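(* Let $(H_n)_{n\in\mathbb{N}}$ be an exchangeable interval hypergraph on $\mathbb{N}$. Then there exists a random compact set $K\subseteq\{(x,y)\in\mathbb{R}^2:0\leq x\leq y\leq 1\}$ with $(x,x)\in K$ for every $x\in[0,1]$ such that, given an i.i.d. sequence $U_1,U_2,\dots$ of random variables uniformly distributed on $[0,1]$ and independent of $K$, the process $(H_n)_{n\in\mathbb{N}}$ has the same distribution as $(H'_n)_{n\in\mathbb{N}}$, where $$H'_n:=\Big\{\big\{i\in[n]:x<U_i<y\big\}:(x,y)\in K\Big\}\cup\Big\{\{j\}:j\in[n]\Big\}\cup\big\{\emptyset\big\}.$$
   Context: $[n]:=\{1,\dots,n\}$ and $\mathbb{N}=\{1,2,\dots\}$. An interval hypergraph on $[n]$ is a set $\mathtt{H}$ of subsets of $[n]$ such that (i) $\emptyset\in\mathtt{H}$ and $\{j\}\in\mathtt{H}$ for all $j\in[n]$, and (ii) there is a linear order $l$ on $[n]$ such that every $e\in\mathtt{H}$ is an interval with respect to $l$ (i.e. if $x,y\in e$ and $z$ lies between $x$ and $y$ with respect to $l$, then $z\in e$). Let $\mathrm{InHy}(n)$ be the (finite) set of all interval hypergraphs on $[n]$. For $k\le n$ and $\mathtt{H}\in\mathrm{InHy}(n)$ let $\mathtt{H}_{|k}:=\{[k]\cap e:e\in\mathtt{H}\}\in\mathrm{InHy}(k)$, and for a permutation $\pi$ of $[n]$ let $\pi(\mathtt{H}):=\{\pi(e):e\in\mathtt{H}\}\in\mathrm{InHy}(n)$. An exchangeable interval hypergraph on $\mathbb{N}$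 is a stochastic process $(H_n)_{n\in\mathbb{N}}$ with $H_n\in\mathrm{InHy}(n)$ and $H_n=(H_{n+1})_{|n}$ almost surely for all $n$, such that for every $n$ and every permutation $\pi$ of $[n]$ the random variables $\pi(H_n)$ and $H_n$ have the same law. A random compact set is a random variable with values in the space of non-empty compact subsets of $\{(x,y):0\le x\le y\le 1\}$ equipped with the Borel $\sigma$-field of the Hausdorff distance. *)

theory Defs
  imports "HOL-Probability.Probability" "HOL-Combinatorics.Permutations"
begin

subsection \<open>Interval hypergraphs on \<open>{1..n}\<close>\<close>

definition interval_wrt :: "('a \<times> 'a) set \<Rightarrow> 'a set \<Rightarrow> 'a set \<Rightarrow> bool" where
  "interval_wrt l A e \<longleftrightarrow>
     e \<subseteq> A \<and> (\<forall>x\<in>e. \<forall>y\<in>e. \<forall>z\<in>A. (x, z) \<in> l \<and> (z, y) \<in> l \<longrightarrow> z \<in> e)"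

definition interval_hypergraph :: "nat \<Rightarrow> nat set set \<Rightarrow> bool" where
  "interval_hypergraph n H \<longleftrightarrow>
     H \<subseteq> Pow {1..n} \<and> {} \<in> H \<and> (\<forall>j\<in>{1..n}. {j} \<in> H) \<and>
     (\<exists>l. linear_order_on {1..n} l \<and> (\<forall>e\<in>H. interval_wrt l {1..n} e))"

definition InHy :: "nat \<Rightarrow> nat set set set" where
  "InHy n = {H. interval_hypergraph n H}"

definition restrict_hypergraph :: "nat \<Rightarrow> nat set set \<Rightarrow> nat set set" where
  "restrict_hypergraph k H = {{1..k} \<inter> e | e. e \<in> H}"

definition permute_hypergraph :: "(nat \<Rightarrow> nat) \<Rightarrow> nat set set \<Rightarrow> nat set set" where
  "permute_hypergraph \<pi> H = {\<pi> ` e | e. e \<in> H}"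

text \<open>Processes are functions of all \<open>n :: nat\<close>, but are only constrained and only looked at for
  \<open>n \<ge> 1\<close>. The finite set \<open>InHy n\<close> carries the discrete \<open>\<sigma>\<close>-field.\<close>

definition exchangeable_interval_hypergraph ::
    "'a measure \<Rightarrow> (nat \<Rightarrow> 'a \<Rightarrow> nat set set) \<Rightarrow> bool" where
  "exchangeable_interval_hypergraph M H \<longleftrightarrow>
     prob_space M \<and>
     (\<forall>n\<ge>1. H n \<in> M \<rightarrow>\<^sub>M count_space (InHy n)) \<and>
     (\<forall>n\<ge>1. AE \<omega> in M. H n \<omega> = restrict_hypergraph n (H (Suc n) \<omega>)) \<and>
     (\<forall>n\<ge>1. \<forall>\<pi>. \<pi> permutes {1..n} \<longrightarrow>
        distr M (count_space (InHy n)) (\<lambda>\<omega>. permute_hypergraph \<pi> (H n \<omega>)) =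
        distr M (count_space (InHy n)) (H n))"

text \<open>The law of a process \<open>(H\<^sub>n)\<close>, \<open>n \<ge> 1\<close>, on the product of the spaces \<open>InHy n\<close>.\<close>

definition process_law :: "'a measure \<Rightarrow> (nat \<Rightarrow> 'a \<Rightarrow> nat set set) \<Rightarrow> (nat \<Rightarrow> nat set set) measure" where
  "process_law M H =
     distr M (\<Pi>\<^sub>M n\<in>{1..}. count_space (InHy n)) (\<lambda>\<omega>. \<lambda>n\<in>{1..}. H n \<omega>)"


subsection \<open>Random compact sets\<close>

text \<open>The guard excludes only arguments for which the suprema below are meaningless.\<close>

definition hausdorff_dist :: "'a::metric_space set \<Rightarrow> 'a set \<Rightarrow> real" where
  "hausdorff_dist A B =
     (if A \<noteq> {} \<and> B \<noteq> {} \<and> bounded A \<and> bounded B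
      then max (SUP a\<in>A. infdist a B) (SUP b\<in>B. infdist b A) else 0)"

definition nonempty_compacts :: "'a::metric_space set \<Rightarrow> 'a set set" where
  "nonempty_compacts S = {K. K \<noteq> {} \<and> compact K \<and> K \<subseteq> S}"

lemma bdd_above_infdist:
  assumes "bounded A" "B \<noteq> {}"
  shows "bdd_above ((\<lambda>a. infdist a B) ` A)"
proof -
  obtain b where b: "b \<in> B" using assms by blast
  obtain e where "\<forall>a\<in>A. dist b a \<le> e"
    using assms(1) bounded_any_center by blast
  with b have "\<forall>a\<in>A. infdist a B \<le> e"
    by (metis dist_commute infdist_le2)
  then show ?thesis by (auto intro: bdd_aboveI)
qed

lemma infdist_triangle_SUP:
  assumes "bounded B" "B \<noteq> {}" "C \<noteq> {}"
  shows "infdist a C \<le> infdist a B + (SUP b\<in>B. infdist b C)"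
proof -
  have "infdist a C - (SUP b\<in>B. infdist b C) \<le> infdist a B"
    unfolding infdist_notempty[OF assms(2)]
  proof (rule cINF_greatest[OF assms(2)])
    fix b assume b: "b \<in> B"
    have "infdist b C \<le> (SUP b\<in>B. infdist b C)"
      by (rule cSUP_upper[OF b bdd_above_infdist[OF assms(1,3)]])
    then show "infdist a C - (SUP b\<in>B. infdist b C) \<le> dist a b"
      using infdist_triangle[of a C b] by linarith
  qed
  then show ?thesis by linarith
qed

lemma SUP_infdist_triangle:
  assumes "bounded A" "A \<noteq> {}" "bounded B" "B \<noteq> {}" "C \<noteq> {}"
  shows "(SUP a\<in>A. infdist a C) \<le> (SUP a\<in>A. infdist a B) + (SUP b\<in>B. infdist b C)"
proof (rule cSUP_least[OF assms(2)])
  fix a assume a: "a \<in> A"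
  show "infdist a C \<le> (SUP a\<in>A. infdist a B) + (SUP b\<in>B. infdist b C)"
    using infdist_triangle_SUP[OF assms(3,4,5), of a]
      cSUP_upper[OF a bdd_above_infdist[OF assms(1,4)]] by linarith
qed

lemma SUP_infdist_nonneg:
  assumes "bounded A" "A \<noteq> {}" "B \<noteq> {}"
  shows "0 \<le> (SUP a\<in>A. infdist a B)"
proof -
  obtain a where "a \<in> A" using assms by blast
  from cSUP_upper[OF this bdd_above_infdist[OF assms(1,3)]] show ?thesis
    using infdist_nonneg[of a B] by linarith
qed

lemma SUP_infdist_0_subset:
  assumes "bounded A" "closed B" "B \<noteq> {}" "(SUP a\<in>A. infdist a B) \<le> 0"
  shows "A \<subseteq> B"
proof
  fix a assume a: "a \<in> A"
  have "infdist a B \<le> 0"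
    using cSUP_upper[OF a bdd_above_infdist[OF assms(1,3)]] assms(4) by linarith
  then show "a \<in> B"
    using infdist_nonneg[of a B] in_closed_iff_infdist_zero[OF assms(2,3)] by force
qed

lemma Metric_space_hausdorff: "Metric_space (nonempty_compacts S) hausdorff_dist"
proof
  fix A B :: "'a set"
  show "0 \<le> hausdorff_dist A B"
    unfolding hausdorff_dist_def using SUP_infdist_nonneg[of A B] by (auto simp: le_max_iff_disj)
  show "hausdorff_dist A B = hausdorff_dist B A"
    unfolding hausdorff_dist_def by (auto simp: max.commute)
next
  fix A B :: "'a set"
  assume "A \<in> nonempty_compacts S" "B \<in> nonempty_compacts S"
  then have *: "A \<noteq> {}" "B \<noteq> {}" "bounded A" "bounded B" "closed A" "closed B"
    by (auto simp: nonempty_compacts_def compact_imp_bounded compact_imp_closed)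
  show "hausdorff_dist A B = 0 \<longleftrightarrow> A = B"
  proof
    assume "hausdorff_dist A B = 0"
    with * have m: "max (SUP a\<in>A. infdist a B) (SUP b\<in>B. infdist b A) = 0"
      by (simp add: hausdorff_dist_def)
    have "A \<subseteq> B" by (rule SUP_infdist_0_subset) (use * m in \<open>auto simp: max_def split: if_splits\<close>)
    moreover have "B \<subseteq> A"
      by (rule SUP_infdist_0_subset) (use * m in \<open>auto simp: max_def split: if_splits\<close>)
    ultimately show "A = B" by blast
  next
    assume "A = B"
    moreover have "(SUP a\<in>A. infdist a A) = (SUP a\<in>A. 0)" by (rule SUP_cong) auto
    ultimately show "hausdorff_dist A B = 0" using * by (simp add: hausdorff_dist_def)
  qed
next
  fix A B C :: "'a set"
  assume "A \<in> nonempty_compacts S" "B \<in> nonempty_compacts S" "C \<in> nonempty_compacts S"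
  then have *: "A \<noteq> {}" "B \<noteq> {}" "C \<noteq> {}" "bounded A" "bounded B" "bounded C"
    by (auto simp: nonempty_compacts_def compact_imp_bounded)
  show "hausdorff_dist A C \<le> hausdorff_dist A B + hausdorff_dist B C"
    using SUP_infdist_triangle[of A B C] SUP_infdist_triangle[of C B A] *
    by (simp add: hausdorff_dist_def max_def)
qed

definition hausdorff_borel :: "'a::metric_space set \<Rightarrow> 'a set measure" where
  "hausdorff_borel S =
     sigma (nonempty_compacts S)
       {\<U>. openin (Metric_space.mtopology (nonempty_compacts S) hausdorff_dist) \<U>}"

definition triangle :: "(real \<times> real) set" where
  "triangle = {(x, y). 0 \<le> x \<and> x \<le> y \<and> y \<le> 1}"

definition random_compact_set :: "'b measure \<Rightarrow> ('b \<Rightarrow> (real \<times> real) set) \<Rightarrow> bool" where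
  "random_compact_set N K \<longleftrightarrow> K \<in> N \<rightarrow>\<^sub>M hausdorff_borel triangle"


subsection \<open>Sampling from a compact set\<close>

text \<open>\<open>U 0\<close> plays no role: the sequence is \<open>U 1, U 2, \<dots>\<close>.\<close>

definition iid_uniform :: "'b measure \<Rightarrow> (nat \<Rightarrow> 'b \<Rightarrow> real) \<Rightarrow> bool" where
  "iid_uniform N U \<longleftrightarrow>
     prob_space.indep_vars N (\<lambda>_. borel) U {1..} \<and>
     (\<forall>i\<ge>1. distr N borel (U i) = uniform_measure lborel {0..1})"

text \<open>Independence of the generated \<open>\<sigma>\<close>-fields. The library's \<open>indep_var\<close> is not applicable, as
  \<open>K\<close> and \<open>(U i)\<^sub>i\<close> have values in different types.\<close>

definition indep_of_sequence ::
    "'b measure \<Rightarrow> ('b \<Rightarrow> (real \<times> real) set) \<Rightarrow> (nat \<Rightarrow> 'b \<Rightarrow> real) \<Rightarrow> bool" where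
  "indep_of_sequence N K U \<longleftrightarrow>
     prob_space.indep_set N
       (sets (vimage_algebra (space N) K (hausdorff_borel triangle)))
       (sets (vimage_algebra (space N) (\<lambda>\<omega>. \<lambda>i\<in>{1..}. U i \<omega>) (\<Pi>\<^sub>M i\<in>{1::nat..}. borel)))"

definition sampled_hypergraph :: "(real \<times> real) set \<Rightarrow> (nat \<Rightarrow> real) \<Rightarrow> nat \<Rightarrow> nat set set" where
  "sampled_hypergraph K u n =
     {{i \<in> {1..n}. x < u i \<and> u i < y} | x y. (x, y) \<in> K} \<union> {{j} | j. j \<in> {1..n}} \<union> {{}}"

end

theory Submission
  imports Defs
begin

text \<open>
  The random compact set is obtained as a limit of compact sets that encode the finite hypergraphs
  \<open>H n\<close>. Four ideas carry the proof.

  \<^emph>\<open>Encoding.\<close> List the vertices of an interval hypergraph on \<open>{1..n}\<close> in a compatible order, cut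
  \<open>[0, 1]\<close> into \<open>n\<close> cells of equal length, and turn a hyperedge that occupies the positions
  \<open>a, \<dots>, b\<close> into the point \<open>((a - 1) / n, b / n)\<close>; call the set of these points, together with the
  diagonal, \<open>embedded n h\<close>. Uniform points \<open>u 1, \<dots>, u k\<close> in different cells select
  \<open>k\<close> different vertices, and sampling from \<open>embedded n h\<close> returns the hypergraph that \<open>h\<close> induces on
  them (\<open>sample_embedded\<close>). The selected tuple is a uniform injection, whatever compatible order has
  been chosen, because the position map is a bijection. An injection extends to a permutation, so by
  exchangeability the induced subhypergraph of \<open>H n\<close> has the law of \<open>H k\<close>. Thus the hypergraph
  sampled from \<open>embedded n (H n)\<close> equals \<open>g\<close> with probability at least \<open>P (H k = g)\<close> times the
  probability that the cells are different, and the latter tends to \<open>1\<close>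
  (\<open>expected_sample_prob_ge\<close>, \<open>card_injections_ratio\<close>).

  \<^emph>\<open>Compactness.\<close> A compact subset of the triangle is determined by the grid cells that it meets, and
  so by a point of the Cantor set, in such a way that close codes belong to close sets. Helly's
  selection theorem and Skorohod's theorem for real random variables then realise a subsequence of the
  random sets \<open>embedded n (H n)\<close> on one probability space so that it converges in the
  Hausdorff distance at every point (\<open>compact_set_Skorohod\<close>).

  \<^emph>\<open>Continuity.\<close> For fixed \<open>k\<close> and \<open>g\<close>, the probability \<open>sample_prob k g K\<close> that sampling from \<open>K\<close>
  yields \<open>g\<close> is a continuous function of \<open>K\<close> (\<open>sample_prob_continuous\<close>). This is the delicate point:
  a sample point may well be a coordinate of some point \<open>p\<close> of \<open>K\<close>, and then the trace of \<open>p\<close> is not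
  stable under perturbation. But for almost all samples \<open>K\<close> has points near \<open>p\<close> on every side of
  the coordinates in question (\<open>AE_generic\<close>), and these have stable traces. The exceptional samples
  are null because the points that \<open>K\<close> does not approach from a prescribed side project to a
  countable set, and those that it does not approach from a prescribed quadrant form a set meeting
  every line of slope \<open>1\<close>, or of slope \<open>-1\<close>, in a countable set.

  \<^emph>\<open>Conclusion.\<close> In the limit, sampling yields \<open>g\<close> with probability at least \<open>P (H k = g)\<close> for every
  \<open>g \<in> InHy k\<close>; both sides sum to \<open>1\<close>, so they agree (\<open>limiting_random_compact_set\<close>). Sampling is jointly
  measurable in the set and the sample (\<open>measurable_sampled_hypergraph\<close>), so this is a statement
  about every sequence \<open>U\<close> that is uniform and independent of the random set (\<open>joint_law\<close>); and
  consistent processes have equal laws if their one-dimensional marginals agree (\<open>process_law_eqI\<close>).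
\<close>

section \<open>The Hausdorff distance\<close>

lemma hausdorff_dist_leI:
  assumes "A \<in> nonempty_compacts S" "B \<in> nonempty_compacts S"
    and "\<And>a. a \<in> A \<Longrightarrow> \<exists>b\<in>B. dist a b \<le> e"
    and "\<And>b. b \<in> B \<Longrightarrow> \<exists>a\<in>A. dist b a \<le> e"
  shows "hausdorff_dist A B \<le> e"
proof -
  have *: "A \<noteq> {}" "B \<noteq> {}" "bounded A" "bounded B"
    using assms by (auto simp: nonempty_compacts_def compact_imp_bounded)
  have "(SUP a\<in>A. infdist a B) \<le> e"
    by (rule cSUP_least[OF *(1)]) (meson assms(3) infdist_le2)
  moreover have "(SUP a\<in>B. infdist a A) \<le> e"
    by (rule cSUP_least[OF *(2)]) (meson assms(4) infdist_le2)
  ultimately show ?thesis using * by (simp add: hausdorff_dist_def)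
qed

lemma hausdorff_dist_lessD:
  assumes "A \<in> nonempty_compacts S" "B \<in> nonempty_compacts S" "hausdorff_dist A B < e" "a \<in> A"
  shows "\<exists>b\<in>B. dist a b < e"
proof -
  have *: "A \<noteq> {}" "B \<noteq> {}" "bounded A" "bounded B"
    using assms by (auto simp: nonempty_compacts_def compact_imp_bounded)
  have "infdist a B \<le> (SUP a\<in>A. infdist a B)"
    by (rule cSUP_upper[OF assms(4) bdd_above_infdist]) (use * in auto)
  with assms(3) * have "infdist a B < e" by (simp add: hausdorff_dist_def)
  then show ?thesis
    using * cINF_less_iff[of B "dist a" e] by (auto simp: infdist_notempty)
qed

lemma hausdorff_dist_commute: "hausdorff_dist A B = hausdorff_dist B A"
  using Metric_space.commute[OF Metric_space_hausdorff] .

text \<open>The limit consists of the accumulation points of the tails: by compactness of \<open>S\<close>, nearby points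
  selected from the later sets have such an accumulation point.\<close>

lemma hausdorff_Cauchy_convergent:
  assumes S: "compact S" and A: "\<And>n. A n \<in> nonempty_compacts S"
    and cauchy: "\<And>e::real. e > 0 \<Longrightarrow> \<exists>N. \<forall>m\<ge>N. \<forall>n\<ge>N. hausdorff_dist (A m) (A n) < e"
  obtains L where "L \<in> nonempty_compacts S" "(\<lambda>n. hausdorff_dist (A n) L) \<longlonglongrightarrow> 0"
proof -
  define L where "L = (\<Inter>n. closure (\<Union>m\<in>{n..}. A m))"
  have AS: "A n \<subseteq> S" for n using A by (auto simp: nonempty_compacts_def)
  have near1: "\<exists>p\<in>L. dist a p \<le> e"
    if N: "\<forall>m\<ge>N. \<forall>n\<ge>N. hausdorff_dist (A m) (A n) < e" and n: "n \<ge> N" "a \<in> A n" for e N n a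
  proof -
    have "\<exists>b. b \<in> A (N + m) \<and> dist a b \<le> e" for m
      using hausdorff_dist_lessD[OF A A _ n(2), of "N + m" e] N n(1) by force
    then obtain b where b: "\<And>m. b m \<in> A (N + m)" "\<And>m. dist a (b m) \<le> e" by metis
    have "\<forall>m. b m \<in> S" using b(1) AS by blast
    then obtain p r where r: "p \<in> S" "strict_mono r" "(b \<circ> r) \<longlonglongrightarrow> p"
      using S[unfolded compact_def] by blast
    have "p \<in> closure (\<Union>m\<in>{k..}. A m)" for k
    proof (rule Lim_in_closed_set[OF closed_closure _ _ r(3)])
      show "\<forall>\<^sub>F x in sequentially. (b \<circ> r) x \<in> closure (\<Union>m\<in>{k..}. A m)"
      proof (rule eventually_sequentiallyI[of k])
        fix x assume "k \<le> x"
        also have "x \<le> r x" by (rule seq_suble[OF r(2)])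
        finally have "(b \<circ> r) x \<in> (\<Union>m\<in>{k..}. A m)" using b(1)[of "r x"] by auto
        then show "(b \<circ> r) x \<in> closure (\<Union>m\<in>{k..}. A m)" by (rule subsetD[OF closure_subset])
      qed
    qed simp
    then have "p \<in> L" by (auto simp: L_def)
    moreover have "dist a p \<le> e"
    proof (rule Lim_dist_ubound[OF _ r(3)])
      show "\<forall>\<^sub>F x in sequentially. dist a ((b \<circ> r) x) \<le> e" using b(2) by simp
    qed simp
    ultimately show ?thesis by blast
  qed
  have near2: "\<exists>b\<in>A n. dist p b \<le> 2 * e"
    if N: "\<forall>m\<ge>N. \<forall>n\<ge>N. hausdorff_dist (A m) (A n) < e" and e: "e > 0" and n: "n \<ge> N" "p \<in> L"
    for e N n p
  proof -
    have "p \<in> closure (\<Union>m\<in>{N..}. A m)" using n by (auto simp: L_def)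
    then obtain q m where q: "m \<ge> N" "q \<in> A m" "dist q p < e"
      using e by (fastforce simp: closure_approachable)
    obtain b where "b \<in> A n" "dist q b < e"
      using hausdorff_dist_lessD[OF A A _ q(2), of n e] N n(1) q(1) by blast
    moreover from this have "dist p b \<le> 2 * e"
      using q dist_triangle3[of p b q] dist_commute[of q b] by linarith
    ultimately show ?thesis by blast
  qed
  have L: "L \<in> nonempty_compacts S"
  proof -
    obtain N where N: "\<forall>m\<ge>N. \<forall>n\<ge>N. hausdorff_dist (A m) (A n) < 1" using cauchy[of 1] by auto
    obtain a where "a \<in> A N" using A[of N] by (auto simp: nonempty_compacts_def)
    with near1[OF N, of N a] have "L \<noteq> {}" by auto
    moreover have "closed L" unfolding L_def by auto
    moreover have "L \<subseteq> closure (\<Union>m\<in>{0..}. A m)" unfolding L_def by (rule INF_lower) simp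
    then have "L \<subseteq> S" using AS closure_minimal[of "\<Union>m\<in>{0..}. A m" S] compact_imp_closed[OF S] by blast
    ultimately show ?thesis
      using compact_Int_closed[OF S, of L] by (simp add: nonempty_compacts_def inf_absorb2)
  qed
  moreover have "(\<lambda>n. hausdorff_dist (A n) L) \<longlonglongrightarrow> 0"
  proof (rule LIMSEQ_I)
    fix e :: real assume e: "e > 0"
    obtain N where N: "\<forall>m\<ge>N. \<forall>n\<ge>N. hausdorff_dist (A m) (A n) < e / 4" using cauchy[of "e/4"] e by auto
    have "norm (hausdorff_dist (A n) L - 0) < e" if "n \<ge> N" for n
    proof -
      have "hausdorff_dist (A n) L \<le> e / 2"
      proof (rule hausdorff_dist_leI[OF A L])
        fix a assume "a \<in> A n"
        then show "\<exists>b\<in>L. dist a b \<le> e / 2" using near1[OF N that, of a] e by force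
      next
        fix a assume "a \<in> L"
        then show "\<exists>b\<in>A n. dist a b \<le> e / 2" using near2[OF N _ that, of a] e by force
      qed
      moreover have "hausdorff_dist (A n) L \<ge> 0"
        using Metric_space.nonneg[OF Metric_space_hausdorff] .
      ultimately show ?thesis using e by simp
    qed
    then show "\<exists>no. \<forall>n\<ge>no. norm (hausdorff_dist (A n) L - 0) < e" by blast
  qed
  ultimately show ?thesis using that by blast
qed

lemma hausdorff_limit_superset:
  assumes A: "\<And>n. A n \<in> nonempty_compacts S" "\<And>n. D \<subseteq> A n" and L: "L \<in> nonempty_compacts S"
    and lim: "(\<lambda>n. hausdorff_dist (A n) L) \<longlonglongrightarrow> 0"
  shows "D \<subseteq> L"
proof
  fix p assume p: "p \<in> D"
  have "\<exists>q\<in>L. dist q p < e" if e: "e > 0" for e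
  proof -
    obtain n where "hausdorff_dist (A n) L < e"
      using order_tendstoD(2)[OF lim e] by (auto simp: eventually_sequentially)
    from hausdorff_dist_lessD[OF A(1) L this, of p] A(2) p show ?thesis by (auto simp: dist_commute)
  qed
  then have "p \<in> closure L" by (simp add: closure_approachable)
  moreover have "closed L" using L by (auto simp: nonempty_compacts_def compact_imp_closed)
  ultimately show "p \<in> L" by simp
qed

lemma hausdorff_open_subset:
  "{\<U>. openin (Metric_space.mtopology (nonempty_compacts S) hausdorff_dist) \<U>}
     \<subseteq> Pow (nonempty_compacts S)"
  using Metric_space.openin_mtopology[OF Metric_space_hausdorff, of S] by blast

lemma space_hausdorff_borel [simp]: "space (hausdorff_borel S) = nonempty_compacts S"
  unfolding hausdorff_borel_def by (rule space_measure_of[OF hausdorff_open_subset])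

lemma sets_hausdorff_borel:
  "sets (hausdorff_borel S) = sigma_sets (nonempty_compacts S)
     {\<U>. openin (Metric_space.mtopology (nonempty_compacts S) hausdorff_dist) \<U>}"
  unfolding hausdorff_borel_def by (rule sets_measure_of[OF hausdorff_open_subset])

lemma hitting_set_measurable:
  assumes "open U"
  shows "{K \<in> nonempty_compacts S. K \<inter> U \<noteq> {}} \<in> sets (hausdorff_borel S)"
proof -
  interpret Metric_space "nonempty_compacts S" hausdorff_dist by (rule Metric_space_hausdorff)
  have "openin mtopology {K \<in> nonempty_compacts S. K \<inter> U \<noteq> {}}"
    unfolding openin_mtopology
  proof (intro conjI allI impI)
    fix K assume K: "K \<in> {K \<in> nonempty_compacts S. K \<inter> U \<noteq> {}}"
    then obtain p where p: "p \<in> K" "p \<in> U" by auto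
    then obtain r where r: "r > 0" "ball p r \<subseteq> U" using assms openE by blast
    have "mball K r \<subseteq> {K \<in> nonempty_compacts S. K \<inter> U \<noteq> {}}"
    proof
      fix L assume "L \<in> mball K r"
      then have L: "L \<in> nonempty_compacts S" "hausdorff_dist K L < r" by auto
      obtain q where "q \<in> L" "dist p q < r" using hausdorff_dist_lessD[OF _ L p(1)] K by auto
      then show "L \<in> {K \<in> nonempty_compacts S. K \<inter> U \<noteq> {}}" using L r by (auto simp: subset_iff)
    qed
    with r show "\<exists>r>0. mball K r \<subseteq> {K \<in> nonempty_compacts S. K \<inter> U \<noteq> {}}" by blast
  qed auto
  then show ?thesis unfolding sets_hausdorff_borel by auto
qed

text \<open>A limit of random sets lies in an open set \<open>U\<close> iff, for some radius, the balls of this radius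
  around the approximants eventually lie in \<open>U\<close>. This writes the preimage of \<open>U\<close> in terms of
  countably many events about the approximants.\<close>

lemma measurable_hausdorff_limit:
  assumes Z: "\<And>n. Z n \<in> M \<rightarrow>\<^sub>M count_space (nonempty_compacts S)"
    and L: "\<And>\<omega>. \<omega> \<in> space M \<Longrightarrow> L \<omega> \<in> nonempty_compacts S"
    and lim: "\<And>\<omega>. \<omega> \<in> space M \<Longrightarrow> (\<lambda>n. hausdorff_dist (Z n \<omega>) (L \<omega>)) \<longlonglongrightarrow> 0"
  shows "L \<in> M \<rightarrow>\<^sub>M hausdorff_borel S"
  unfolding hausdorff_borel_def
proof (rule measurable_measure_of)
  interpret Metric_space "nonempty_compacts S" hausdorff_dist by (rule Metric_space_hausdorff)
  show "{\<U>. openin mtopology \<U>} \<subseteq> Pow (nonempty_compacts S)"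
    by (auto dest!: openin_subset)
  show "L \<in> space M \<rightarrow> nonempty_compacts S" using L by auto
  fix U assume "U \<in> {\<U>. openin mtopology \<U>}"
  then have U: "U \<subseteq> nonempty_compacts S" "\<And>x. x \<in> U \<Longrightarrow> \<exists>r>0. mball x r \<subseteq> U"
    by (auto simp: openin_mtopology)
  define V where "V r = {A \<in> nonempty_compacts S. mball A (1 / real (Suc r)) \<subseteq> U}" for r
  have iff: "L \<omega> \<in> U \<longleftrightarrow> (\<exists>r k. \<forall>n\<in>{k..}. Z n \<omega> \<in> V r)" if w: "\<omega> \<in> space M" for \<omega>
  proof
    have ZS: "Z n \<omega> \<in> nonempty_compacts S" for n
      using measurable_space[OF Z w] by simp
    {
      assume "L \<omega> \<in> U"
      then obtain s where s: "s > 0" "mball (L \<omega>) s \<subseteq> U" using U by blast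
      obtain r where r: "1 / real (Suc r) < s / 2" using s nat_approx_posE[of "s/2"] by auto
      have "\<forall>\<^sub>F n in sequentially. hausdorff_dist (Z n \<omega>) (L \<omega>) < s / 2"
        using order_tendstoD(2)[OF lim[OF w], of "s/2"] s by simp
      then obtain k where k: "\<And>n. n \<ge> k \<Longrightarrow> hausdorff_dist (Z n \<omega>) (L \<omega>) < s / 2"
        by (auto simp: eventually_sequentially)
      have "Z n \<omega> \<in> V r" if "n \<ge> k" for n
      proof -
        have "mball (Z n \<omega>) (1 / real (Suc r)) \<subseteq> mball (L \<omega>) s"
        proof
          fix B assume "B \<in> mball (Z n \<omega>) (1 / real (Suc r))"
          then have B: "B \<in> nonempty_compacts S" "hausdorff_dist (Z n \<omega>) B < 1 / real (Suc r)" by auto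
          have "hausdorff_dist (L \<omega>) B < s"
            using triangle[OF L[OF w] ZS B(1), of n] B(2) r k[OF that] commute[of "L \<omega>" "Z n \<omega>"] by linarith
          then show "B \<in> mball (L \<omega>) s" using B L[OF w] by auto
        qed
        then show ?thesis using s ZS by (auto simp: V_def)
      qed
      then show "\<exists>r k. \<forall>n\<in>{k..}. Z n \<omega> \<in> V r" by auto
    }
    {
      assume "\<exists>r k. \<forall>n\<in>{k..}. Z n \<omega> \<in> V r"
      then obtain r k where k: "\<And>n. n \<ge> k \<Longrightarrow> Z n \<omega> \<in> V r" by auto
      have "\<forall>\<^sub>F n in sequentially. hausdorff_dist (Z n \<omega>) (L \<omega>) < 1 / real (Suc r)"
        using order_tendstoD(2)[OF lim[OF w], of "1 / real (Suc r)"] by simp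
      then have "\<forall>\<^sub>F n in sequentially. hausdorff_dist (Z n \<omega>) (L \<omega>) < 1 / real (Suc r) \<and> n \<ge> k"
        using eventually_ge_at_top by (rule eventually_conj)
      then obtain n where n: "hausdorff_dist (Z n \<omega>) (L \<omega>) < 1 / real (Suc r)" "n \<ge> k"
        by (auto simp: eventually_sequentially)
      then have "L \<omega> \<in> mball (Z n \<omega>) (1 / real (Suc r))" using ZS L[OF w] by auto
      then show "L \<omega> \<in> U" using k[OF n(2)] by (auto simp: V_def)
    }
  qed
  have "L -` U \<inter> space M = {\<omega>\<in>space M. \<exists>r k. \<forall>n\<in>{k..}. Z n \<omega> \<in> V r}"
    using iff by (simp add: vimage_def Int_def conj_commute cong: conj_cong)
  also have "\<dots> \<in> sets M"
  proof (intro sets.sets_Collect_countable_Ex sets.sets_Collect_countable_Ball)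
    fix r n
    have "Z n -` V r \<inter> space M \<in> sets M"
      by (rule measurable_sets[OF Z]) (auto simp: V_def)
    then show "{\<omega>\<in>space M. Z n \<omega> \<in> V r} \<in> sets M"
      by (simp add: vimage_def Int_def conj_commute)
  qed
  finally show "L -` U \<inter> space M \<in> sets M" .
qed

section \<open>Coding compact sets by points of the Cantor set\<close>

definition cantor_sum :: "(nat \<Rightarrow> bool) \<Rightarrow> real" where
  "cantor_sum b = (\<Sum>i. 2 * of_bool (b i) * (1 / 3) ^ Suc i)"

lemma summable_cantor: "summable (\<lambda>i. 2 * of_bool (b i) * (1 / 3 :: real) ^ Suc i)"
proof (rule summable_comparison_test')
  show "summable (\<lambda>i. 2 * (1 / 3 :: real) ^ Suc i)"
    using summable_mult[OF summable_geometric[of "1 / 3 :: real"], of "2 / 3"] by simp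
qed (auto simp: abs_mult)

lemma suminf_third: "(\<Sum>i. 2 * (1 / 3 :: real) ^ Suc (i + m)) = (1 / 3) ^ m"
proof -
  have "(\<lambda>i. (2 * (1 / 3) ^ Suc m) * (1 / 3 :: real) ^ i) sums ((2 * (1 / 3) ^ Suc m) * (1 / (1 - 1 / 3)))"
    by (intro sums_mult geometric_sums) auto
  then show ?thesis by (simp add: sums_iff power_add mult_ac)
qed

lemma cantor_tail_bounds:
  "0 \<le> (\<Sum>i. 2 * of_bool (b (i + m)) * (1 / 3 :: real) ^ Suc (i + m))"
  "(\<Sum>i. 2 * of_bool (b (i + m)) * (1 / 3 :: real) ^ Suc (i + m)) \<le> (1 / 3) ^ m"
proof -
  have s: "summable (\<lambda>i. 2 * of_bool (b (i + m)) * (1 / 3 :: real) ^ Suc (i + m))"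
    using summable_ignore_initial_segment[OF summable_cantor[of b], of m] by simp
  have s': "summable (\<lambda>i. 2 * (1 / 3 :: real) ^ Suc (i + m))"
    using summable_ignore_initial_segment[OF summable_cantor[of "\<lambda>_. True"], of m] by simp
  show "0 \<le> (\<Sum>i. 2 * of_bool (b (i + m)) * (1 / 3 :: real) ^ Suc (i + m))"
    by (rule suminf_nonneg[OF s]) auto
  have "(\<Sum>i. 2 * of_bool (b (i + m)) * (1 / 3 :: real) ^ Suc (i + m)) \<le> (\<Sum>i. 2 * (1 / 3 :: real) ^ Suc (i + m))"
    by (rule suminf_le[OF _ s s']) auto
  then show "(\<Sum>i. 2 * of_bool (b (i + m)) * (1 / 3 :: real) ^ Suc (i + m)) \<le> (1 / 3) ^ m"
    by (simp only: suminf_third)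
qed

lemma cantor_sum_bounds: "0 \<le> cantor_sum b" "cantor_sum b \<le> 1"
  using cantor_tail_bounds[of b 0] by (simp_all add: cantor_sum_def)

text \<open>At the first digit in which two codes differ, the gap of the Cantor set exceeds what the
  later digits can make up for.\<close>

lemma cantor_sum_close_imp_eq:
  assumes close: "\<bar>cantor_sum b - cantor_sum c\<bar> < (1 / 3) ^ m" and "i < m"
  shows "b i = c i"
proof (rule ccontr)
  assume "b i \<noteq> c i"
  define P where "P j \<longleftrightarrow> b j \<noteq> c j" for j
  define j where "j = (LEAST j. P j)"
  have "P i" using \<open>b i \<noteq> c i\<close> by (simp add: P_def)
  then have "P j" "j \<le> i" unfolding j_def by (rule LeastI, rule Least_le)
  moreover have "\<not> P l" if "l < j" for l using that unfolding j_def by (rule not_less_Least)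
  ultimately have j: "b j \<noteq> c j" "j \<le> i" "\<And>l. l < j \<Longrightarrow> b l = c l" by (auto simp: P_def)
  define T where "T b = (\<Sum>l. 2 * of_bool (b (l + Suc j)) * (1 / 3 :: real) ^ Suc (l + Suc j))" for b
  have split: "cantor_sum b = T b + 2 * of_bool (b j) * (1 / 3) ^ Suc j + (\<Sum>l<j. 2 * of_bool (b l) * (1 / 3) ^ Suc l)" for b
    using suminf_split_initial_segment[OF summable_cantor[of b], of "Suc j"]
    by (simp add: cantor_sum_def T_def)
  have eq: "(\<Sum>l<j. 2 * of_bool (b l) * (1 / 3 :: real) ^ Suc l) = (\<Sum>l<j. 2 * of_bool (c l) * (1 / 3) ^ Suc l)"
    by (rule sum.cong) (auto simp: j(3))
  have "\<bar>cantor_sum b - cantor_sum c\<bar> \<ge> (1 / 3) ^ Suc j"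
    using cantor_tail_bounds[of b "Suc j"] cantor_tail_bounds[of c "Suc j"] j(1)
    unfolding split[of b] split[of c] eq T_def[symmetric] by (cases "b j"; cases "c j") auto
  moreover have "(1 / 3 :: real) ^ m \<le> (1 / 3) ^ Suc j"
    using j(2) \<open>i < m\<close> by (intro power_decreasing) auto
  ultimately show False using close by linarith
qed

text \<open>The cells of the square grids of all mesh sizes \<open>1 / m\<close>, encoded by the mesh and the integer
  coordinates.\<close>

definition hits_cell :: "(real \<times> real) set \<Rightarrow> nat \<times> int \<times> int \<Rightarrow> bool" where
  "hits_cell K = (\<lambda>(m, a, b). \<exists>(x, y)\<in>K. \<lfloor>real m * x\<rfloor> = a \<and> \<lfloor>real m * y\<rfloor> = b)"

definition set_code :: "(real \<times> real) set \<Rightarrow> real" where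
  "set_code K = cantor_sum (\<lambda>i. hits_cell K (from_nat i))"

lemma dist_le_of_same_cell:
  fixes x y :: "real \<times> real"
  assumes "m > 0" "\<lfloor>real m * fst x\<rfloor> = \<lfloor>real m * fst y\<rfloor>" "\<lfloor>real m * snd x\<rfloor> = \<lfloor>real m * snd y\<rfloor>"
  shows "dist x y \<le> 2 / real m"
proof -
  have *: "\<bar>s - t\<bar> \<le> 1 / real m" if "\<lfloor>real m * s\<rfloor> = \<lfloor>real m * t\<rfloor>" for s t
  proof -
    have "\<bar>real m * s - real m * t\<bar> \<le> 1" using that by linarith
    then have "real m * \<bar>s - t\<bar> \<le> 1" by (simp add: abs_mult flip: right_diff_distrib)
    then show ?thesis using assms(1) by (simp add: field_simps)
  qed
  have "dist x y \<le> \<bar>fst x - fst y\<bar> + \<bar>snd x - snd y\<bar>"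
    using sqrt_sum_squares_le_sum_abs[of "fst x - fst y" "snd x - snd y"]
    by (simp add: dist_prod_def dist_real_def)
  also have "\<dots> \<le> 1 / real m + 1 / real m" using assms by (intro add_mono *) auto
  finally show ?thesis by simp
qed

text \<open>Two sets meeting the same cells of a fine grid are close, and the finitely many cells in
  question are decided by finitely many digits of the code.\<close>

lemma set_code_close:
  assumes "e > 0"
  obtains d where "d > 0" "\<And>K L. K \<in> nonempty_compacts triangle \<Longrightarrow> L \<in> nonempty_compacts triangle \<Longrightarrow>
     \<bar>set_code K - set_code L\<bar> < d \<Longrightarrow> hausdorff_dist K L < e"
proof -
  obtain m :: nat where m: "m > 0" "2 / real m < e"
  proof -
    obtain n where "1 / real (Suc n) < e / 2" using nat_approx_posE[of "e/2"] assms by auto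
    then show ?thesis using that[of "Suc n"] by simp
  qed
  define C where "C = {m} \<times> {0..int m} \<times> {0..int m}"
  have fin: "finite (to_nat ` C)" unfolding C_def by auto
  define M where "M = Suc (Max (to_nat ` C))"
  have M: "to_nat c < M" if "c \<in> C" for c
    using Max_ge[OF fin, of "to_nat c"] that by (auto simp: M_def)
  have half: "\<exists>b\<in>L. dist a b \<le> 2 / real m"
    if K: "K \<in> nonempty_compacts triangle"
      and cl: "\<bar>set_code K - set_code L\<bar> < (1 / 3) ^ M" and a: "a \<in> K" for K L a
  proof -
    obtain x y where xy: "a = (x, y)" by (cases a)
    with a K have tri: "0 \<le> x" "x \<le> 1" "0 \<le> y" "y \<le> 1"
      by (auto simp: nonempty_compacts_def triangle_def)
    define c where "c = (m, \<lfloor>real m * x\<rfloor>, \<lfloor>real m * y\<rfloor>)"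
    have "\<lfloor>real m * z\<rfloor> \<in> {0..int m}" if "0 \<le> z" "z \<le> 1" for z
      using that mult_left_le[of z "real m"] by (auto simp: floor_le_iff) 
    then have "c \<in> C" using tri by (auto simp: c_def C_def)
    from M[OF this] cl have "hits_cell K (from_nat (to_nat c)) = hits_cell L (from_nat (to_nat c))"
      unfolding set_code_def by (rule cantor_sum_close_imp_eq[rotated])
    moreover have "hits_cell K c" using a by (auto simp: hits_cell_def c_def xy)
    ultimately have "hits_cell L c" by simp
    then obtain x' y' where "(x', y') \<in> L" "\<lfloor>real m * x'\<rfloor> = \<lfloor>real m * x\<rfloor>" "\<lfloor>real m * y'\<rfloor> = \<lfloor>real m * y\<rfloor>"
      by (auto simp: hits_cell_def c_def)
    then show ?thesis using dist_le_of_same_cell[OF m(1), of "(x, y)" "(x', y')"] by (auto simp: xy)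
  qed
  show ?thesis
  proof (rule that[of "(1 / 3) ^ M"])
    fix K L assume KL: "K \<in> nonempty_compacts triangle" "L \<in> nonempty_compacts triangle"
      and cl: "\<bar>set_code K - set_code L\<bar> < (1 / 3) ^ M"
    have "hausdorff_dist K L \<le> 2 / real m"
      by (rule hausdorff_dist_leI[OF KL]) (use half KL cl in \<open>auto simp: abs_minus_commute\<close>)
    with m show "hausdorff_dist K L < e" by simp
  qed auto
qed

lemma inj_on_set_code: "inj_on set_code (nonempty_compacts triangle)"
proof (rule inj_onI, rule ccontr)
  fix K L assume KL: "K \<in> nonempty_compacts triangle" "L \<in> nonempty_compacts triangle"
    and eq: "set_code K = set_code L" and ne: "K \<noteq> L"
  have "hausdorff_dist K L > 0"
    using Metric_space.mdist_pos_less[OF Metric_space_hausdorff ne KL] .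
  then obtain d where "d > 0" "\<bar>set_code K - set_code L\<bar> < d \<Longrightarrow> hausdorff_dist K L < hausdorff_dist K L"
    using set_code_close[of "hausdorff_dist K L"] KL by metis
  with eq show False by auto
qed

lemma compact_triangle: "compact triangle"
proof -
  have "triangle = ({0..1} \<times> {0..1}) \<inter> {p. fst p \<le> snd p}"
    by (auto simp: triangle_def)
  moreover have "closed {p :: real \<times> real. fst p \<le> snd p}"
    by (intro closed_Collect_le continuous_intros)
  moreover have "compact ({0..1::real} \<times> {0..1::real})" by (intro compact_Times) auto
  ultimately show ?thesis using compact_Int_closed by metis
qed

section \<open>Convergent subsequences of random compact sets\<close>

text \<open>The codes of the random sets are bounded real random variables, to which Helly's and Skorohod's
  theorems apply; decoding turns convergence of the codes into convergence of the sets. Finite ranges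
  make the decoding measurable. The set \<open>\<D>\<close> serves to carry a property of all approximants over to the
  new probability space.\<close>

lemma compact_set_Skorohod:
  assumes M: "prob_space M"
    and fin: "\<And>n. finite (\<C> n)" and \<C>: "\<And>n. \<C> n \<subseteq> \<D>" and \<D>: "\<D> \<subseteq> nonempty_compacts triangle"
    and X: "\<And>n. X n \<in> M \<rightarrow>\<^sub>M count_space (\<C> n)"
  obtains r :: "nat \<Rightarrow> nat" and \<Omega> :: "real measure" and Z L where
    "strict_mono r" "prob_space \<Omega>"
    "\<And>n. Z n \<in> \<Omega> \<rightarrow>\<^sub>M count_space \<D>"
    "\<And>n f. (\<integral>\<omega>. f (Z n \<omega>) \<partial>\<Omega>) = (\<integral>\<omega>. f (X (r n) \<omega>) \<partial>M :: real)"
    "\<And>\<omega>. \<omega> \<in> space \<Omega> \<Longrightarrow> L \<omega> \<in> nonempty_compacts triangle"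
    "\<And>\<omega>. \<omega> \<in> space \<Omega> \<Longrightarrow> (\<lambda>n. hausdorff_dist (Z n \<omega>) (L \<omega>)) \<longlonglongrightarrow> 0"
proof -
  interpret M: prob_space M by fact
  have code [measurable]: "(\<lambda>\<omega>. set_code (X n \<omega>)) \<in> borel_measurable M" for n
    using measurable_compose[OF X[of n], of set_code borel] by simp
  define \<mu> where "\<mu> n = distr M borel (\<lambda>\<omega>. set_code (X n \<omega>))" for n
  have rd: "real_distribution (\<mu> n)" for n
    unfolding \<mu>_def by (rule M.real_distribution_distr) simp
  have "tight \<mu>"
    unfolding tight_def
  proof (intro conjI allI impI rd)
    fix e :: real assume "e > 0"
    have bounds: "-1 < set_code K" "set_code K \<le> 1" for K
      unfolding set_code_def
      using cantor_sum_bounds(1)[of "\<lambda>i. hits_cell K (from_nat i)"] cantor_sum_bounds(2)[of "\<lambda>i. hits_cell K (from_nat i)"]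
      by linarith+
    have "measure (\<mu> n) {-1<..1} = 1" for n
    proof -
      have "(\<lambda>\<omega>. set_code (X n \<omega>)) -` {-1<..1} \<inter> space M = space M"
        using bounds by auto
      then show ?thesis by (simp add: \<mu>_def measure_distr M.prob_space)
    qed
    with \<open>e > 0\<close> show "\<exists>a b. a < b \<and> (\<forall>n. 1 - e < measure (\<mu> n) {a<..b})"
      by (intro exI[of _ "-1"] exI[of _ 1]) auto
  qed
  from tight_imp_convergent_subsubsequence[OF this strict_mono_id]
  obtain r \<nu> where r: "strict_mono r" and \<nu>: "real_distribution \<nu>" "weak_conv_m (\<lambda>n. \<mu> (r n)) \<nu>"
    by (auto simp: comp_def)
  obtain \<Omega> :: "real measure" and Y Y' where \<Omega>: "prob_space \<Omega>"
    and Y [measurable]: "\<And>n. Y n \<in> borel_measurable \<Omega>"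
    and Yd: "\<And>n. distr \<Omega> borel (Y n) = \<mu> (r n)"
    and lim: "\<And>\<omega>. \<omega> \<in> space \<Omega> \<Longrightarrow> (\<lambda>n. Y n \<omega>) \<longlonglongrightarrow> Y' \<omega>"
    using Skorohod[OF rd \<nu>] by blast
  interpret \<Omega>: prob_space \<Omega> by fact
  obtain \<omega>0 where "\<omega>0 \<in> space M" using M.not_empty by blast
  then obtain D where D: "D \<in> \<D>" using measurable_space[OF X[of 0]] \<C>[of 0] by auto
  \<comment> \<open>On \<open>G\<close> every \<open>Y n\<close> can be decoded. The complement of \<open>G\<close> is null; there the sequence will be constant.\<close>
  define G where "G = {\<omega>\<in>space \<Omega>. \<forall>n. Y n \<omega> \<in> set_code ` \<C> (r n)}"
  have finb: "set_code ` \<C> n \<in> sets borel" for n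
    using fin by (intro borel_closed finite_imp_closed) auto
  have G [measurable]: "G \<in> sets \<Omega>"
    unfolding G_def using finb by (intro sets.sets_Collect_countable_All) auto
  have AEG: "AE \<omega> in \<Omega>. \<omega> \<in> G"
  proof -
    have "AE \<omega> in \<Omega>. Y n \<omega> \<in> set_code ` \<C> (r n)" for n
    proof -
      have "AE y in distr \<Omega> borel (Y n). y \<in> set_code ` \<C> (r n)"
        unfolding Yd \<mu>_def using finb[of "r n"] measurable_space[OF X[of "r n"]]
        by (subst AE_distr_iff) (auto simp: Collect_mem_eq)
      then show ?thesis using finb[of "r n"] by (subst (asm) AE_distr_iff) (auto simp: Collect_mem_eq)
    qed
    then have "AE \<omega> in \<Omega>. \<forall>n. Y n \<omega> \<in> set_code ` \<C> (r n)" by (simp add: AE_all_countable)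
    then show ?thesis using AE_space[of \<Omega>] by eventually_elim (auto simp: G_def)
  qed
  define dec where "dec n = the_inv_into (\<C> n) set_code" for n
  have inj: "inj_on set_code (\<C> n)" for n
    using inj_on_subset[OF inj_on_set_code] \<C> \<D> by blast
  have dec_code: "dec n (set_code K) = K" if "K \<in> \<C> n" for n K
    unfolding dec_def using that by (rule the_inv_into_f_f[OF inj])
  define Z where "Z n \<omega> = (if \<omega> \<in> G then dec (r n) (Y n \<omega>) else D)" for n \<omega>
  have ZC: "Z n \<omega> \<in> \<C> (r n) \<and> set_code (Z n \<omega>) = Y n \<omega>" if G: "\<omega> \<in> G" for n \<omega>
  proof -
    obtain K where "K \<in> \<C> (r n)" "Y n \<omega> = set_code K" using G by (auto simp: G_def)
    then show ?thesis using G by (simp add: Z_def dec_code)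
  qed
  have ZD: "Z n \<omega> \<in> \<D>" for n \<omega>
    using ZC[of \<omega> n] \<C>[of "r n"] D by (cases "\<omega> \<in> G") (auto simp: Z_def)
  have Zm: "Z n \<in> \<Omega> \<rightarrow>\<^sub>M count_space \<D>" for n
  proof (rule measurableI)
    fix \<A> :: "(real \<times> real) set set" assume "\<A> \<in> sets (count_space \<D>)"
    have "Z n -` \<A> \<inter> space \<Omega> =
        (Y n -` (set_code ` (\<A> \<inter> \<C> (r n))) \<inter> space \<Omega> \<inter> G) \<union> (if D \<in> \<A> then space \<Omega> - G else {})"
      (is "_ = ?R")
    proof (rule set_eqI)
      fix \<omega> show "\<omega> \<in> Z n -` \<A> \<inter> space \<Omega> \<longleftrightarrow> \<omega> \<in> ?R"
      proof (cases "\<omega> \<in> G")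
        case True
        then have "Z n \<omega> \<in> \<A> \<longleftrightarrow> Y n \<omega> \<in> set_code ` (\<A> \<inter> \<C> (r n))"
          using ZC[OF True, of n] inj_onD[OF inj[of "r n"]] by (smt (verit, best) IntD1 IntD2 IntI image_iff)
        then show ?thesis using True by auto
      qed (auto simp: Z_def)
    qed
    also have "\<dots> \<in> sets \<Omega>"
    proof -
      have "set_code ` (\<A> \<inter> \<C> (r n)) \<in> sets borel"
        using fin by (intro borel_closed finite_imp_closed) auto
      from sets.Int[OF measurable_sets[OF Y this] G] sets.compl_sets[OF G] show ?thesis by auto
    qed
    finally show "Z n -` \<A> \<inter> space \<Omega> \<in> sets \<Omega>" .
  qed (simp add: ZD)
  have int: "(\<integral>\<omega>. f (Z n \<omega>) \<partial>\<Omega>) = (\<integral>\<omega>. f (X (r n) \<omega>) \<partial>M :: real)" for n f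
  proof -
    define g where "g y = (if y \<in> set_code ` \<C> (r n) then f (dec (r n) y) else 0)" for y
    have "g = (\<lambda>y. \<Sum>K\<in>\<C> (r n). f K * indicator {set_code K} y)"
    proof
      fix y
      show "g y = (\<Sum>K\<in>\<C> (r n). f K * indicator {set_code K} y)"
      proof (cases "y \<in> set_code ` \<C> (r n)")
        case True
        then obtain K where K: "K \<in> \<C> (r n)" "y = set_code K" by auto
        have "(\<Sum>K\<in>\<C> (r n). f K * indicator {set_code K} y) = (\<Sum>L\<in>{K}. f L * indicator {set_code L} y)"
        proof (intro sum.mono_neutral_right ballI)
          fix L assume L: "L \<in> \<C> (r n) - {K}"
          then have "set_code L \<noteq> y" using K inj_onD[OF inj[of "r n"], of L K] by blast
          then show "f L * indicator {set_code L} y = 0" by simp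
        qed (use K fin in auto)
        then show ?thesis using K by (simp add: g_def dec_code)
      next
        case False
        then have "(\<Sum>K\<in>\<C> (r n). f K * indicator {set_code K} y) = 0"
          by (intro sum.neutral) (auto simp: indicator_def)
        then show ?thesis using False by (simp add: g_def)
      qed
    qed
    then have g [measurable]: "g \<in> borel_measurable borel" by simp
    have "(\<integral>\<omega>. f (Z n \<omega>) \<partial>\<Omega>) = (\<integral>\<omega>. g (Y n \<omega>) \<partial>\<Omega>)"
    proof (rule integral_cong_AE)
      show "(\<lambda>\<omega>. f (Z n \<omega>)) \<in> borel_measurable \<Omega>"
        using measurable_compose[OF Zm, of f borel] by simp
      show "AE \<omega> in \<Omega>. f (Z n \<omega>) = g (Y n \<omega>)"
        using AEG by eventually_elim (auto simp: g_def Z_def G_def)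
    qed simp
    also have "\<dots> = (\<integral>y. g y \<partial>\<mu> (r n))" by (simp add: Yd[symmetric] integral_distr)
    also have "\<dots> = (\<integral>\<omega>. g (set_code (X (r n) \<omega>)) \<partial>M)" unfolding \<mu>_def by (rule integral_distr) auto
    also have "\<dots> = (\<integral>\<omega>. f (X (r n) \<omega>) \<partial>M)"
      using measurable_space[OF X[of "r n"]] by (intro Bochner_Integration.integral_cong) (auto simp: g_def dec_code)
    finally show ?thesis .
  qed
  have "\<exists>L\<in>nonempty_compacts triangle. (\<lambda>n. hausdorff_dist (Z n \<omega>) L) \<longlonglongrightarrow> 0" if w: "\<omega> \<in> space \<Omega>" for \<omega>
  proof (cases "\<omega> \<in> G")
    case True
    have "\<exists>N. \<forall>m\<ge>N. \<forall>n\<ge>N. hausdorff_dist (Z m \<omega>) (Z n \<omega>) < e" if "e > 0" for e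
    proof -
      obtain d where d: "d > 0" "\<And>K L. K \<in> nonempty_compacts triangle \<Longrightarrow> L \<in> nonempty_compacts triangle \<Longrightarrow>
         \<bar>set_code K - set_code L\<bar> < d \<Longrightarrow> hausdorff_dist K L < e"
        using set_code_close[OF \<open>e > 0\<close>] by blast
      have "Cauchy (\<lambda>n. Y n \<omega>)" using lim[OF w] LIMSEQ_imp_Cauchy by blast
      from CauchyD[OF this d(1)] obtain N where "\<forall>m\<ge>N. \<forall>n\<ge>N. \<bar>Y m \<omega> - Y n \<omega>\<bar> < d" by auto
      then have "\<forall>m\<ge>N. \<forall>n\<ge>N. hausdorff_dist (Z m \<omega>) (Z n \<omega>) < e"
        using ZC[OF True] ZD \<D> by (intro allI impI d(2)) auto
      then show ?thesis ..
    qed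
    then show ?thesis
      using hausdorff_Cauchy_convergent[OF compact_triangle, of "\<lambda>n. Z n \<omega>"] ZD \<D> by (metis subsetD)
  next
    case False
    then have "\<And>n. Z n \<omega> = D" by (simp add: Z_def)
    moreover have "hausdorff_dist D D = 0"
      using Metric_space.mdist_zero[OF Metric_space_hausdorff] D \<D> by blast
    ultimately show ?thesis using D \<D> by (intro bexI[of _ D]) auto
  qed
  then obtain L where "\<And>\<omega>. \<omega> \<in> space \<Omega> \<Longrightarrow> L \<omega> \<in> nonempty_compacts triangle"
    "\<And>\<omega>. \<omega> \<in> space \<Omega> \<Longrightarrow> (\<lambda>n. hausdorff_dist (Z n \<omega>) (L \<omega>)) \<longlonglongrightarrow> 0"
    by metis
  from that[OF r \<Omega> Zm int this] show ?thesis .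
qed

section \<open>The sampled hypergraph\<close>

definition sample_trace :: "nat \<Rightarrow> (nat \<Rightarrow> real) \<Rightarrow> real \<times> real \<Rightarrow> nat set" where
  "sample_trace n u p = {i \<in> {1..n}. fst p < u i \<and> u i < snd p}"

lemma sampled_hypergraph_eq:
  "sampled_hypergraph K u n = sample_trace n u ` K \<union> (\<lambda>j. {j}) ` {1..n} \<union> {{}}"
proof -
  have "{{i \<in> {1..n}. x < u i \<and> u i < y} | x y. (x, y) \<in> K} = sample_trace n u ` K"
    unfolding sample_trace_def image_def Bex_def split_paired_Ex fst_conv snd_conv
    by (simp only: conj_commute)
  moreover have "{{j} | j. j \<in> {1..n}} = (\<lambda>j. {j}) ` {1..n}" by blast
  ultimately show ?thesis by (simp only: sampled_hypergraph_def)
qed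

lemma sampled_hypergraph_subset: "sampled_hypergraph K u n \<subseteq> Pow {1..n}"
  by (auto simp: sampled_hypergraph_eq sample_trace_def)

lemma finite_InHy: "finite (InHy n)"
  by (rule finite_subset[of _ "Pow (Pow {1..n})"]) (auto simp: InHy_def interval_hypergraph_def)

text \<open>Ties between the sample points are broken by the indices.\<close>

lemma sampled_hypergraph_InHy: "sampled_hypergraph K u n \<in> InHy n"
proof -
  define l where "l = {(i, j). i \<in> {1..n} \<and> j \<in> {1..n} \<and> (u i < u j \<or> u i = u j \<and> i \<le> j)}"
  have "trans l" "antisym l" "total_on {1..n} l" "refl_on {1..n} l" "l \<subseteq> {1..n} \<times> {1..n}"
  proof -
    show "trans l"
    proof (rule transI)
      fix x y z assume "(x, y) \<in> l" "(y, z) \<in> l"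
      then show "(x, z) \<in> l" unfolding l_def by (simp, linarith)
    qed
  qed (auto simp: l_def antisym_def total_on_def refl_on_def)
  then have "linear_order_on {1..n} l"
    by (auto simp: linear_order_on_def partial_order_on_def preorder_on_def)
  moreover have "interval_wrt l {1..n} e" if e: "e \<in> sampled_hypergraph K u n" for e
  proof -
    consider p where "e = sample_trace n u p" | j where "j \<in> {1..n}" "e = {j}" | "e = {}"
      using e unfolding sampled_hypergraph_eq by blast
    then show ?thesis
    proof cases
      case (1 p)
      have "z \<in> sample_trace n u p" if xyz: "x \<in> sample_trace n u p" "y \<in> sample_trace n u p" "(x, z) \<in> l" "(z, y) \<in> l" for x y z
      proof -
        have "u x \<le> u z" "u z \<le> u y" "z \<in> {1..n}" using xyz by (auto simp: l_def)
        with xyz(1,2) show ?thesis by (auto simp: sample_trace_def)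
      qed
      moreover have "sample_trace n u p \<subseteq> {1..n}" by (auto simp: sample_trace_def)
      ultimately show ?thesis unfolding 1 interval_wrt_def by blast
    next
      case (2 j)
      have "z = j" if "(j, z) \<in> l" "(z, j) \<in> l" for z
        using that by (auto simp: l_def)
      with 2 show ?thesis by (auto simp: interval_wrt_def)
    qed (simp add: interval_wrt_def)
  qed
  ultimately show ?thesis
    using sampled_hypergraph_subset[of K u n]
    by (auto simp: InHy_def interval_hypergraph_def sampled_hypergraph_eq)
qed

lemma restrict_sampled_hypergraph:
  assumes "k \<le> n"
  shows "restrict_hypergraph k (sampled_hypergraph K u n) = sampled_hypergraph K u k"
proof -
  have 1: "{1..k} \<inter> sample_trace n u p = sample_trace k u p" for p
    using assms by (auto simp: sample_trace_def)
  have "restrict_hypergraph k (sampled_hypergraph K u n) = (\<inter>) {1..k} ` sampled_hypergraph K u n"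
    by (auto simp: restrict_hypergraph_def)
  also have "\<dots> = (\<lambda>p. {1..k} \<inter> sample_trace n u p) ` K \<union> (\<lambda>j. {1..k} \<inter> {j}) ` {1..n} \<union> {{}}"
    by (simp add: sampled_hypergraph_eq image_Un image_image)
  also have "\<dots> = sample_trace k u ` K \<union> (\<lambda>j. {j}) ` {1..k} \<union> {{}}"
  proof -
    have "(\<lambda>j. {1..k} \<inter> {j}) ` {1..n} \<union> {{}} = (\<lambda>j. {j}) ` {1..k} \<union> {{}}"
    proof (intro equalityI subsetI)
      fix e assume "e \<in> (\<lambda>j. {j}) ` {1..k} \<union> {{}}"
      then consider j where "j \<in> {1..k}" "e = {1..k} \<inter> {j}" | "e = {}" by blast
      then show "e \<in> (\<lambda>j. {1..k} \<inter> {j}) ` {1..n} \<union> {{}}" using assms by cases auto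
    qed auto
    then show ?thesis unfolding 1 by (simp only: Un_assoc)
  qed
  finally show ?thesis by (simp only: sampled_hypergraph_eq)
qed

text \<open>For \<open>s = 0\<close> and \<open>d > 0\<close>: the trace of \<open>p\<close> is \<open>e\<close>, and the points with index in \<open>e\<close> keep distance
  \<open>d\<close> from the ends of the interval. These conditions are closed in \<open>p\<close>; \<open>s > 0\<close> relaxes them.\<close>

definition nearly_trace :: "nat \<Rightarrow> nat set \<Rightarrow> real \<Rightarrow> real \<Rightarrow> (nat \<Rightarrow> real) \<Rightarrow> real \<times> real \<Rightarrow> bool" where
  "nearly_trace n e d s u p \<longleftrightarrow>
     (\<forall>i\<in>e. fst p + d \<le> u i + s \<and> u i + d \<le> snd p + s) \<and>
     (\<forall>i\<in>{1..n} - e. u i \<le> fst p + s \<or> snd p \<le> u i + s)"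

lemma trace_eq_iff_nearly:
  assumes e: "e \<subseteq> {1..n}"
  shows "sample_trace n u p = e \<longleftrightarrow> (\<exists>r. nearly_trace n e (1 / real (Suc r)) 0 u p)"
proof
  assume t: "sample_trace n u p = e"
  have fin: "finite e" using e finite_subset by blast
  define m where "m = Min (insert 1 ((\<lambda>i. u i - fst p) ` e \<union> (\<lambda>i. snd p - u i) ` e))"
  have "m > 0" unfolding m_def using t fin by (subst Min_gr_iff) (auto simp: sample_trace_def)
  then obtain r where r: "1 / real (Suc r) < m" using nat_approx_posE by blast
  have "m \<le> u i - fst p" "m \<le> snd p - u i" if "i \<in> e" for i
    unfolding m_def using fin that by (auto intro!: Min_le)
  then have "nearly_trace n e (1 / real (Suc r)) 0 u p"
    using r t by (fastforce simp: nearly_trace_def sample_trace_def not_less)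
  then show "\<exists>r. nearly_trace n e (1 / real (Suc r)) 0 u p" ..
next
  assume "\<exists>r. nearly_trace n e (1 / real (Suc r)) 0 u p"
  then obtain r where r: "nearly_trace n e (1 / real (Suc r)) 0 u p" ..
  have pos: "1 / real (Suc r) > 0" by simp
  show "sample_trace n u p = e"
  proof (intro equalityI subsetI)
    fix i assume i: "i \<in> sample_trace n u p"
    show "i \<in> e"
    proof (rule ccontr)
      assume "i \<notin> e"
      with i have "i \<in> {1..n} - e" by (simp add: sample_trace_def)
      with r have "u i \<le> fst p + 0 \<or> snd p \<le> u i + 0" unfolding nearly_trace_def by blast
      with i show False by (auto simp: sample_trace_def)
    qed
  next
    fix i assume i: "i \<in> e"
    with r have "fst p + 1 / real (Suc r) \<le> u i + 0 \<and> u i + 1 / real (Suc r) \<le> snd p + 0"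
      unfolding nearly_trace_def by blast
    with pos have "fst p < u i" "u i < snd p" by linarith+
    with i e show "i \<in> sample_trace n u p" by (auto simp: sample_trace_def)
  qed
qed

lemma dist_fst_snd_less:
  fixes p q :: "real \<times> real"
  assumes "dist p q < e"
  shows "\<bar>fst p - fst q\<bar> < e" "\<bar>snd p - snd q\<bar> < e"
proof -
  have 1: "dist (fst p) (fst q) \<le> dist p q" by (rule dist_fst_le)
  have 2: "dist (snd p) (snd q) \<le> dist p q" by (rule dist_snd_le)
  show "\<bar>fst p - fst q\<bar> < e" "\<bar>snd p - snd q\<bar> < e"
    using order.strict_trans1[OF 1 assms] order.strict_trans1[OF 2 assms] by (simp_all only: dist_real_def)
qed

lemma nearly_trace_move:
  assumes near: "nearly_trace n e d s u p" and pq: "dist p q < t"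
  shows "nearly_trace n e d (s + t) u q"
proof -
  have d: "fst q \<le> fst p + t" "fst p \<le> fst q + t" "snd q \<le> snd p + t" "snd p \<le> snd q + t"
    using dist_fst_snd_less[OF pq] by (simp_all add: abs_less_iff)
  show ?thesis
    unfolding nearly_trace_def
  proof (intro conjI ballI)
    fix i assume "i \<in> e"
    then have "fst p + d \<le> u i + s" "u i + d \<le> snd p + s" using near by (auto simp: nearly_trace_def)
    with d show "fst q + d \<le> u i + (s + t)" "u i + d \<le> snd q + (s + t)" by linarith+
  next
    fix i assume "i \<in> {1..n} - e"
    then have "u i \<le> fst p + s \<or> snd p \<le> u i + s" using near by (auto simp: nearly_trace_def)
    with d show "u i \<le> fst q + (s + t) \<or> snd q \<le> u i + (s + t)" by linarith
  qed
qed

lemma rational_point_near: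
  fixes p :: "real \<times> real"
  assumes "e > 0"
  obtains a b :: rat where "dist p (of_rat a, of_rat b) < e"
proof -
  obtain x y where p: "p = (x, y)" by (cases p)
  obtain a b :: rat where "x < of_rat a" "of_rat a < x + e / 2" "y < of_rat b" "of_rat b < y + e / 2"
    using of_rat_dense[of x "x + e/2"] of_rat_dense[of y "y + e/2"] assms by auto
  then have "dist p (of_rat a, of_rat b) < e"
    using sqrt_sum_squares_le_sum_abs[of "of_rat a - x" "of_rat b - y"]
    by (simp add: p dist_prod_def dist_real_def)
  then show ?thesis using that by blast
qed

text \<open>Near a point of \<open>K\<close> meeting the conditions, every rational point meets relaxed ones. Conversely,
  points of \<open>K\<close> that meet weaker and weaker relaxations accumulate, by compactness, at a point meeting the
  closed conditions. The right-hand side involves countably many events only, whence the joint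
  measurability of sampling.\<close>

lemma nearly_trace_iff_rational:
  assumes K: "compact K"
  shows "(\<exists>p\<in>K. nearly_trace n e d 0 u p) \<longleftrightarrow>
    (\<forall>s. \<exists>a b. K \<inter> ball (of_rat a, of_rat b) (1 / real (Suc s)) \<noteq> {} \<and>
        nearly_trace n e d (1 / real (Suc s)) u (of_rat a, of_rat b))"
proof
  assume "\<exists>p\<in>K. nearly_trace n e d 0 u p"
  then obtain p where p: "p \<in> K" "nearly_trace n e d 0 u p" ..
  show "\<forall>s. \<exists>a b. K \<inter> ball (of_rat a, of_rat b) (1 / real (Suc s)) \<noteq> {} \<and>
        nearly_trace n e d (1 / real (Suc s)) u (of_rat a, of_rat b)"
  proof
    fix s
    obtain a b :: rat where ab: "dist p (of_rat a, of_rat b) < 1 / real (Suc s)"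
      using rational_point_near[of "1 / real (Suc s)" p] by auto
    have "nearly_trace n e d (1 / real (Suc s)) u (of_rat a, of_rat b)"
      using nearly_trace_move[OF p(2) ab] by simp
    moreover have "p \<in> ball (of_rat a, of_rat b) (1 / real (Suc s))" 
      unfolding mem_ball by (subst dist_commute) (rule ab)
    ultimately show "\<exists>a b. K \<inter> ball (of_rat a, of_rat b) (1 / real (Suc s)) \<noteq> {} \<and>
        nearly_trace n e d (1 / real (Suc s)) u (of_rat a, of_rat b)" using p(1) by blast
  qed
next
  assume *: "\<forall>s. \<exists>a b. K \<inter> ball (of_rat a, of_rat b) (1 / real (Suc s)) \<noteq> {} \<and>
        nearly_trace n e d (1 / real (Suc s)) u (of_rat a, of_rat b)"
  have "\<exists>p\<in>K. nearly_trace n e d (2 / real (Suc s)) u p" for s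
  proof -
    obtain a b p where p: "p \<in> K" "dist (of_rat a, of_rat b) p < 1 / real (Suc s)"
      and t: "nearly_trace n e d (1 / real (Suc s)) u (of_rat a, of_rat b)"
      using *[rule_format, of s] unfolding ex_in_conv[symmetric] Int_iff mem_ball by blast
    have "nearly_trace n e d (2 / real (Suc s)) u p"
      using nearly_trace_move[OF t p(2)] by simp
    then show ?thesis using p by blast
  qed
  then obtain p where p: "\<And>s. p s \<in> K" "\<And>s. nearly_trace n e d (2 / real (Suc s)) u (p s)" by metis
  then obtain q r where q: "q \<in> K" "strict_mono r" "(p \<circ> r) \<longlonglongrightarrow> q"
    using K[unfolded compact_def, rule_format, of p] by auto
  define s where "s k = 2 / real (Suc (r k))" for k
  have "(\<lambda>k. 2 / real (Suc k)) \<longlonglongrightarrow> 0"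
    using tendsto_mult[OF tendsto_const[of "2::real"] LIMSEQ_inverse_real_of_nat] by (simp add: divide_inverse)
  then have s: "s \<longlonglongrightarrow> 0"
    unfolding s_def using q(2) by (rule LIMSEQ_subseq_LIMSEQ[unfolded comp_def])
  have lim: "(\<lambda>k. fst (p (r k))) \<longlonglongrightarrow> fst q" "(\<lambda>k. snd (p (r k))) \<longlonglongrightarrow> snd q"
    using tendsto_fst[OF q(3)] tendsto_snd[OF q(3)] by (simp_all add: comp_def)
  have near: "nearly_trace n e d (s k) u (p (r k))" for k unfolding s_def by (rule p)
  have "nearly_trace n e d 0 u q"
    unfolding nearly_trace_def
  proof (intro conjI ballI)
    fix i assume i: "i \<in> e"
    have "fst q + d \<le> u i + 0"
    proof (rule tendsto_le[OF _ tendsto_add[OF tendsto_const s] tendsto_add[OF lim(1) tendsto_const]])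
      show "\<forall>\<^sub>F k in sequentially. fst (p (r k)) + d \<le> u i + s k"
        using near i by (intro always_eventually) (simp add: nearly_trace_def)
    qed simp
    then show "fst q + d \<le> u i + 0" .
    have "u i + d \<le> snd q + 0"
    proof (rule tendsto_le[OF _ tendsto_add[OF lim(2) s] tendsto_const])
      show "\<forall>\<^sub>F k in sequentially. u i + d \<le> snd (p (r k)) + s k"
        using near i by (intro always_eventually) (simp add: nearly_trace_def)
    qed simp
    then show "u i + d \<le> snd q + 0" .
  next
    fix i assume i: "i \<in> {1..n} - e"
    show "u i \<le> fst q + 0 \<or> snd q \<le> u i + 0"
    proof (rule ccontr)
      assume "\<not> ?thesis"
      then have *: "fst q + 0 < u i" "u i + 0 < snd q" by auto
      have "\<forall>\<^sub>F k in sequentially. fst (p (r k)) + s k < u i"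
        by (rule order_tendstoD(2)[OF tendsto_add[OF lim(1) s] *(1)])
      moreover have "\<forall>\<^sub>F k in sequentially. 0 < snd (p (r k)) - (u i + s k)"
        by (rule order_tendstoD(1)[OF tendsto_diff[OF lim(2) tendsto_add[OF tendsto_const s]]])
          (use * in simp)
      ultimately have "\<forall>\<^sub>F k in sequentially. False"
      proof eventually_elim
        case (elim k)
        have "u i \<le> fst (p (r k)) + s k \<or> snd (p (r k)) \<le> u i + s k"
          using near[of k] i unfolding nearly_trace_def by blast
        with elim show ?case by linarith
      qed
      then show False by simp
    qed
  qed
  with q(1) show "\<exists>p\<in>K. nearly_trace n e d 0 u p" ..
qed

lemma measurable_sampled_hypergraph:
  "(\<lambda>(K, u). sampled_hypergraph K u n)
     \<in> hausdorff_borel triangle \<Otimes>\<^sub>M (\<Pi>\<^sub>M i\<in>{1::nat..}. borel) \<rightarrow>\<^sub>M count_space (InHy n)"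
proof -
  let ?P = "hausdorff_borel triangle \<Otimes>\<^sub>M (\<Pi>\<^sub>M i\<in>{1::nat..}. borel) :: ((real \<times> real) set \<times> (nat \<Rightarrow> real)) measure"
  have coord [measurable]: "(\<lambda>z. snd z i) \<in> borel_measurable ?P" if "i \<in> {1..n}" for i
    using that by (intro measurable_compose[OF measurable_snd measurable_component_singleton]) auto
  have hit [measurable]: "Measurable.pred ?P (\<lambda>z. fst z \<inter> ball q r \<noteq> {})" for q r
  proof -
    have "{z \<in> space ?P. fst z \<inter> ball q r \<noteq> {}} = fst -` {K \<in> nonempty_compacts triangle. K \<inter> ball q r \<noteq> {}} \<inter> space ?P"
      by (auto simp: space_pair_measure)
    then show ?thesis
      using measurable_sets[OF measurable_fst hitting_set_measurable[OF open_ball[of q r], of triangle]]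
      by (simp add: pred_def)
  qed
  have near: "Measurable.pred ?P (\<lambda>z. nearly_trace n e d s (snd z) p)" if e: "e \<subseteq> {1..n}" for e d s p
  proof -
    have fin: "finite e" "finite ({1..n} - e)" using e finite_subset by auto
    have 1: "Measurable.pred ?P (\<lambda>z. fst p + d \<le> snd z i + s \<and> snd z i + d \<le> snd p + s)" if "i \<in> e" for i
    proof -
      have [measurable]: "(\<lambda>z. snd z i) \<in> borel_measurable ?P" using coord that e by blast
      show ?thesis by measurable
    qed
    have 2: "Measurable.pred ?P (\<lambda>z. snd z i \<le> fst p + s \<or> snd p \<le> snd z i + s)" if "i \<in> {1..n} - e" for i
    proof -
      have [measurable]: "(\<lambda>z. snd z i) \<in> borel_measurable ?P" using coord that by blast
      show ?thesis by measurable
    qed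
    show ?thesis
      unfolding nearly_trace_def
      by (intro pred_intros_logic pred_intros_finite fin 1 2)
  qed
  have mem: "Measurable.pred ?P (\<lambda>z. e \<in> sampled_hypergraph (fst z) (snd z) n)" if e: "e \<subseteq> {1..n}" for e
  proof -
    define B where "B \<longleftrightarrow> e \<in> (\<lambda>j. {j}) ` {1..n} \<union> {{}}"
    define R where "R z \<longleftrightarrow> (\<exists>r. \<forall>s. \<exists>a b. fst z \<inter> ball (of_rat a, of_rat b) (1 / real (Suc s)) \<noteq> {} \<and>
        nearly_trace n e (1 / real (Suc r)) (1 / real (Suc s)) (snd z) (of_rat a, of_rat b)) \<or> B"
      for z :: "(real \<times> real) set \<times> (nat \<Rightarrow> real)"
    have "Measurable.pred ?P R"
      unfolding R_def
      by (intro pred_intros_countable pred_intros_logic(3,5) measurable_const hit near e) simp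
    moreover have "R z \<longleftrightarrow> e \<in> sampled_hypergraph (fst z) (snd z) n" if "z \<in> space ?P" for z
    proof -
      have K: "compact (fst z)" using that by (auto simp: space_pair_measure nonempty_compacts_def)
      have "e \<in> sample_trace n (snd z) ` fst z \<longleftrightarrow> (\<exists>p\<in>fst z. sample_trace n (snd z) p = e)"
        by blast
      also have "\<dots> \<longleftrightarrow> (\<exists>r. \<exists>p\<in>fst z. nearly_trace n e (1 / real (Suc r)) 0 (snd z) p)"
        unfolding trace_eq_iff_nearly[OF e] by blast
      finally show ?thesis
        unfolding R_def B_def nearly_trace_iff_rational[OF K, symmetric] sampled_hypergraph_eq by blast
    qed
    ultimately show ?thesis using measurable_cong[of ?P R] by simp
  qed
  have "(\<lambda>z. sampled_hypergraph (fst z) (snd z) n) \<in> ?P \<rightarrow>\<^sub>M count_space (InHy n)"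
    unfolding measurable_count_space_eq2[OF finite_InHy]
  proof (intro conjI ballI funcsetI sampled_hypergraph_InHy)
    fix h assume "h \<in> InHy n"
    then have h: "h \<subseteq> Pow {1..n}" by (auto simp: InHy_def interval_hypergraph_def)
    have "Measurable.pred ?P (\<lambda>z. \<forall>e\<in>Pow {1..n}. e \<in> sampled_hypergraph (fst z) (snd z) n \<longleftrightarrow> e \<in> h)"
      by (intro pred_intros_finite pred_intros_logic mem) auto
    also have "(\<lambda>z. \<forall>e\<in>Pow {1..n}. e \<in> sampled_hypergraph (fst z) (snd z) n \<longleftrightarrow> e \<in> h)
      = (\<lambda>z :: (real \<times> real) set \<times> (nat \<Rightarrow> real). sampled_hypergraph (fst z) (snd z) n = h)"
      using h sampled_hypergraph_subset by (intro ext) blast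
    finally show "(\<lambda>z. sampled_hypergraph (fst z) (snd z) n) -` {h} \<inter> space ?P \<in> sets ?P"
      by (simp add: pred_def vimage_def Int_def conj_commute)
  qed
  then show ?thesis by (simp add: case_prod_beta')
qed

section \<open>Generic sample points\<close>

text \<open>The sign \<open>0\<close> stands for no restriction. With it, half-planes and quadrants are treated together.\<close>

definition on_side :: "real \<Rightarrow> real \<Rightarrow> bool" where
  "on_side \<sigma> t \<longleftrightarrow> \<sigma> = 0 \<or> 0 < \<sigma> * t"

text \<open>The points of \<open>K\<close> that have no neighbour in \<open>K\<close> at distance less than \<open>\<epsilon>\<close> in the half-plane or
  quadrant given by the signs \<open>\<sigma>\<close> and \<open>\<tau>\<close>.\<close>

definition lonely :: "(real \<times> real) set \<Rightarrow> real \<Rightarrow> real \<Rightarrow> real \<Rightarrow> (real \<times> real) set" where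
  "lonely K \<sigma> \<tau> \<epsilon> = {p \<in> K. \<forall>q\<in>K. \<not> (on_side \<sigma> (fst q - fst p) \<and> on_side \<tau> (snd q - snd p) \<and>
       \<bar>fst q - fst p\<bar> < \<epsilon> \<and> \<bar>snd q - snd p\<bar> < \<epsilon>)}"

lemma lonelyD:
  assumes "p \<in> lonely K \<sigma> \<tau> \<epsilon>" "q \<in> lonely K \<sigma> \<tau> \<epsilon>"
    and "\<bar>fst q - fst p\<bar> < \<epsilon>" "\<bar>snd q - snd p\<bar> < \<epsilon>"
  shows "\<not> (on_side \<sigma> (fst q - fst p) \<and> on_side \<tau> (snd q - snd p))"
  using assms unfolding lonely_def by blast

lemma same_floor_close:
  fixes a b e :: real
  assumes "e > 0" "\<lfloor>a / e\<rfloor> = \<lfloor>b / e\<rfloor>"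
  shows "\<bar>a - b\<bar> < e"
proof -
  have "\<bar>a / e - b / e\<bar> < 1" using assms(2) by linarith
  then have "\<bar>a - b\<bar> / e < 1" using assms(1) by (simp add: abs_divide flip: diff_divide_distrib)
  then show ?thesis using assms(1) by (simp add: divide_less_eq)
qed

lemma on_side_cases: "\<sigma> \<noteq> 0 \<Longrightarrow> t \<noteq> 0 \<Longrightarrow> on_side \<sigma> t \<or> on_side \<sigma> (- t)"
  unfolding on_side_def by (simp, cases "0 < \<sigma> * t"; simp add: mult_less_0_iff zero_less_mult_iff; linarith)

text \<open>If two lonely points in the same cell of a grid of mesh \<open>\<epsilon>\<close> had different first coordinates, one of
  them would lie on the forbidden side of the other. So each cell contributes one coordinate at most.\<close>

lemma countable_lonely_fst:
  assumes "\<sigma> \<noteq> 0" "\<epsilon> > 0"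
  shows "countable (fst ` lonely K \<sigma> 0 \<epsilon>)"
proof -
  have "\<forall>v\<in>fst ` lonely K \<sigma> 0 \<epsilon>. \<exists>p\<in>lonely K \<sigma> 0 \<epsilon>. fst p = v" by blast
  then obtain p where p: "\<And>v. v \<in> fst ` lonely K \<sigma> 0 \<epsilon> \<Longrightarrow> p v \<in> lonely K \<sigma> 0 \<epsilon>"
    "\<And>v. v \<in> fst ` lonely K \<sigma> 0 \<epsilon> \<Longrightarrow> fst (p v) = v" by metis
  define c where "c v = (\<lfloor>v / \<epsilon>\<rfloor>, \<lfloor>snd (p v) / \<epsilon>\<rfloor>)" for v
  have "inj_on c (fst ` lonely K \<sigma> 0 \<epsilon>)"
  proof (rule inj_onI, rule ccontr)
    fix v w assume vw: "v \<in> fst ` lonely K \<sigma> 0 \<epsilon>" "w \<in> fst ` lonely K \<sigma> 0 \<epsilon>" and c: "c v = c w" and ne: "v \<noteq> w"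
    have a: "\<bar>w - v\<bar> < \<epsilon>" "\<bar>snd (p w) - snd (p v)\<bar> < \<epsilon>"
      using c by (auto simp: c_def intro!: same_floor_close[OF assms(2)])
    then have b: "\<bar>v - w\<bar> < \<epsilon>" "\<bar>snd (p v) - snd (p w)\<bar> < \<epsilon>" by linarith+
    have "\<not> on_side \<sigma> (w - v)"
      using lonelyD[OF p(1)[OF vw(1)] p(1)[OF vw(2)]] a p(2)[OF vw(1)] p(2)[OF vw(2)]
      by (simp add: on_side_def[of 0])
    moreover have "\<not> on_side \<sigma> (v - w)"
      using lonelyD[OF p(1)[OF vw(2)] p(1)[OF vw(1)]] b p(2)[OF vw(1)] p(2)[OF vw(2)]
      by (simp add: on_side_def[of 0])
    ultimately show False using on_side_cases[OF assms(1), of "w - v"] ne by simp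
  qed
  then show ?thesis using countable_image_inj_on[of c] countableI_type by blast
qed

lemma lonely_swap: "prod.swap ` lonely K \<sigma> \<tau> \<epsilon> = lonely (prod.swap ` K) \<tau> \<sigma> \<epsilon>"
  unfolding lonely_def by force

lemma countable_lonely_snd:
  assumes "\<tau> \<noteq> 0" "\<epsilon> > 0"
  shows "countable (snd ` lonely K 0 \<tau> \<epsilon>)"
proof -
  have "snd ` lonely K 0 \<tau> \<epsilon> = fst ` prod.swap ` lonely K 0 \<tau> \<epsilon>"
    by (simp add: image_image)
  then show ?thesis unfolding lonely_swap using countable_lonely_fst[OF assms] by simp
qed

text \<open>On a line of slope \<open>\<sigma> * \<tau>\<close>, one of any two points lies in the quadrant with signs \<open>\<sigma>\<close> and \<open>\<tau>\<close> of
  the other; so the lonely points on such a line are \<open>\<epsilon>\<close>-separated.\<close>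

lemma countable_lonely_diagonal:
  assumes \<sigma>: "\<sigma> \<in> {-1, 1}" and \<tau>: "\<tau> \<in> {-1, 1}" and "\<epsilon> > 0"
  shows "countable {v. (v, d + \<sigma> * \<tau> * v) \<in> lonely K \<sigma> \<tau> \<epsilon>}" (is "countable ?S")
proof -
  have "inj_on (\<lambda>v. \<lfloor>v / \<epsilon>\<rfloor>) ?S"
  proof (rule inj_onI, rule ccontr)
    fix v w assume v: "v \<in> ?S" and w: "w \<in> ?S" and c: "\<lfloor>v / \<epsilon>\<rfloor> = \<lfloor>w / \<epsilon>\<rfloor>" and ne: "v \<noteq> w"
    have a: "\<bar>v - w\<bar> < \<epsilon>" "\<bar>w - v\<bar> < \<epsilon>" using same_floor_close[OF assms(3)] c by auto
    have s: "(d + \<sigma> * \<tau> * w) - (d + \<sigma> * \<tau> * v) = \<sigma> * \<tau> * (w - v)" for v w by (simp add: algebra_simps)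
    have abs: "\<bar>\<sigma> * \<tau> * t\<bar> = \<bar>t\<bar>" "on_side \<tau> (\<sigma> * \<tau> * t) \<longleftrightarrow> on_side \<sigma> t" for t
      using \<sigma> \<tau> by (auto simp: on_side_def)
    have "\<not> on_side \<sigma> (w - v)"
      using lonelyD[OF v[unfolded mem_Collect_eq] w[unfolded mem_Collect_eq]] a
      by (simp only: fst_conv snd_conv s abs) blast
    moreover have "\<not> on_side \<sigma> (v - w)"
      using lonelyD[OF w[unfolded mem_Collect_eq] v[unfolded mem_Collect_eq]] a
      by (simp only: fst_conv snd_conv s abs) blast
    ultimately show False using on_side_cases[of \<sigma> "w - v"] ne \<sigma> by auto
  qed
  then show ?thesis using countable_image_inj_on countableI_type by blast
qed

lemma borel_lonely:
  assumes K: "closed K" and "\<sigma> \<noteq> 0" "\<tau> \<noteq> 0"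
  shows "lonely K \<sigma> \<tau> \<epsilon> \<in> sets borel"
proof -
  have "lonely K \<sigma> \<tau> \<epsilon> = K - (\<Union>q\<in>K. {p. 0 < \<sigma> * (fst q - fst p)} \<inter> {p. 0 < \<tau> * (snd q - snd p)} \<inter>
      {p. \<bar>fst q - fst p\<bar> < \<epsilon>} \<inter> {p. \<bar>snd q - snd p\<bar> < \<epsilon>})"
    unfolding lonely_def on_side_def using assms(2,3) by blast
  moreover have "open (\<Union>q\<in>K. {p. 0 < \<sigma> * (fst q - fst p)} \<inter> {p. 0 < \<tau> * (snd q - snd p)} \<inter>
      {p :: real \<times> real. \<bar>fst q - fst p\<bar> < \<epsilon>} \<inter> {p. \<bar>snd q - snd p\<bar> < \<epsilon>})"
    by (intro open_UN ballI open_Int open_Collect_less continuous_intros)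
  ultimately show ?thesis using K by auto
qed

abbreviation unif01 :: "real measure" where
  "unif01 \<equiv> uniform_measure lborel {0..1}"

abbreviation uniform_seq :: "(nat \<Rightarrow> real) measure" where
  "uniform_seq \<equiv> \<Pi>\<^sub>M i\<in>{1::nat..}. unif01"

lemma prob_space_unif01: "prob_space unif01"
  by (rule prob_space_uniform_measure) auto

interpretation unif: product_prob_space "\<lambda>_::nat. unif01" "{1::nat..}"
proof -
  interpret prob_space unif01 by (rule prob_space_unif01)
  show "product_prob_space (\<lambda>_::nat. unif01)" by unfold_locales
qed

lemma AE_unif01: "AE x in lborel. P x \<Longrightarrow> AE x in unif01. P x"
  by (rule AE_uniform_measureI) auto

lemma AE_uniform_seq_not_in_countable:
  assumes "countable C" "i \<ge> 1"
  shows "AE u in uniform_seq. u i \<notin> C"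
proof -
  have "AE x in lborel. x \<notin> C"
    using countable_imp_null_set_lborel[OF assms(1)] by (rule AE_not_in)
  then show ?thesis using unif.AE_component[of i, OF _ AE_unif01] assms(2) by simp
qed

text \<open>Fubini's theorem along the lines of slope \<open>\<rho>\<close>: the shear \<open>(v, d) \<mapsto> (v, d + \<rho> * v)\<close> preserves
  Lebesgue measure.\<close>

lemma null_set_by_slanted_lines:
  assumes A: "A \<in> sets borel" and c: "\<And>d. countable {v. (v, d + \<rho> * v) \<in> A}"
  shows "(A :: (real \<times> real) set) \<in> null_sets (lborel \<Otimes>\<^sub>M lborel)"
proof
  have sets: "sets (lborel \<Otimes>\<^sub>M lborel :: (real \<times> real) measure) = sets borel"
    by (simp add: borel_prod[symmetric] cong: sets_pair_measure_cong)
  show AS: "A \<in> sets (lborel \<Otimes>\<^sub>M lborel)" using A sets by simp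
  have [measurable]: "indicator A \<in> borel_measurable (borel :: (real \<times> real) measure)"
    using A by measurable
  have m: "(\<lambda>(v, d). indicator A (v, d + \<rho> * v) :: ennreal) \<in> borel_measurable (lborel \<Otimes>\<^sub>M lborel)"
  proof -
    have "(\<lambda>z. (fst z, snd z + \<rho> * fst z)) \<in> borel_measurable (lborel \<Otimes>\<^sub>M lborel)"
      unfolding measurable_cong_sets[OF sets refl]
      by (intro borel_measurable_continuous_onI continuous_intros)
    then have "(\<lambda>z. indicator A (fst z, snd z + \<rho> * fst z) :: ennreal) \<in> borel_measurable (lborel \<Otimes>\<^sub>M lborel)"
      by (rule measurable_compose) measurable
    then show ?thesis by (simp add: case_prod_beta')
  qed
  have "emeasure (lborel \<Otimes>\<^sub>M lborel) A = (\<integral>\<^sup>+v. \<integral>\<^sup>+w. indicator A (v, w) \<partial>lborel \<partial>lborel)"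
    using AS by (rule lborel.emeasure_pair_measure)
  also have "\<dots> = (\<integral>\<^sup>+v. \<integral>\<^sup>+d. indicator A (v, d + \<rho> * v) \<partial>lborel \<partial>lborel)"
  proof (rule nn_integral_cong)
    fix v :: real
    have "(\<lambda>w. indicator A (v, w) :: ennreal) \<in> borel_measurable borel"
    proof -
      have "(\<lambda>w. (v, w)) \<in> borel_measurable borel"
        by (intro borel_measurable_continuous_onI continuous_intros)
      then show ?thesis by (rule measurable_compose) measurable
    qed
    from nn_integral_real_affine[OF this, of 1 "\<rho> * v"]
    show "(\<integral>\<^sup>+w. indicator A (v, w) \<partial>lborel) = (\<integral>\<^sup>+d. indicator A (v, d + \<rho> * v) \<partial>lborel)"
      by (simp add: add.commute)
  qed
  also have "\<dots> = (\<integral>\<^sup>+d. \<integral>\<^sup>+v. indicator A (v, d + \<rho> * v) \<partial>lborel \<partial>lborel)"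
    using lborel_pair.Fubini'[OF m] by simp
  also have "\<dots> = (\<integral>\<^sup>+(d::real). 0 \<partial>lborel)"
  proof (rule nn_integral_cong)
    fix d :: real
    have "AE v in lborel. v \<notin> {v. (v, d + \<rho> * v) \<in> A}"
      using countable_imp_null_set_lborel[OF c] by (rule AE_not_in)
    then have "AE v in lborel. indicator A (v, d + \<rho> * v) = (0::ennreal)"
      by eventually_elim simp
    from nn_integral_cong_AE[OF this] show "(\<integral>\<^sup>+v. indicator A (v, d + \<rho> * v) \<partial>lborel) = (0::ennreal)"
      by simp
  qed
  finally show "emeasure (lborel \<Otimes>\<^sub>M lborel) A = 0" by simp
qed

lemma AE_uniform_seq_pair_not_in_null:
  assumes A: "A \<in> null_sets (lborel \<Otimes>\<^sub>M lborel)" and ij: "i \<ge> 1" "j \<ge> 1" "i \<noteq> j"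
  shows "AE u in uniform_seq. (u i, u j) \<notin> A"
proof -
  have sets: "sets (unif01 \<Otimes>\<^sub>M unif01) = sets (lborel \<Otimes>\<^sub>M lborel)"
    by (simp cong: sets_pair_measure_cong)
  have AS: "A \<in> sets (unif01 \<Otimes>\<^sub>M unif01)" using A sets by auto
  have "AE x in lborel. AE y in lborel. (x, y) \<notin> A"
    using lborel_pair.AE_pair[OF AE_not_in[OF A]] by simp
  then have "AE x in unif01. AE y in lborel. (x, y) \<notin> A" by (rule AE_unif01)
  then have ae: "AE x in unif01. AE y in unif01. (x, y) \<notin> A" by eventually_elim (rule AE_unif01)
  interpret U: prob_space unif01 by (rule prob_space_unif01)
  interpret UU: pair_prob_space unif01 unif01 ..
  have "AE z in unif01 \<Otimes>\<^sub>M unif01. z \<notin> A"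
  proof (rule UU.AE_pair_measure[OF _ ae])
    have "{z \<in> space (unif01 \<Otimes>\<^sub>M unif01). z \<notin> A} = space (unif01 \<Otimes>\<^sub>M unif01) - A" by auto
    then show "{z \<in> space (unif01 \<Otimes>\<^sub>M unif01). z \<notin> A} \<in> sets (unif01 \<Otimes>\<^sub>M unif01)"
      using sets.compl_sets[OF AS] by simp
  qed
  then have "emeasure (unif01 \<Otimes>\<^sub>M unif01) A = 0"
    using AS by (simp add: AE_iff_null_sets null_setsD1)
  moreover
  define f where "f u = (indicator A (u i, u j) :: ennreal)" for u :: "nat \<Rightarrow> real"
  have fm: "f \<in> borel_measurable (\<Pi>\<^sub>M k\<in>{i, j}. unif01)"
  proof -
    have "(\<lambda>u. (u i, u j)) \<in> (\<Pi>\<^sub>M k\<in>{i, j}. unif01) \<rightarrow>\<^sub>M unif01 \<Otimes>\<^sub>M unif01"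
      by (intro measurable_Pair measurable_component_singleton) auto
    from measurable_compose[OF this borel_measurable_indicator[OF AS]] show ?thesis
      by (simp add: f_def[abs_def])
  qed
  have "(\<integral>\<^sup>+u. f u \<partial>(\<Pi>\<^sub>M k\<in>{i, j}. unif01)) = (\<integral>\<^sup>+z. indicator A (fst z, snd z) \<partial>(unif01 \<Otimes>\<^sub>M unif01))"
    unfolding f_def using ij AS by (intro unif.product_nn_integral_pair) auto
  ultimately have "(\<integral>\<^sup>+u. f u \<partial>(\<Pi>\<^sub>M k\<in>{i, j}. unif01)) = 0"
    using AS by simp
  then have "AE u in (\<Pi>\<^sub>M k\<in>{i, j}. unif01). f u = 0"
    using nn_integral_0_iff_AE[OF fm] by simp
  then have "AE u in distr uniform_seq (\<Pi>\<^sub>M k\<in>{i, j}. unif01) (\<lambda>u. restrict u {i, j}). f u = 0"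
    using ij by (subst unif.distr_PiM_restrict_finite) auto
  then have "AE u in uniform_seq. f (restrict u {i, j}) = 0"
    by (rule AE_distrD[rotated]) (use ij in \<open>auto intro!: measurable_restrict_subset\<close>)
  then show ?thesis by eventually_elim (auto simp: f_def indicator_def split: if_splits)
qed

text \<open>Whenever a coordinate of a point \<open>p\<close> of \<open>K\<close> is a sample point, \<open>K\<close> has points close to \<open>p\<close> on both
  sides, and on all four if this concerns both coordinates. Points on the diagonal are exempt: they and
  nearby points have no traces but the empty set and singletons.\<close>

definition generic :: "(real \<times> real) set \<Rightarrow> (nat \<Rightarrow> real) \<Rightarrow> nat \<Rightarrow> bool" where
  "generic K u n \<longleftrightarrow> inj_on u {1..n} \<and>
    (\<forall>\<epsilon>>0. \<forall>\<sigma>\<in>{-1, 0, 1}. \<forall>\<tau>\<in>{-1, 0, 1}. \<forall>p\<in>K. fst p < snd p \<longrightarrow>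
      (\<sigma> \<noteq> 0 \<longrightarrow> fst p \<in> u ` {1..n}) \<longrightarrow> (\<tau> \<noteq> 0 \<longrightarrow> snd p \<in> u ` {1..n}) \<longrightarrow>
      (\<exists>q\<in>K. on_side \<sigma> (fst q - fst p) \<and> on_side \<tau> (snd q - snd p) \<and>
         \<bar>fst q - fst p\<bar> < \<epsilon> \<and> \<bar>snd q - snd p\<bar> < \<epsilon>))"

lemma AE_generic:
  assumes K: "closed K"
  shows "AE u in uniform_seq. generic K u n"
proof -
  let ?\<epsilon> = "\<lambda>m. 1 / real (Suc m)"
  have diag: "{p :: real \<times> real. fst p = snd p} \<in> null_sets (lborel \<Otimes>\<^sub>M lborel)"
  proof (rule null_set_by_slanted_lines[where \<rho> = "-1"])
    have "closed {p :: real \<times> real. fst p = snd p}" by (intro closed_Collect_eq continuous_intros)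
    then show "{p :: real \<times> real. fst p = snd p} \<in> sets borel" by (rule borel_closed)
    fix d :: real
    have "{v. (v, d + (- 1) * v) \<in> {p. fst p = snd p}} \<subseteq> {d / 2}" by auto
    then show "countable {v. (v, d + (- 1) * v) \<in> {p. fst p = snd p}}"
      using countable_subset by blast
  qed
  have 1: "AE u in uniform_seq. u i \<noteq> u j" if "i \<ge> 1" "j \<ge> 1" "i \<noteq> j" for i j
    using AE_uniform_seq_pair_not_in_null[OF diag that] by simp
  have 2: "AE u in uniform_seq. u i \<notin> fst ` lonely K \<sigma> 0 (?\<epsilon> m)" if "i \<ge> 1" "\<sigma> \<in> {-1, 1}" for i \<sigma> m
    using that by (intro AE_uniform_seq_not_in_countable countable_lonely_fst) auto
  have 3: "AE u in uniform_seq. u i \<notin> snd ` lonely K 0 \<tau> (?\<epsilon> m)" if "i \<ge> 1" "\<tau> \<in> {-1, 1}" for i \<tau> m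
    using that by (intro AE_uniform_seq_not_in_countable countable_lonely_snd) auto
  have 4: "AE u in uniform_seq. (u i, u j) \<notin> lonely K \<sigma> \<tau> (?\<epsilon> m)"
    if "i \<ge> 1" "j \<ge> 1" "i \<noteq> j" "\<sigma> \<in> {-1, 1}" "\<tau> \<in> {-1, 1}" for i j \<sigma> \<tau> m
  proof -
    have "lonely K \<sigma> \<tau> (?\<epsilon> m) \<in> null_sets (lborel \<Otimes>\<^sub>M lborel)"
      using that by (intro null_set_by_slanted_lines[where \<rho> = "\<sigma> * \<tau>"] borel_lonely[OF K] countable_lonely_diagonal) auto
    from AE_uniform_seq_pair_not_in_null[OF this that(1-3)] show ?thesis .
  qed
  have "AE u in uniform_seq. \<forall>i\<in>{1..n}. \<forall>j\<in>{1..n} - {i}. u i \<noteq> u j"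
    by (intro AE_finite_allI finite_Diff 1) auto
  moreover have "AE u in uniform_seq. \<forall>m. \<forall>i\<in>{1..n}. \<forall>\<sigma>\<in>{-1, 1}. u i \<notin> fst ` lonely K \<sigma> 0 (?\<epsilon> m)"
    unfolding AE_all_countable by (intro allI AE_finite_allI 2) auto
  moreover have "AE u in uniform_seq. \<forall>m. \<forall>i\<in>{1..n}. \<forall>\<tau>\<in>{-1, 1}. u i \<notin> snd ` lonely K 0 \<tau> (?\<epsilon> m)"
    unfolding AE_all_countable by (intro allI AE_finite_allI 3) auto
  moreover have "AE u in uniform_seq. \<forall>m. \<forall>i\<in>{1..n}. \<forall>j\<in>{1..n} - {i}. \<forall>\<sigma>\<in>{-1, 1}. \<forall>\<tau>\<in>{-1, 1}.
      (u i, u j) \<notin> lonely K \<sigma> \<tau> (?\<epsilon> m)"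
    unfolding AE_all_countable by (intro allI AE_finite_allI finite_Diff 4) auto
  ultimately show ?thesis
  proof eventually_elim
    case (elim u)
    show ?case
      unfolding generic_def
    proof (intro conjI allI impI ballI)
      show "inj_on u {1..n}" using elim(1) by (intro inj_onI) blast
      fix \<epsilon> \<sigma> \<tau> :: real and p
      assume \<epsilon>: "\<epsilon> > 0" and s: "\<sigma> \<in> {-1, 0, 1}" "\<tau> \<in> {-1, 0, 1}" and p: "p \<in> K" "fst p < snd p"
        and \<sigma>: "\<sigma> \<noteq> 0 \<longrightarrow> fst p \<in> u ` {1..n}" and \<tau>: "\<tau> \<noteq> 0 \<longrightarrow> snd p \<in> u ` {1..n}"
      obtain m where m: "?\<epsilon> m < \<epsilon>" using \<epsilon> nat_approx_posE by blast
      have "\<exists>q\<in>K. on_side \<sigma> (fst q - fst p) \<and> on_side \<tau> (snd q - snd p) \<and>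
         \<bar>fst q - fst p\<bar> < ?\<epsilon> m \<and> \<bar>snd q - snd p\<bar> < ?\<epsilon> m"
      proof (cases "\<sigma> = 0 \<and> \<tau> = 0")
        case True
        then show ?thesis using p(1) by (intro bexI[of _ p]) (auto simp: on_side_def)
      next
        case False
        have "p \<notin> lonely K \<sigma> \<tau> (?\<epsilon> m)"
        proof
          assume L: "p \<in> lonely K \<sigma> \<tau> (?\<epsilon> m)"
          consider "\<sigma> \<in> {-1, 1}" "\<tau> = 0" | "\<sigma> = 0" "\<tau> \<in> {-1, 1}" | "\<sigma> \<in> {-1, 1}" "\<tau> \<in> {-1, 1}"
            using s False by auto
          then show False
          proof cases
            case 1
            then obtain i where "i \<in> {1..n}" "fst p = u i" using \<sigma> by auto
            with elim(2) 1 L show False by (metis imageI)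
          next
            case 2
            then obtain i where "i \<in> {1..n}" "snd p = u i" using \<tau> by auto
            with elim(3) 2 L show False by (metis imageI)
          next
            case 3
            then obtain i j where ij: "i \<in> {1..n}" "fst p = u i" "j \<in> {1..n}" "snd p = u j" using \<sigma> \<tau> by auto
            then have "j \<in> {1..n} - {i}" using p by auto
            with elim(4) ij 3 have "(u i, u j) \<notin> lonely K \<sigma> \<tau> (?\<epsilon> m)" by blast
            with L ij show False by (metis prod.collapse)
          qed
        qed
        then show ?thesis using p(1) unfolding lonely_def by blast
      qed
      then show "\<exists>q\<in>K. on_side \<sigma> (fst q - fst p) \<and> on_side \<tau> (snd q - snd p) \<and>
         \<bar>fst q - fst p\<bar> < \<epsilon> \<and> \<bar>snd q - snd p\<bar> < \<epsilon>"
        using m by (meson order.strict_trans)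
    qed
  qed
qed

section \<open>Continuity of the sampling probabilities\<close>

lemma sample_gap:
  fixes u :: "nat \<Rightarrow> real"
  obtains \<delta> :: real where "\<delta> > 0"
    "\<And>i. i \<in> {1..n} \<Longrightarrow> u i \<noteq> a \<Longrightarrow> \<delta> \<le> \<bar>u i - a\<bar>"
    "\<And>i. i \<in> {1..n} \<Longrightarrow> u i \<noteq> b \<Longrightarrow> \<delta> \<le> \<bar>u i - b\<bar>"
proof -
  obtain d1 where d1: "d1 > 0" "\<forall>x\<in>u ` {1..n}. x \<noteq> a \<longrightarrow> d1 \<le> dist a x"
    using finite_set_avoid[OF finite_imageI[OF finite_atLeastAtMost], of u 1 n a] by blast
  obtain d2 where d2: "d2 > 0" "\<forall>x\<in>u ` {1..n}. x \<noteq> b \<longrightarrow> d2 \<le> dist b x"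
    using finite_set_avoid[OF finite_imageI[OF finite_atLeastAtMost], of u 1 n b] by blast
  show ?thesis
  proof (rule that[of "min d1 d2"])
    show "min d1 d2 > 0" using d1 d2 by simp
    show "min d1 d2 \<le> \<bar>u i - a\<bar>" if "i \<in> {1..n}" "u i \<noteq> a" for i
      using d1(2) that by (fastforce simp: dist_real_def abs_minus_commute min_le_iff_disj)
    show "min d1 d2 \<le> \<bar>u i - b\<bar>" if "i \<in> {1..n}" "u i \<noteq> b" for i
      using d2(2) that by (fastforce simp: dist_real_def abs_minus_commute min_le_iff_disj)
  qed
qed

text \<open>If a coordinate of \<open>p\<close> is itself a sample point, then \<open>K\<close> has points near \<open>p\<close> on either side of it,
  and one picks the side that \<open>p'\<close> is on. If \<open>p\<close> is on the diagonal, the interval given by \<open>p'\<close> is so short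
  that it contains one sample point at most.\<close>

lemma generic_nearby_trace:
  assumes g: "generic K u n" and p: "p \<in> K" "fst p \<le> snd p"
  obtains \<delta> where "\<delta> > 0" "\<And>p'. dist p p' < \<delta> \<Longrightarrow> sample_trace n u p' \<in> sampled_hypergraph K u n"
proof -
  obtain \<delta> :: real where \<delta>: "\<delta> > 0" and
    a: "\<And>i. i \<in> {1..n} \<Longrightarrow> u i \<noteq> fst p \<Longrightarrow> \<delta> \<le> \<bar>u i - fst p\<bar>" and
    b: "\<And>i. i \<in> {1..n} \<Longrightarrow> u i \<noteq> snd p \<Longrightarrow> \<delta> \<le> \<bar>u i - snd p\<bar>"
    by (rule sample_gap[where n = n and u = u and a = "fst p" and b = "snd p"]) blast
  have inj: "inj_on u {1..n}" using g by (simp add: generic_def)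
  have "sample_trace n u p' \<in> sampled_hypergraph K u n" if "dist p p' < \<delta>" for p'
  proof -
    have p': "\<bar>fst p - fst p'\<bar> < \<delta>" "\<bar>snd p - snd p'\<bar> < \<delta>"
      using dist_fst_snd_less[OF that] by auto
    show ?thesis
    proof (cases "fst p = snd p")
      case True
      have "u i = fst p" if "i \<in> sample_trace n u p'" for i
      proof (rule ccontr)
        assume "u i \<noteq> fst p"
        moreover have i: "i \<in> {1..n}" "fst p' < u i" "u i < snd p'" using that by (auto simp: sample_trace_def)
        ultimately have "\<delta> \<le> \<bar>u i - fst p\<bar>" using a by blast
        with i p' True show False by linarith
      qed
      moreover have "sample_trace n u p' \<subseteq> {1..n}" by (auto simp: sample_trace_def)
      ultimately have "\<forall>i\<in>sample_trace n u p'. \<forall>j\<in>sample_trace n u p'. i = j"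
        using inj by (metis inj_onD subsetD)
      then consider "sample_trace n u p' = {}" | i where "sample_trace n u p' = {i}" by blast
      then show ?thesis
      proof cases
        case (2 i)
        then have "i \<in> {1..n}" by (auto simp: sample_trace_def)
        with 2 show ?thesis by (simp add: sampled_hypergraph_eq)
      qed (simp add: sampled_hypergraph_eq)
    next
      case False
      with p have lt: "fst p < snd p" by simp
      define \<sigma> :: real where "\<sigma> = (if fst p \<in> u ` {1..n} then if fst p' < fst p then -1 else 1 else 0)"
      define \<tau> :: real where "\<tau> = (if snd p \<in> u ` {1..n} then if snd p < snd p' then 1 else -1 else 0)"
      have "\<sigma> \<in> {-1, 0, 1}" "\<tau> \<in> {-1, 0, 1}" "\<sigma> \<noteq> 0 \<longrightarrow> fst p \<in> u ` {1..n}" "\<tau> \<noteq> 0 \<longrightarrow> snd p \<in> u ` {1..n}"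
        by (auto simp: \<sigma>_def \<tau>_def)
      then obtain q where q: "q \<in> K" "on_side \<sigma> (fst q - fst p)" "on_side \<tau> (snd q - snd p)"
         "\<bar>fst q - fst p\<bar> < \<delta>" "\<bar>snd q - snd p\<bar> < \<delta>"
        using g[unfolded generic_def] \<delta> p(1) lt by blast
      have l: "fst q < u i \<longleftrightarrow> fst p' < u i" if "i \<in> {1..n}" for i
      proof (cases "u i = fst p")
        case True
        then have "fst p \<in> u ` {1..n}" using that by force
        with q(2) True show ?thesis by (auto simp: \<sigma>_def on_side_def split: if_splits)
      next
        case False
        then have "\<delta> \<le> \<bar>u i - fst p\<bar>" using a that by blast
        with q(4) p'(1) show ?thesis by linarith
      qed
      have r: "u i < snd q \<longleftrightarrow> u i < snd p'" if "i \<in> {1..n}" for i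
      proof (cases "u i = snd p")
        case True
        then have "snd p \<in> u ` {1..n}" using that by force
        with q(3) True show ?thesis by (auto simp: \<tau>_def on_side_def split: if_splits)
      next
        case False
        then have "\<delta> \<le> \<bar>u i - snd p\<bar>" using b that by blast
        with q(5) p'(2) show ?thesis by linarith
      qed
      have "sample_trace n u p' = sample_trace n u q" using l r by (auto simp: sample_trace_def)
      then show ?thesis using q(1) by (auto simp: sampled_hypergraph_eq)
    qed
  qed
  with \<delta> show ?thesis using that by blast
qed

text \<open>A trace is lost under small perturbations only if a coordinate of \<open>p\<close> is a sample point that the
  perturbed interval takes in. Moving \<open>p\<close> within \<open>K\<close> so as to shrink the interval past these sample
  points leaves the trace unchanged and makes it stable.\<close>

lemma generic_stable_trace:
  assumes g: "generic K u n" and e: "e \<in> sampled_hypergraph K u n"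
  shows "(\<forall>L. e \<in> sampled_hypergraph L u n) \<or>
    (\<exists>q\<in>K. \<exists>\<delta>>0. \<forall>q'. dist q q' < \<delta> \<longrightarrow> sample_trace n u q' = e)"
proof (cases "e = {} \<or> e \<in> (\<lambda>j. {j}) ` {1..n}")
  case True
  then show ?thesis unfolding sampled_hypergraph_eq by blast
next
  case False
  then obtain p where p: "p \<in> K" "e = sample_trace n u p" using e unfolding sampled_hypergraph_eq by blast
  with False have lt: "fst p < snd p" by (auto simp: sample_trace_def)
  obtain \<delta> :: real where \<delta>: "\<delta> > 0" and
    a: "\<And>i. i \<in> {1..n} \<Longrightarrow> u i \<noteq> fst p \<Longrightarrow> \<delta> \<le> \<bar>u i - fst p\<bar>" and
    b: "\<And>i. i \<in> {1..n} \<Longrightarrow> u i \<noteq> snd p \<Longrightarrow> \<delta> \<le> \<bar>u i - snd p\<bar>"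
    by (rule sample_gap[where n = n and u = u and a = "fst p" and b = "snd p"]) blast
  define \<sigma> :: real where "\<sigma> = (if fst p \<in> u ` {1..n} then 1 else 0)"
  define \<tau> :: real where "\<tau> = (if snd p \<in> u ` {1..n} then -1 else 0)"
  have "\<sigma> \<in> {-1, 0, 1}" "\<tau> \<in> {-1, 0, 1}" "\<sigma> \<noteq> 0 \<longrightarrow> fst p \<in> u ` {1..n}" "\<tau> \<noteq> 0 \<longrightarrow> snd p \<in> u ` {1..n}"
    by (auto simp: \<sigma>_def \<tau>_def)
  then obtain q where q: "q \<in> K" "on_side \<sigma> (fst q - fst p)" "on_side \<tau> (snd q - snd p)"
     "\<bar>fst q - fst p\<bar> < \<delta>" "\<bar>snd q - snd p\<bar> < \<delta>"
    using g[unfolded generic_def] \<delta> p(1) lt by blast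
  have l: "u i \<noteq> fst q \<and> (fst q < u i \<longleftrightarrow> fst p < u i)" if "i \<in> {1..n}" for i
  proof (cases "u i = fst p")
    case True
    then have "fst p \<in> u ` {1..n}" using that by force
    with q(2) True show ?thesis by (auto simp: \<sigma>_def on_side_def split: if_splits)
  next
    case False
    then have "\<delta> \<le> \<bar>u i - fst p\<bar>" using a that by blast
    with q(4) show ?thesis by linarith
  qed
  have r: "u i \<noteq> snd q \<and> (u i < snd q \<longleftrightarrow> u i < snd p)" if "i \<in> {1..n}" for i
  proof (cases "u i = snd p")
    case True
    then have "snd p \<in> u ` {1..n}" using that by force
    with q(3) True show ?thesis by (auto simp: \<tau>_def on_side_def split: if_splits)
  next
    case False
    then have "\<delta> \<le> \<bar>u i - snd p\<bar>" using b that by blast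
    with q(5) show ?thesis by linarith
  qed
  obtain \<eta> :: real where \<eta>: "\<eta> > 0" and
    a': "\<And>i. i \<in> {1..n} \<Longrightarrow> u i \<noteq> fst q \<Longrightarrow> \<eta> \<le> \<bar>u i - fst q\<bar>" and
    b': "\<And>i. i \<in> {1..n} \<Longrightarrow> u i \<noteq> snd q \<Longrightarrow> \<eta> \<le> \<bar>u i - snd q\<bar>"
    by (rule sample_gap[where n = n and u = u and a = "fst q" and b = "snd q"]) blast
  have "sample_trace n u q' = e" if "dist q q' < \<eta>" for q'
  proof -
    have q': "\<bar>fst q - fst q'\<bar> < \<eta>" "\<bar>snd q - snd q'\<bar> < \<eta>"
      using dist_fst_snd_less[OF that] by auto
    have "fst q' < u i \<longleftrightarrow> fst p < u i" "u i < snd q' \<longleftrightarrow> u i < snd p" if "i \<in> {1..n}" for i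
    proof -
      have "\<eta> \<le> \<bar>u i - fst q\<bar>" "\<eta> \<le> \<bar>u i - snd q\<bar>" using l[OF that] r[OF that] a' b' that by blast+
      with q' l[OF that] r[OF that] show "fst q' < u i \<longleftrightarrow> fst p < u i" "u i < snd q' \<longleftrightarrow> u i < snd p"
        by linarith+
    qed
    then show ?thesis unfolding p(2) by (auto simp: sample_trace_def)
  qed
  with q(1) \<eta> show ?thesis by blast
qed

lemma sampled_hypergraph_eventually_eq:
  assumes A: "\<And>m. A m \<in> nonempty_compacts triangle" and K: "K \<in> nonempty_compacts triangle"
    and lim: "(\<lambda>m. hausdorff_dist (A m) K) \<longlonglongrightarrow> 0" and g: "generic K u n"
  shows "\<forall>\<^sub>F m in sequentially. sampled_hypergraph (A m) u n = sampled_hypergraph K u n"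
proof -
  have ev: "\<forall>\<^sub>F m in sequentially. hausdorff_dist (A m) K < \<delta>" if "\<delta> > 0" for \<delta>
    using order_tendstoD(2)[OF lim that] .
  have 1: "\<forall>\<^sub>F m in sequentially. sampled_hypergraph (A m) u n \<subseteq> sampled_hypergraph K u n"
  proof -
    have "\<forall>p\<in>K. \<exists>\<delta>>0. \<forall>p'. dist p p' < \<delta> \<longrightarrow> sample_trace n u p' \<in> sampled_hypergraph K u n"
    proof
      fix p assume p: "p \<in> K"
      then have "fst p \<le> snd p" using K by (auto simp: nonempty_compacts_def triangle_def)
      with generic_nearby_trace[OF g p] show "\<exists>\<delta>>0. \<forall>p'. dist p p' < \<delta> \<longrightarrow> sample_trace n u p' \<in> sampled_hypergraph K u n"
        by metis
    qed
    then obtain \<delta> where \<delta>: "\<And>p. p \<in> K \<Longrightarrow> \<delta> p > 0"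
      "\<And>p p'. p \<in> K \<Longrightarrow> dist p p' < \<delta> p \<Longrightarrow> sample_trace n u p' \<in> sampled_hypergraph K u n" by metis
    \<comment> \<open>A Lebesgue number of the cover of \<open>K\<close> by the balls with radii \<open>\<delta> p\<close>.\<close>
    have "compact K" using K by (auto simp: nonempty_compacts_def)
    moreover have "K \<subseteq> \<Union> ((\<lambda>p. ball p (\<delta> p)) ` K)" using \<delta>(1) by force
    ultimately obtain \<eta> where \<eta>: "\<eta> > 0" "\<forall>p\<in>K. \<exists>b\<in>(\<lambda>p. ball p (\<delta> p)) ` K. ball p \<eta> \<subseteq> b"
      by (rule Heine_Borel_lemma) auto
    show ?thesis
      using ev[OF \<eta>(1)]
    proof eventually_elim
      case (elim m)
      have "sample_trace n u p' \<in> sampled_hypergraph K u n" if mem: "p' \<in> A m" for p'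
      proof -
        obtain p where p: "p \<in> K" "dist p' p < \<eta>" using hausdorff_dist_lessD[OF A K elim mem] by blast
        then obtain p0 where "p0 \<in> K" "ball p \<eta> \<subseteq> ball p0 (\<delta> p0)" using \<eta>(2) by blast
        moreover have "p' \<in> ball p \<eta>" unfolding mem_ball by (subst dist_commute) (rule p(2))
        ultimately have "p0 \<in> K" "p' \<in> ball p0 (\<delta> p0)" by blast+
        then show ?thesis using \<delta>(2)[of p0 p'] by (simp only: mem_ball)
      qed
      then show ?case unfolding sampled_hypergraph_eq[of "A m"] by (auto simp: sampled_hypergraph_eq[of K])
    qed
  qed
  have 2: "\<forall>\<^sub>F m in sequentially. e \<in> sampled_hypergraph (A m) u n" if e: "e \<in> sampled_hypergraph K u n" for e
    using generic_stable_trace[OF g e]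
  proof (elim disjE bexE exE conjE)
    assume "\<forall>L. e \<in> sampled_hypergraph L u n"
    then show ?thesis by simp
  next
    fix q \<delta> assume q: "q \<in> K" "\<delta> > 0" "\<forall>q'. dist q q' < \<delta> \<longrightarrow> sample_trace n u q' = e"
    show ?thesis
      using ev[OF q(2)]
    proof eventually_elim
      case (elim m)
      then have "hausdorff_dist K (A m) < \<delta>" by (simp only: hausdorff_dist_commute)
      from hausdorff_dist_lessD[OF K A this q(1)] obtain q' where "q' \<in> A m" "dist q q' < \<delta>" by blast
      with q(3) show ?case unfolding sampled_hypergraph_eq by blast
    qed
  qed
  have "finite (sampled_hypergraph K u n)"
    using sampled_hypergraph_subset by (rule finite_subset) simp
  then have "\<forall>\<^sub>F m in sequentially. \<forall>e\<in>sampled_hypergraph K u n. e \<in> sampled_hypergraph (A m) u n"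
    using 2 by (simp add: eventually_ball_finite)
  with 1 show ?thesis by eventually_elim blast
qed

definition sample_prob :: "nat \<Rightarrow> nat set set \<Rightarrow> (real \<times> real) set \<Rightarrow> real" where
  "sample_prob k h A = measure uniform_seq {u \<in> space uniform_seq. sampled_hypergraph A u k = h}"

lemma sets_uniform_seq: "sets uniform_seq = sets (\<Pi>\<^sub>M i\<in>{1::nat..}. borel)"
  by (rule sets_PiM_cong) auto

lemma sample_event:
  assumes "A \<in> nonempty_compacts triangle"
  shows "{u \<in> space uniform_seq. sampled_hypergraph A u k = h} \<in> sets uniform_seq"
proof -
  have m: "(\<lambda>u. sampled_hypergraph A u k) \<in> uniform_seq \<rightarrow>\<^sub>M count_space (InHy k)"
    using measurable_Pair2[OF measurable_sampled_hypergraph, of A k] assms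
    unfolding measurable_cong_sets[OF sets_uniform_seq refl] by simp
  have "{u \<in> space uniform_seq. sampled_hypergraph A u k = h} =
      (\<lambda>u. sampled_hypergraph A u k) -` ({h} \<inter> InHy k) \<inter> space uniform_seq"
    using sampled_hypergraph_InHy by auto
  also have "\<dots> \<in> sets uniform_seq" by (rule measurable_sets[OF m]) simp
  finally show ?thesis .
qed

lemma sample_prob_continuous:
  assumes A: "\<And>m. A m \<in> nonempty_compacts triangle" and K: "K \<in> nonempty_compacts triangle"
    and lim: "(\<lambda>m. hausdorff_dist (A m) K) \<longlonglongrightarrow> 0"
  shows "(\<lambda>m. sample_prob k h (A m)) \<longlonglongrightarrow> sample_prob k h K"
proof -
  let ?E = "\<lambda>A. {u \<in> space uniform_seq. sampled_hypergraph A u k = h}"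
  have eq: "sample_prob k h B = (\<integral>u. indicator (?E B) u \<partial>uniform_seq)" if "B \<in> nonempty_compacts triangle" for B
    using sample_event[OF that, of k h] by (simp add: sample_prob_def)
  have "(\<lambda>m. \<integral>u. indicator (?E (A m)) u \<partial>uniform_seq) \<longlonglongrightarrow> (\<integral>u. indicator (?E K) u \<partial>uniform_seq :: real)"
  proof (rule integral_dominated_convergence[where w = "\<lambda>_. 1"])
    show "indicator (?E K) \<in> borel_measurable uniform_seq"
      by (rule borel_measurable_indicator[OF sample_event[OF K]])
    show "indicator (?E (A m)) \<in> borel_measurable uniform_seq" for m
      by (rule borel_measurable_indicator[OF sample_event[OF A]])
    have "closed K" using K by (auto simp: nonempty_compacts_def compact_imp_closed)
    from AE_generic[OF this, of k]
    show "AE u in uniform_seq. (\<lambda>m. indicator (?E (A m)) u) \<longlonglongrightarrow> (indicator (?E K) u :: real)"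
    proof eventually_elim
      case (elim u)
      from sampled_hypergraph_eventually_eq[OF A K lim this]
      have "\<forall>\<^sub>F m in sequentially. indicator (?E (A m)) u = (indicator (?E K) u :: real)"
        by eventually_elim (simp add: indicator_def)
      then show ?case by (rule tendsto_eventually)
    qed
    show "integrable uniform_seq (\<lambda>_. 1 :: real)" by (rule unif.P.integrable_const)
  qed (auto simp: indicator_def)
  then show ?thesis by (simp only: eq[OF A] eq[OF K])
qed

section \<open>Finite interval hypergraphs as compact sets\<close>

lemma InHyI:
  fixes \<sigma> :: "nat \<Rightarrow> nat"
  assumes "h \<subseteq> Pow {1..n}" "{} \<in> h" "\<And>j. j \<in> {1..n} \<Longrightarrow> {j} \<in> h" and inj: "inj_on \<sigma> {1..n}"
    and int: "\<And>e x y z. e \<in> h \<Longrightarrow> x \<in> e \<Longrightarrow> y \<in> e \<Longrightarrow> z \<in> {1..n} \<Longrightarrow> \<sigma> x \<le> \<sigma> z \<Longrightarrow> \<sigma> z \<le> \<sigma> y \<Longrightarrow> z \<in> e"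
  shows "h \<in> InHy n"
proof -
  define l where "l = {(x, y). x \<in> {1..n} \<and> y \<in> {1..n} \<and> \<sigma> x \<le> \<sigma> y}"
  have "trans l" "antisym l" "total_on {1..n} l" "refl_on {1..n} l" "l \<subseteq> {1..n} \<times> {1..n}"
  proof -
    show "antisym l"
    proof (rule antisymI)
      fix x y assume "(x, y) \<in> l" "(y, x) \<in> l"
      then show "x = y" using inj_onD[OF inj, of x y] by (simp add: l_def)
    qed
  qed (auto simp: l_def total_on_def refl_on_def trans_def)
  then have "linear_order_on {1..n} l"
    by (auto simp: linear_order_on_def partial_order_on_def preorder_on_def)
  moreover have "interval_wrt l {1..n} e" if "e \<in> h" for e
  proof -
    have "e \<subseteq> {1..n}" using that assms(1) by auto
    then show ?thesis using int[OF that] unfolding interval_wrt_def l_def by blast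
  qed
  ultimately show ?thesis using assms(1-3) unfolding InHy_def interval_hypergraph_def by blast
qed

text \<open>The position of \<open>x\<close> is the number of vertices that do not come after \<open>x\<close>; intervals of the linear
  order are the sets of vertices with positions between a minimum and a maximum.\<close>

lemma InHy_positions:
  assumes "h \<in> InHy n"
  shows "\<exists>\<sigma>. bij_betw \<sigma> {1..n} {1..n} \<and>
    (\<forall>e\<in>h. e \<noteq> {} \<longrightarrow> (\<exists>a\<in>{1..n}. \<exists>b\<in>{1..n}. a \<le> b \<and> e = {x \<in> {1..n}. a \<le> \<sigma> x \<and> \<sigma> x \<le> b}))"
proof -
  obtain l where l: "linear_order_on {1..n} l" and int: "\<And>e. e \<in> h \<Longrightarrow> interval_wrt l {1..n} e"
    using assms unfolding InHy_def interval_hypergraph_def by blast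
  have ord: "refl_on {1..n} l" "trans l" "antisym l" "total_on {1..n} l"
    using l by (auto simp: linear_order_on_def partial_order_on_def preorder_on_def)
  define D where "D x = {z \<in> {1..n}. (z, x) \<in> l}" for x
  define \<sigma> where "\<sigma> x = card (D x)" for x
  have fin: "finite (D x)" "D x \<subseteq> {1..n}" for x by (auto simp: D_def)
  have self: "x \<in> D x" if "x \<in> {1..n}" for x using ord(1) that by (auto simp: D_def refl_on_def)
  have mono: "D x \<subseteq> D y" if "(x, y) \<in> l" for x y
    using transD[OF ord(2)] that unfolding D_def by blast
  have le: "\<sigma> x \<le> \<sigma> y" if "(x, y) \<in> l" for x y
    unfolding \<sigma>_def by (rule card_mono[OF fin(1) mono[OF that]])
  have iff: "(x, y) \<in> l \<longleftrightarrow> \<sigma> x \<le> \<sigma> y" if xy: "x \<in> {1..n}" "y \<in> {1..n}" for x y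
  proof
    assume s: "\<sigma> x \<le> \<sigma> y"
    show "(x, y) \<in> l"
    proof (cases "(y, x) \<in> l")
      case True
      then have "D y = D x"
        using mono[OF True] s card_subset_eq[OF fin(1), of "D y" x] card_mono[OF fin(1), of "D y" x]
        unfolding \<sigma>_def by (metis le_antisym)
      with self[OF xy(1)] have "x \<in> D y" by simp
      then show ?thesis unfolding D_def by blast
    next
      case False
      then show ?thesis using ord(1,4) xy unfolding refl_on_def total_on_def by metis
    qed
  qed (rule le)
  have inj: "inj_on \<sigma> {1..n}"
    by (rule inj_onI) (metis antisymD[OF ord(3)] iff order_refl)
  have rng: "\<sigma> ` {1..n} \<subseteq> {1..n}"
  proof
    fix s assume "s \<in> \<sigma> ` {1..n}"
    then obtain x where x: "x \<in> {1..n}" "s = \<sigma> x" by auto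
    have "0 < card (D x)" using self[OF x(1)] fin(1) card_gt_0_iff by blast
    moreover have "card (D x) \<le> card {1..n}" by (rule card_mono[OF finite_atLeastAtMost fin(2)])
    ultimately show "s \<in> {1..n}" using x by (auto simp: \<sigma>_def)
  qed
  have "\<sigma> ` {1..n} = {1..n}" using rng inj by (rule endo_inj_surj[OF finite_atLeastAtMost])
  with inj have bij: "bij_betw \<sigma> {1..n} {1..n}" by (simp add: bij_betw_def)
  have "\<exists>a\<in>{1..n}. \<exists>b\<in>{1..n}. a \<le> b \<and> e = {x \<in> {1..n}. a \<le> \<sigma> x \<and> \<sigma> x \<le> b}" if e: "e \<in> h" "e \<noteq> {}" for e
  proof -
    have sub: "e \<subseteq> {1..n}" using int[OF e(1)] by (simp add: interval_wrt_def)
    then have fine: "finite (\<sigma> ` e)" "\<sigma> ` e \<noteq> {}" using e finite_subset by auto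
    obtain x where x: "x \<in> e" "Min (\<sigma> ` e) = \<sigma> x" using Min_in[OF fine] by auto
    obtain y where y: "y \<in> e" "Max (\<sigma> ` e) = \<sigma> y" using Max_in[OF fine] by auto
    have bounds: "\<sigma> x \<le> \<sigma> z" "\<sigma> z \<le> \<sigma> y" if "z \<in> e" for z
      using Min_le[OF fine(1)] Max_ge[OF fine(1)] that x y by force+
    have "z \<in> e" if "z \<in> {1..n}" "\<sigma> x \<le> \<sigma> z" "\<sigma> z \<le> \<sigma> y" for z
      using int[OF e(1)] that x(1) y(1) iff[of x z] iff[of z y] sub unfolding interval_wrt_def by blast
    then have "e = {z \<in> {1..n}. \<sigma> x \<le> \<sigma> z \<and> \<sigma> z \<le> \<sigma> y}" using bounds sub by blast
    moreover have "\<sigma> x \<in> {1..n}" "\<sigma> y \<in> {1..n}" using rng x(1) y(1) sub by blast+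
    moreover have "\<sigma> x \<le> \<sigma> y" using bounds x by blast
    ultimately show ?thesis by blast
  qed
  with bij show ?thesis by blast
qed

definition positions :: "nat \<Rightarrow> nat set set \<Rightarrow> nat \<Rightarrow> nat" where
  "positions n h = (SOME \<sigma>. bij_betw \<sigma> {1..n} {1..n} \<and>
    (\<forall>e\<in>h. e \<noteq> {} \<longrightarrow> (\<exists>a\<in>{1..n}. \<exists>b\<in>{1..n}. a \<le> b \<and> e = {x \<in> {1..n}. a \<le> \<sigma> x \<and> \<sigma> x \<le> b})))"

lemma positions:
  assumes "h \<in> InHy n"
  shows "bij_betw (positions n h) {1..n} {1..n}"
    "\<And>e. e \<in> h \<Longrightarrow> e \<noteq> {} \<Longrightarrow>
       \<exists>a\<in>{1..n}. \<exists>b\<in>{1..n}. a \<le> b \<and> e = {x \<in> {1..n}. a \<le> positions n h x \<and> positions n h x \<le> b}"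
proof -
  note * = someI_ex[OF InHy_positions[OF assms], folded positions_def]
  show "bij_betw (positions n h) {1..n} {1..n}" by (rule conjunct1[OF *])
  show "\<exists>a\<in>{1..n}. \<exists>b\<in>{1..n}. a \<le> b \<and> e = {x \<in> {1..n}. a \<le> positions n h x \<and> positions n h x \<le> b}"
    if "e \<in> h" "e \<noteq> {}" for e
    using bspec[OF conjunct2[OF *] that(1)] that(2) by (rule mp)
qed

definition diagonal :: "(real \<times> real) set" where
  "diagonal = (\<lambda>x. (x, x)) ` {0..1}"

text \<open>The hyperedge with positions \<open>a, \<dots>, b\<close> becomes the union of the cells \<open>((s - 1) / n, s / n)\<close> with
  \<open>a \<le> s \<le> b\<close>, up to end points.\<close>

definition embedded :: "nat \<Rightarrow> nat set set \<Rightarrow> (real \<times> real) set" where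
  "embedded n h = diagonal \<union> {((real a - 1) / real n, real b / real n) | a b.
     a \<in> {1..n} \<and> b \<in> {1..n} \<and> a \<le> b \<and> {x \<in> {1..n}. a \<le> positions n h x \<and> positions n h x \<le> b} \<in> h}"

lemma embedded_nonempty_compact: "embedded n h \<in> nonempty_compacts triangle"
proof -
  have "finite {((real a - 1) / real n, real b / real n) | a b.
     a \<in> {1..n} \<and> b \<in> {1..n} \<and> a \<le> b \<and> {x \<in> {1..n}. a \<le> positions n h x \<and> positions n h x \<le> b} \<in> h}"
    by (rule finite_subset[of _ "(\<lambda>(a, b). ((real a - 1) / real n, real b / real n)) ` ({1..n} \<times> {1..n})"]) auto
  then have "compact {((real a - 1) / real n, real b / real n) | a b.
     a \<in> {1..n} \<and> b \<in> {1..n} \<and> a \<le> b \<and> {x \<in> {1..n}. a \<le> positions n h x \<and> positions n h x \<le> b} \<in> h}"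
    by (rule finite_imp_compact)
  moreover have "compact diagonal"
    unfolding diagonal_def by (intro compact_continuous_image continuous_intros) auto
  ultimately have "compact (embedded n h)" unfolding embedded_def by (intro compact_Un)
  moreover have "embedded n h \<subseteq> triangle"
  proof
    fix p assume "p \<in> embedded n h"
    then consider x where "x \<in> {0..1}" "p = (x, x)" | a b where "a \<in> {1..n}" "b \<in> {1..n}" "a \<le> b"
        "p = ((real a - 1) / real n, real b / real n)"
      unfolding embedded_def diagonal_def by blast
    then show "p \<in> triangle"
    proof cases
      case (2 a b)
      then show ?thesis by (auto simp: triangle_def divide_right_mono)
    qed (auto simp: triangle_def)
  qed
  moreover have "(0, 0) \<in> embedded n h" by (auto simp: embedded_def diagonal_def)
  ultimately show ?thesis unfolding nonempty_compacts_def by blast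
qed

text \<open>For injective \<open>\<gamma>\<close> this is the hypergraph induced on the vertices \<open>\<gamma> 1, \<dots>, \<gamma> k\<close>, relabelled.\<close>

definition pull_back :: "nat \<Rightarrow> (nat \<Rightarrow> nat) \<Rightarrow> nat set set \<Rightarrow> nat set set" where
  "pull_back k \<gamma> h = (\<lambda>e. {i \<in> {1..k}. \<gamma> i \<in> e}) ` h"

text \<open>A point in the cell with number \<open>s\<close> lies in the interval from \<open>(a - 1) / n\<close> to \<open>b / n\<close> iff
  \<open>a \<le> s \<le> b\<close>, so the points of the embedded set cut out the preimages of the hyperedges. Injectivity makes the
  singletons, which belong to every sampled hypergraph, preimages of singletons.\<close>

lemma sample_embedded:
  assumes h: "h \<in> InHy n" and \<gamma>: "\<gamma> ` {1..k} \<subseteq> {1..n}" "inj_on \<gamma> {1..k}"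
    and u: "\<And>i. i \<in> {1..k} \<Longrightarrow>
       u i \<in> {(real (positions n h (\<gamma> i)) - 1) / real n <..< real (positions n h (\<gamma> i)) / real n}"
  shows "sampled_hypergraph (embedded n h) u k = pull_back k \<gamma> h"
proof -
  let ?\<sigma> = "positions n h"
  have hy: "{} \<in> h" "\<And>j. j \<in> {1..n} \<Longrightarrow> {j} \<in> h"
    using h by (auto simp: InHy_def interval_hypergraph_def)
  have lower: "(real a - 1) / real n < u i \<longleftrightarrow> a \<le> ?\<sigma> (\<gamma> i)"
    and upper: "u i < real a / real n \<longleftrightarrow> ?\<sigma> (\<gamma> i) \<le> a" if i: "i \<in> {1..k}" for i a
  proof -
    have n: "real n > 0" using \<gamma>(1) i by fastforce
    have b: "real (?\<sigma> (\<gamma> i)) - 1 < real n * u i" "real n * u i < real (?\<sigma> (\<gamma> i))"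
      using u[OF i] n by (simp_all add: field_simps)
    have "real a - 1 < real n * u i \<longleftrightarrow> a \<le> ?\<sigma> (\<gamma> i)" using b by linarith
    then show "(real a - 1) / real n < u i \<longleftrightarrow> a \<le> ?\<sigma> (\<gamma> i)"
      using n by (simp add: divide_less_eq mult.commute)
    have "real n * u i < real a \<longleftrightarrow> ?\<sigma> (\<gamma> i) \<le> a" using b by linarith
    then show "u i < real a / real n \<longleftrightarrow> ?\<sigma> (\<gamma> i) \<le> a"
      using n by (simp add: less_divide_eq mult.commute)
  qed
  have tr: "sample_trace k u ((real a - 1) / real n, real b / real n) =
      {i \<in> {1..k}. \<gamma> i \<in> {x \<in> {1..n}. a \<le> ?\<sigma> x \<and> ?\<sigma> x \<le> b}}" for a b
    using lower upper \<gamma>(1) unfolding sample_trace_def fst_conv snd_conv by blast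
  have empty: "{} \<in> pull_back k \<gamma> h" unfolding pull_back_def using hy(1) by (intro image_eqI[of _ _ "{}"]) auto
  show ?thesis
  proof (intro equalityI subsetI)
    fix e assume "e \<in> sampled_hypergraph (embedded n h) u k"
    then consider x where "e = sample_trace k u (x, x)"
      | a b where "{x \<in> {1..n}. a \<le> ?\<sigma> x \<and> ?\<sigma> x \<le> b} \<in> h" "e = sample_trace k u ((real a - 1) / real n, real b / real n)"
      | j where "j \<in> {1..k}" "e = {j}" | "e = {}"
      unfolding sampled_hypergraph_eq embedded_def diagonal_def by blast
    then show "e \<in> pull_back k \<gamma> h"
    proof cases
      case (1 x)
      then have "e = {}" by (auto simp: sample_trace_def)
      with empty show ?thesis by simp
    next
      case (2 a b)
      then show ?thesis unfolding tr pull_back_def by blast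
    next
      case (3 j)
      then have "e = {i \<in> {1..k}. \<gamma> i \<in> {\<gamma> j}}" using \<gamma>(2) by (auto dest: inj_onD)
      moreover have "{\<gamma> j} \<in> h" using hy(2) \<gamma>(1) 3 by blast
      ultimately show ?thesis unfolding pull_back_def by blast
    qed (simp add: empty)
  next
    fix e assume "e \<in> pull_back k \<gamma> h"
    then obtain e' where e': "e' \<in> h" "e = {i \<in> {1..k}. \<gamma> i \<in> e'}" unfolding pull_back_def by blast
    show "e \<in> sampled_hypergraph (embedded n h) u k"
    proof (cases "e' = {}")
      case True
      then show ?thesis using e' by (simp add: sampled_hypergraph_eq)
    next
      case False
      from positions(2)[OF h e'(1) this] obtain a b where ab: "a \<in> {1..n}" "b \<in> {1..n}" "a \<le> b"
        "e' = {x \<in> {1..n}. a \<le> ?\<sigma> x \<and> ?\<sigma> x \<le> b}" by blast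
      have "((real a - 1) / real n, real b / real n) \<in> embedded n h"
        using ab e'(1) unfolding embedded_def by blast
      moreover have "e = sample_trace k u ((real a - 1) / real n, real b / real n)"
        unfolding tr e'(2) ab(4) ..
      ultimately show ?thesis unfolding sampled_hypergraph_eq by blast
    qed
  qed
qed

lemma emeasure_unif01_cell:
  assumes "s \<in> {1..n}"
  shows "emeasure unif01 {(real s - 1) / real n <..< real s / real n} = ennreal (1 / real n)"
proof -
  have n: "real n > 0" and s: "1 \<le> real s" "real s \<le> real n" using assms by auto
  have "0 \<le> (real s - 1) / real n" "real s / real n \<le> 1" using n s by (auto simp: divide_le_eq)
  then have sub: "{0..1} \<inter> {(real s - 1) / real n <..< real s / real n} = {(real s - 1) / real n <..< real s / real n}"
    by auto
  have "(real s - 1) / real n \<le> real s / real n" using n by (intro divide_right_mono) auto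
  moreover have "real s / real n - (real s - 1) / real n = 1 / real n" by (simp flip: diff_divide_distrib)
  moreover have "ennreal (1 / real n) / 1 = ennreal (1 / real n)"
    using divide_ennreal[of "1 / real n" 1] by simp
  ultimately show ?thesis by (subst emeasure_uniform_measure) (simp_all add: sub)
qed

definition injections :: "nat \<Rightarrow> nat \<Rightarrow> (nat \<Rightarrow> nat) set" where
  "injections k n = {\<gamma> \<in> {1..k} \<rightarrow>\<^sub>E {1..n}. inj_on \<gamma> {1..k}}"

lemma finite_injections: "finite (injections k n)"
  unfolding injections_def using finite_PiE[of "{1..k}" "\<lambda>_. {1..n}"] by simp

text \<open>Different injections correspond to disjoint boxes of sample points, since the position map is
  injective, and each box has probability \<open>(1 / n) ^ k\<close>.\<close>

lemma sample_prob_embedded_ge: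
  assumes h: "h \<in> InHy n"
  shows "(\<Sum>\<gamma>\<in>injections k n. (1 / real n) ^ k * of_bool (pull_back k \<gamma> h = g)) \<le> sample_prob k g (embedded n h)"
proof -
  let ?\<sigma> = "positions n h"
  let ?cell = "\<lambda>s. {(real s - 1) / real n <..< real s / real n}"
  define W where "W \<gamma> = {u \<in> space uniform_seq. \<forall>i\<in>{1..k}. u i \<in> ?cell (?\<sigma> (\<gamma> i))}" for \<gamma>
  define I where "I = {\<gamma> \<in> injections k n. pull_back k \<gamma> h = g}"
  have I: "\<gamma> ` {1..k} \<subseteq> {1..n}" "inj_on \<gamma> {1..k}" if "\<gamma> \<in> I" for \<gamma>
    using that by (auto simp: I_def injections_def)
  have \<sigma>: "?\<sigma> (\<gamma> i) \<in> {1..n}" if "\<gamma> \<in> I" "i \<in> {1..k}" for \<gamma> i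
    using I(1)[OF that(1)] that(2) positions(1)[OF h] unfolding bij_betw_def by blast
  have W: "W \<gamma> \<in> sets uniform_seq" "measure uniform_seq (W \<gamma>) = (1 / real n) ^ k" if "\<gamma> \<in> I" for \<gamma>
  proof -
    show "W \<gamma> \<in> sets uniform_seq"
      unfolding W_def by (intro sets.sets_Collect_finite_All) auto
    have "emeasure uniform_seq (W \<gamma>) = (\<Prod>i\<in>{1..k}. emeasure unif01 (?cell (?\<sigma> (\<gamma> i))))"
      unfolding W_def by (rule unif.emeasure_PiM_Collect) auto
    also have "\<dots> = (\<Prod>i\<in>{1..k}. ennreal (1 / real n))"
      using emeasure_unif01_cell \<sigma>[OF that] by (intro prod.cong) auto
    also have "\<dots> = ennreal ((1 / real n) ^ k)" by (simp add: ennreal_power)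
    finally show "measure uniform_seq (W \<gamma>) = (1 / real n) ^ k" by (simp add: measure_def)
  qed
  have disj: "disjoint_family_on W I"
  unfolding disjoint_family_on_def
  proof (intro ballI impI, rule ccontr)
    fix \<gamma> \<gamma>' assume g: "\<gamma> \<in> I" "\<gamma>' \<in> I" "\<gamma> \<noteq> \<gamma>'" and "W \<gamma> \<inter> W \<gamma>' \<noteq> {}"
    then obtain u where u: "u \<in> W \<gamma>" "u \<in> W \<gamma>'" by blast
    have "\<gamma> i = \<gamma>' i" if i: "i \<in> {1..k}" for i
    proof -
      have n: "real n > 0" using \<sigma>[OF g(1) i] by auto
      have a: "(real (?\<sigma> (\<gamma> i)) - 1) / real n < real (?\<sigma> (\<gamma>' i)) / real n"
        and b: "(real (?\<sigma> (\<gamma>' i)) - 1) / real n < real (?\<sigma> (\<gamma> i)) / real n"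
      proof -
        have "u i \<in> ?cell (?\<sigma> (\<gamma> i))" "u i \<in> ?cell (?\<sigma> (\<gamma>' i))" using u i unfolding W_def by blast+
        then show "(real (?\<sigma> (\<gamma> i)) - 1) / real n < real (?\<sigma> (\<gamma>' i)) / real n"
          "(real (?\<sigma> (\<gamma>' i)) - 1) / real n < real (?\<sigma> (\<gamma> i)) / real n" by auto
      qed
      then have "?\<sigma> (\<gamma> i) = ?\<sigma> (\<gamma>' i)"
        using n by (simp add: divide_less_cancel)
      moreover have "\<gamma> i \<in> {1..n}" "\<gamma>' i \<in> {1..n}" 
        using I(1)[OF g(1)] I(1)[OF g(2)] i by blast+
      ultimately show ?thesis using positions(1)[OF h] by (auto simp: bij_betw_def dest: inj_onD)
    qed
    moreover have "\<gamma> \<in> {1..k} \<rightarrow>\<^sub>E {1..n}" "\<gamma>' \<in> {1..k} \<rightarrow>\<^sub>E {1..n}"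
      using g by (auto simp: I_def injections_def)
    ultimately have "\<gamma> = \<gamma>'" by (intro PiE_ext) auto
    with g show False by simp
  qed
  have fin: "finite I" using finite_injections by (auto simp: I_def)
  have "(\<Sum>\<gamma>\<in>injections k n. (1 / real n) ^ k * of_bool (pull_back k \<gamma> h = g)) = (\<Sum>\<gamma>\<in>I. (1 / real n) ^ k)"
    using finite_injections by (intro sum.mono_neutral_cong_right) (auto simp: I_def)
  also have "\<dots> = (\<Sum>\<gamma>\<in>I. measure uniform_seq (W \<gamma>))" using W(2) by simp
  also have "\<dots> = measure uniform_seq (\<Union>\<gamma>\<in>I. W \<gamma>)"
    using fin W(1) disj by (intro unif.P.finite_measure_finite_Union[symmetric]) auto
  also have "\<dots> \<le> sample_prob k g (embedded n h)"
    unfolding sample_prob_def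
  proof (rule unif.P.finite_measure_mono[OF _ sample_event[OF embedded_nonempty_compact]])
    show "(\<Union>\<gamma>\<in>I. W \<gamma>) \<subseteq> {u \<in> space uniform_seq. sampled_hypergraph (embedded n h) u k = g}"
    proof
      fix u assume "u \<in> (\<Union>\<gamma>\<in>I. W \<gamma>)"
      then obtain \<gamma> where \<gamma>: "\<gamma> \<in> I" "u \<in> W \<gamma>" by blast
      have "sampled_hypergraph (embedded n h) u k = pull_back k \<gamma> h"
        using \<gamma>(2) by (intro sample_embedded[OF h I[OF \<gamma>(1)]]) (auto simp: W_def)
      then show "u \<in> {u \<in> space uniform_seq. sampled_hypergraph (embedded n h) u k = g}"
        using \<gamma> by (auto simp: I_def W_def)
    qed
  qed
  finally show ?thesis .
qed

text \<open>The left-hand side is the probability that \<open>k\<close> uniform choices among \<open>n\<close> cells are all different.\<close>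

lemma card_injections_ratio: "(\<lambda>n. real (card (injections k n)) * (1 / real n) ^ k) \<longlonglongrightarrow> 1"
proof -
  have "(\<lambda>n. \<Prod>i\<in>{0..<k}. real (n - i) / real n) \<longlonglongrightarrow> (\<Prod>i\<in>{0..<k}. 1)"
  proof (rule tendsto_prod)
    fix i
    have "(\<lambda>n. 1 - real i / real n) \<longlonglongrightarrow> 1 - 0"
      by (intro tendsto_diff tendsto_const lim_const_over_n)
    moreover have "\<forall>\<^sub>F n in sequentially. 1 - real i / real n = real (n - i) / real n"
      using eventually_ge_at_top[of "Suc i"] by eventually_elim (auto simp: field_simps of_nat_diff)
    ultimately show "(\<lambda>n. real (n - i) / real n) \<longlonglongrightarrow> 1"
      using tendsto_cong by fastforce
  qed
  moreover have "real (card (injections k n)) * (1 / real n) ^ k = (\<Prod>i\<in>{0..<k}. real (n - i) / real n)" for n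
  proof -
    have "card (injections k n) = (\<Prod>i\<in>{0..<k}. n - i)"
      unfolding injections_def using card_inj_on_subset_funcset[of "{1..k}" "{1..n}" "{1..k}"] by simp
    then show ?thesis by (simp add: prod_dividef power_divide)
  qed
  ultimately show ?thesis by simp
qed

lemma injection_extends_to_permutation:
  assumes "\<gamma> \<in> injections k n" "k \<le> n"
  obtains \<pi> where "\<pi> permutes {1..n}" "\<And>i. i \<in> {1..k} \<Longrightarrow> \<pi> i = \<gamma> i"
proof -
  have \<gamma>: "\<gamma> ` {1..k} \<subseteq> {1..n}" "inj_on \<gamma> {1..k}" using assms by (auto simp: injections_def)
  have sub: "{1..k} \<subseteq> {1..n}" using assms by auto
  have "card ({1..n} - {1..k}) = card ({1..n} - \<gamma> ` {1..k})"
    using sub \<gamma> by (simp add: card_Diff_subset card_image)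
  then obtain g where g: "bij_betw g ({1..n} - {1..k}) ({1..n} - \<gamma> ` {1..k})"
    using finite_same_card_bij[OF finite_Diff[OF finite_atLeastAtMost] finite_Diff[OF finite_atLeastAtMost]]
    by blast
  have "bij_betw \<gamma> {1..k} (\<gamma> ` {1..k})" using \<gamma>(2) by (simp add: bij_betw_def)
  from bij_betw_disjoint_Un[OF this g]
  have bij: "bij_betw (\<lambda>x. if x \<in> {1..k} then \<gamma> x else g x) {1..n} {1..n}"
    using sub \<gamma>(1) by (simp add: Un_absorb1)
  define \<pi> where "\<pi> x = (if x \<in> {1..n} then if x \<in> {1..k} then \<gamma> x else g x else x)" for x
  have "bij_betw \<pi> {1..n} {1..n}"
    using bij by (subst bij_betw_cong[where g = "\<lambda>x. if x \<in> {1..k} then \<gamma> x else g x"]) (auto simp: \<pi>_def)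
  then have "\<pi> permutes {1..n}" by (rule bij_imp_permutes) (auto simp: \<pi>_def)
  moreover have "\<pi> i = \<gamma> i" if "i \<in> {1..k}" for i using that sub by (auto simp: \<pi>_def)
  ultimately show ?thesis using that by blast
qed

lemma pull_back_eq_restrict_permute:
  assumes \<pi>: "\<pi> permutes {1..n}" and eq: "\<And>i. i \<in> {1..k} \<Longrightarrow> \<pi> i = \<gamma> i"
  shows "pull_back k \<gamma> h = restrict_hypergraph k (permute_hypergraph (inv \<pi>) h)"
proof -
  have "{1..k} \<inter> inv \<pi> ` e = {i \<in> {1..k}. \<gamma> i \<in> e}" for e
  proof -
    have "inv \<pi> ` e = \<pi> -` e" using permutes_bij[OF \<pi>] by (simp add: bij_vimage_eq_inv_image)
    then show ?thesis using eq by auto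
  qed
  then have "pull_back k \<gamma> h = (\<lambda>e. {1..k} \<inter> inv \<pi> ` e) ` h" by (simp add: pull_back_def)
  moreover have "permute_hypergraph (inv \<pi>) h = (\<lambda>e. inv \<pi> ` e) ` h"
    unfolding permute_hypergraph_def by blast
  moreover have "restrict_hypergraph k G = (\<lambda>e. {1..k} \<inter> e) ` G" for G
    unfolding restrict_hypergraph_def by blast
  ultimately show ?thesis by (simp add: image_image)
qed

lemma permute_hypergraph_InHy:
  assumes h: "h \<in> InHy n" and \<pi>: "\<pi> permutes {1..n}"
  shows "permute_hypergraph \<pi> h \<in> InHy n"
proof (rule InHyI[where \<sigma> = "positions n h \<circ> inv \<pi>"])
  have hy: "h \<subseteq> Pow {1..n}" "{} \<in> h" "\<And>j. j \<in> {1..n} \<Longrightarrow> {j} \<in> h"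
    using h by (auto simp: InHy_def interval_hypergraph_def)
  have eq: "permute_hypergraph \<pi> h = (\<lambda>e. \<pi> ` e) ` h" unfolding permute_hypergraph_def by blast
  have ip: "inv \<pi> permutes {1..n}" by (rule permutes_inv[OF \<pi>])
  have inv: "inv \<pi> (\<pi> x) = x" "\<pi> (inv \<pi> x) = x" for x using permutes_inverses[OF \<pi>] by auto
  show "permute_hypergraph \<pi> h \<subseteq> Pow {1..n}"
    using hy(1) permutes_in_image[OF \<pi>] unfolding eq by blast
  show "{} \<in> permute_hypergraph \<pi> h" unfolding eq using hy(2) by (metis image_empty image_eqI)
  show "{j} \<in> permute_hypergraph \<pi> h" if "j \<in> {1..n}" for j
  proof -
    have "{inv \<pi> j} \<in> h" using that hy(3) permutes_in_image[OF ip] by blast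
    moreover have "{j} = \<pi> ` {inv \<pi> j}" by (simp add: inv)
    ultimately show ?thesis unfolding eq by blast
  qed
  show "inj_on (positions n h \<circ> inv \<pi>) {1..n}"
    using positions(1)[OF h] permutes_inj_on[OF ip, of "{1..n}"] permutes_image[OF ip]
    by (intro comp_inj_on) (auto simp: bij_betw_def)
  fix e x y z assume e: "e \<in> permute_hypergraph \<pi> h" and xyz: "x \<in> e" "y \<in> e" "z \<in> {1..n}"
    "(positions n h \<circ> inv \<pi>) x \<le> (positions n h \<circ> inv \<pi>) z" "(positions n h \<circ> inv \<pi>) z \<le> (positions n h \<circ> inv \<pi>) y"
  from e obtain e' where e': "e' \<in> h" "e = \<pi> ` e'" unfolding eq by blast
  have xy: "inv \<pi> x \<in> e'" "inv \<pi> y \<in> e'" using xyz(1,2) e'(2) inv by auto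
  then have "e' \<noteq> {}" by blast
  from positions(2)[OF h e'(1) this] obtain a b where ab:
    "e' = {x \<in> {1..n}. a \<le> positions n h x \<and> positions n h x \<le> b}" by blast
  have "inv \<pi> z \<in> {1..n}" using xyz(3) permutes_in_image[OF ip] by blast
  then have "inv \<pi> z \<in> e'" using xy xyz(4,5) unfolding ab by auto
  then show "z \<in> e" using e'(2) inv(2) by (metis image_eqI)
qed

section \<open>Laws of consistent processes\<close>

lemma restrict_restrict_hypergraph:
  assumes "j \<le> k"
  shows "restrict_hypergraph j (restrict_hypergraph k G) = restrict_hypergraph j G"
proof -
  have 1: "restrict_hypergraph k G = (\<lambda>e. {1..k} \<inter> e) ` G" for k G
    unfolding restrict_hypergraph_def by blast
  have 2: "{1..j} \<inter> ({1..k} \<inter> e) = {1..j} \<inter> e" for e using assms by auto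
  show ?thesis by (simp only: 1 image_image 2)
qed

lemma restrict_hypergraph_self:
  assumes "h \<in> InHy k"
  shows "restrict_hypergraph k h = h"
proof -
  have 1: "restrict_hypergraph k h = (\<lambda>e. {1..k} \<inter> e) ` h"
    unfolding restrict_hypergraph_def by blast
  have "{1..k} \<inter> e = e" if "e \<in> h" for e
    using that assms by (auto simp: InHy_def interval_hypergraph_def)
  then show ?thesis by (simp add: 1)
qed

lemma consistent_AE:
  assumes H: "\<And>n. n \<ge> 1 \<Longrightarrow> H n \<in> M \<rightarrow>\<^sub>M count_space (InHy n)"
    and cons: "\<And>n. n \<ge> 1 \<Longrightarrow> AE \<omega> in M. H n \<omega> = restrict_hypergraph n (H (Suc n) \<omega>)"
    and "1 \<le> j" "j \<le> k"
  shows "AE \<omega> in M. H j \<omega> = restrict_hypergraph j (H k \<omega>)"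
  using \<open>j \<le> k\<close>
proof (induction rule: dec_induct)
  case base
  show ?case
  proof (rule AE_I2)
    fix \<omega> assume "\<omega> \<in> space M"
    then have "H j \<omega> \<in> InHy j" using measurable_space[OF H[OF \<open>1 \<le> j\<close>]] by simp
    then show "H j \<omega> = restrict_hypergraph j (H j \<omega>)" by (simp add: restrict_hypergraph_self)
  qed
next
  case (step m)
  have "AE \<omega> in M. H m \<omega> = restrict_hypergraph m (H (Suc m) \<omega>)"
    using cons step \<open>1 \<le> j\<close> by simp
  with step(3) show ?case
  proof eventually_elim
    case (elim \<omega>)
    then show ?case using restrict_restrict_hypergraph[OF step(1)] by metis
  qed
qed

text \<open>By consistency, the coordinates with index at most \<open>k\<close> are almost surely functions of the \<open>k\<close>-th.\<close>

lemma process_law_cylinder: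
  assumes H: "\<And>n. n \<ge> 1 \<Longrightarrow> H n \<in> M \<rightarrow>\<^sub>M count_space (InHy n)"
    and cons: "\<And>n. n \<ge> 1 \<Longrightarrow> AE \<omega> in M. H n \<omega> = restrict_hypergraph n (H (Suc n) \<omega>)"
    and J: "finite J" "J \<subseteq> {1..k}" and k: "k \<ge> 1"
    and A: "\<And>j. j \<in> J \<Longrightarrow> A j \<subseteq> InHy j"
  shows "emeasure (process_law M H) (prod_emb {1..} (\<lambda>n. count_space (InHy n)) J (Pi\<^sub>E J A)) =
    emeasure (distr M (count_space (InHy k)) (H k)) {g \<in> InHy k. \<forall>j\<in>J. restrict_hypergraph j g \<in> A j}"
proof -
  let ?P = "\<Pi>\<^sub>M n\<in>{1::nat..}. count_space (InHy n)"
  let ?h = "\<lambda>\<omega>. \<lambda>n\<in>{1..}. H n \<omega>"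
  have m: "?h \<in> M \<rightarrow>\<^sub>M ?P"
    by (rule measurable_restrict) (simp add: H)
  have J1: "J \<subseteq> {1..}" using J by auto
  have cyl: "prod_emb {1..} (\<lambda>n. count_space (InHy n)) J (Pi\<^sub>E J A) \<in> sets ?P"
    by (rule sets_PiM_I[OF J(1) J1]) (simp add: A)
  have AE: "AE \<omega> in M. \<forall>j\<in>J. H j \<omega> = restrict_hypergraph j (H k \<omega>)"
    using J by (intro AE_finite_allI consistent_AE[OF H cons]) auto
  have meas1: "?h -` prod_emb {1..} (\<lambda>n. count_space (InHy n)) J (Pi\<^sub>E J A) \<inter> space M \<in> sets M"
    by (rule measurable_sets[OF m cyl])
  have meas2: "H k -` {g \<in> InHy k. \<forall>j\<in>J. restrict_hypergraph j g \<in> A j} \<inter> space M \<in> sets M"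
    by (rule measurable_sets[OF H[OF k]]) auto
  have "emeasure (process_law M H) (prod_emb {1..} (\<lambda>n. count_space (InHy n)) J (Pi\<^sub>E J A)) =
      emeasure M (?h -` prod_emb {1..} (\<lambda>n. count_space (InHy n)) J (Pi\<^sub>E J A) \<inter> space M)"
    unfolding process_law_def by (rule emeasure_distr[OF m cyl])
  also have "\<dots> = emeasure M (H k -` {g \<in> InHy k. \<forall>j\<in>J. restrict_hypergraph j g \<in> A j} \<inter> space M)"
  proof (rule emeasure_eq_AE[OF _ meas1 meas2])
    show "AE \<omega> in M. \<omega> \<in> ?h -` prod_emb {1..} (\<lambda>n. count_space (InHy n)) J (Pi\<^sub>E J A) \<inter> space M \<longleftrightarrow>
        \<omega> \<in> H k -` {g \<in> InHy k. \<forall>j\<in>J. restrict_hypergraph j g \<in> A j} \<inter> space M"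
      using AE AE_space
    proof eventually_elim
      case (elim \<omega>)
      have sp: "?h \<omega> \<in> space ?P" by (rule measurable_space[OF m elim(2)])
      have hk: "H k \<omega> \<in> InHy k" using measurable_space[OF H[OF k] elim(2)] by simp
      have "?h \<omega> \<in> prod_emb {1..} (\<lambda>n. count_space (InHy n)) J (Pi\<^sub>E J A) \<longleftrightarrow> restrict (?h \<omega>) J \<in> Pi\<^sub>E J A"
        using sp by (simp add: prod_emb_def space_PiM)
      also have "\<dots> \<longleftrightarrow> (\<forall>j\<in>J. H j \<omega> \<in> A j)"
        using J1 by (auto simp: PiE_iff)
      also have "\<dots> \<longleftrightarrow> (\<forall>j\<in>J. restrict_hypergraph j (H k \<omega>) \<in> A j)"
        using elim(1) by simp
      finally show ?case using hk by auto
    qed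
  qed
  also have "\<dots> = emeasure (distr M (count_space (InHy k)) (H k)) {g \<in> InHy k. \<forall>j\<in>J. restrict_hypergraph j g \<in> A j}"
    by (rule emeasure_distr[OF H[OF k], symmetric]) auto
  finally show ?thesis .
qed

lemma process_law_eqI:
  assumes M: "prob_space M"
    and H: "\<And>n. n \<ge> 1 \<Longrightarrow> H n \<in> M \<rightarrow>\<^sub>M count_space (InHy n)"
    and H': "\<And>n. n \<ge> 1 \<Longrightarrow> H' n \<in> M' \<rightarrow>\<^sub>M count_space (InHy n)"
    and cons: "\<And>n. n \<ge> 1 \<Longrightarrow> AE \<omega> in M. H n \<omega> = restrict_hypergraph n (H (Suc n) \<omega>)"
    and cons': "\<And>n. n \<ge> 1 \<Longrightarrow> AE \<omega> in M'. H' n \<omega> = restrict_hypergraph n (H' (Suc n) \<omega>)"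
    and law: "\<And>n. n \<ge> 1 \<Longrightarrow> distr M (count_space (InHy n)) (H n) = distr M' (count_space (InHy n)) (H' n)"
  shows "process_law M H = process_law M' H'"
proof (rule measure_eqI_PiM_infinite)
  let ?P = "\<Pi>\<^sub>M n\<in>{1::nat..}. count_space (InHy n)"
  show "sets (process_law M H) = sets ?P" "sets (process_law M' H') = sets ?P"
    by (simp_all add: process_law_def)
  have "(\<lambda>\<omega>. \<lambda>n\<in>{1..}. H n \<omega>) \<in> M \<rightarrow>\<^sub>M ?P"
    by (rule measurable_restrict) (simp add: H)
  then have "prob_space (process_law M H)"
    unfolding process_law_def by (rule prob_space.prob_space_distr[OF M])
  then show "finite_measure (process_law M H)" by (rule prob_space.finite_measure)
  fix A :: "nat \<Rightarrow> nat set set set" and J :: "nat set"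
  assume J: "finite J" "J \<subseteq> {1..}" and A: "\<And>i. i \<in> J \<Longrightarrow> A i \<in> sets (count_space (InHy i))"
  define k where "k = Max (insert 1 J)"
  have k: "k \<ge> 1" "J \<subseteq> {1..k}" using J by (auto simp: k_def)
  have A': "A j \<subseteq> InHy j" if "j \<in> J" for j using A[OF that] by simp
  show "emeasure (process_law M H) (prod_emb {1..} (\<lambda>n. count_space (InHy n)) J (Pi\<^sub>E J A)) =
     emeasure (process_law M' H') (prod_emb {1..} (\<lambda>n. count_space (InHy n)) J (Pi\<^sub>E J A))"
    using process_law_cylinder[OF H cons J(1) k(2,1) A'] process_law_cylinder[OF H' cons' J(1) k(2,1) A'] law[OF k(1)]
    by simp
qed

section \<open>Sampling from an independent random compact set\<close>

lemma sampled_hypergraph_restrict: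
  "sampled_hypergraph K (\<lambda>i\<in>{1..}. u i) n = sampled_hypergraph K u n"
proof -
  have "sample_trace n (\<lambda>i\<in>{1..}. u i) = sample_trace n u"
    by (rule ext) (auto simp: sample_trace_def)
  then show ?thesis by (simp add: sampled_hypergraph_eq)
qed

lemma iid_uniform_law:
  assumes N: "prob_space N" and U: "iid_uniform N U"
  shows "(\<lambda>\<omega>. \<lambda>i\<in>{1..}. U i \<omega>) \<in> N \<rightarrow>\<^sub>M (\<Pi>\<^sub>M i\<in>{1..}. borel)"
    "distr N (\<Pi>\<^sub>M i\<in>{1..}. borel) (\<lambda>\<omega>. \<lambda>i\<in>{1..}. U i \<omega>) = uniform_seq"
proof -
  interpret prob_space N by fact
  have iv: "indep_vars (\<lambda>_. borel) U {1..}" and d: "\<And>i. i \<ge> 1 \<Longrightarrow> distr N borel (U i) = unif01"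
    using U by (auto simp: iid_uniform_def)
  have rv: "random_variable borel (U i)" if "i \<in> {1..}" for i
    using iv that by (auto simp: indep_vars_def)
  show "(\<lambda>\<omega>. \<lambda>i\<in>{1..}. U i \<omega>) \<in> N \<rightarrow>\<^sub>M (\<Pi>\<^sub>M i\<in>{1..}. borel)"
    by (rule measurable_restrict) (rule rv)
  have "distr N (\<Pi>\<^sub>M i\<in>{1..}. borel) (\<lambda>\<omega>. \<lambda>i\<in>{1..}. U i \<omega>) = (\<Pi>\<^sub>M i\<in>{1..}. distr N borel (U i))"
    using iv by (subst (asm) indep_vars_iff_distr_eq_PiM') (use rv in auto)
  also have "\<dots> = uniform_seq" by (rule PiM_cong) (auto simp: d)
  finally show "distr N (\<Pi>\<^sub>M i\<in>{1..}. borel) (\<lambda>\<omega>. \<lambda>i\<in>{1..}. U i \<omega>) = uniform_seq" .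
qed

text \<open>It is through this lemma that the law of the sampled process is the same for all admissible \<open>U\<close>.\<close>

lemma joint_law:
  assumes N: "prob_space N" and K: "random_compact_set N K" and U: "iid_uniform N U"
    and ind: "indep_of_sequence N K U"
  shows "distr N (hausdorff_borel triangle \<Otimes>\<^sub>M (\<Pi>\<^sub>M i\<in>{1..}. borel)) (\<lambda>\<omega>. (K \<omega>, \<lambda>i\<in>{1..}. U i \<omega>)) =
    distr N (hausdorff_borel triangle) K \<Otimes>\<^sub>M uniform_seq"
proof -
  interpret prob_space N by fact
  let ?HB = "hausdorff_borel triangle :: (real \<times> real) set measure"
  let ?V = "\<Pi>\<^sub>M i\<in>{1::nat..}. (borel :: real measure)"
  let ?U = "\<lambda>\<omega>. \<lambda>i\<in>{1..}. U i \<omega>"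
  have Km: "K \<in> N \<rightarrow>\<^sub>M ?HB" using K by (simp add: random_compact_set_def)
  note Um = iid_uniform_law[OF N U]
  have pm: "(\<lambda>\<omega>. (K \<omega>, ?U \<omega>)) \<in> N \<rightarrow>\<^sub>M ?HB \<Otimes>\<^sub>M ?V" by (rule measurable_Pair[OF Km Um(1)])
  interpret L: prob_space "distr N ?HB K" by (rule prob_space_distr[OF Km])
  show ?thesis
  proof (rule pair_measure_eqI[symmetric])
    show "sigma_finite_measure (distr N ?HB K)" "sigma_finite_measure uniform_seq" by unfold_locales
    show "sets (distr N ?HB K \<Otimes>\<^sub>M uniform_seq) = sets (distr N (?HB \<Otimes>\<^sub>M ?V) (\<lambda>\<omega>. (K \<omega>, ?U \<omega>)))"
      unfolding sets_distr by (rule sets_pair_measure_cong[OF sets_distr sets_uniform_seq])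
    fix A B assume "A \<in> sets (distr N ?HB K)" "B \<in> sets uniform_seq"
    then have A: "A \<in> sets ?HB" and B: "B \<in> sets ?V" by (simp_all only: sets_distr sets_uniform_seq)
    have "emeasure (distr N (?HB \<Otimes>\<^sub>M ?V) (\<lambda>\<omega>. (K \<omega>, ?U \<omega>))) (A \<times> B) =
        emeasure N ((K -` A \<inter> space N) \<inter> (?U -` B \<inter> space N))"
    proof -
      have "(\<lambda>\<omega>. (K \<omega>, ?U \<omega>)) -` (A \<times> B) \<inter> space N = (K -` A \<inter> space N) \<inter> (?U -` B \<inter> space N)"
        by blast
      then show ?thesis by (simp only: emeasure_distr[OF pm pair_measureI[OF A B]])
    qed
    also have "\<dots> = ennreal (prob ((K -` A \<inter> space N) \<inter> (?U -` B \<inter> space N)))"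
      by (rule emeasure_eq_measure)
    also have "prob ((K -` A \<inter> space N) \<inter> (?U -` B \<inter> space N)) =
        prob (K -` A \<inter> space N) * prob (?U -` B \<inter> space N)"
      using ind unfolding indep_of_sequence_def
      by (rule indep_setD) (intro in_vimage_algebra A B)+
    also have "ennreal \<dots> = emeasure (distr N ?HB K) A * emeasure (distr N ?V ?U) B"
      unfolding emeasure_distr[OF Km A] emeasure_distr[OF Um(1) B] emeasure_eq_measure
      by (rule ennreal_mult) (rule measure_nonneg)+
    finally show "emeasure (distr N ?HB K) A * emeasure uniform_seq B =
        emeasure (distr N (?HB \<Otimes>\<^sub>M ?V) (\<lambda>\<omega>. (K \<omega>, ?U \<omega>))) (A \<times> B)"
      unfolding Um(2) by (rule sym)
  qed
qed

lemma sets_hausdorff_uniform: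
  "sets (hausdorff_borel triangle \<Otimes>\<^sub>M uniform_seq) = sets (hausdorff_borel triangle \<Otimes>\<^sub>M (\<Pi>\<^sub>M i\<in>{1..}. borel))"
  by (rule sets_pair_measure_cong[OF refl sets_uniform_seq])

lemma sampled_pair_event:
  "{z \<in> space (hausdorff_borel triangle \<Otimes>\<^sub>M uniform_seq). sampled_hypergraph (fst z) (snd z) k = g}
     \<in> sets (hausdorff_borel triangle \<Otimes>\<^sub>M uniform_seq)"
proof -
  let ?P = "hausdorff_borel triangle \<Otimes>\<^sub>M uniform_seq"
  have m: "(\<lambda>(K, u). sampled_hypergraph K u k) \<in> ?P \<rightarrow>\<^sub>M count_space (InHy k)"
    using measurable_sampled_hypergraph unfolding measurable_cong_sets[OF sets_hausdorff_uniform refl] .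
  have "{z \<in> space ?P. sampled_hypergraph (fst z) (snd z) k = g} =
      (\<lambda>(K, u). sampled_hypergraph K u k) -` ({g} \<inter> InHy k) \<inter> space ?P"
    using sampled_hypergraph_InHy by auto
  also have "\<dots> \<in> sets ?P" by (rule measurable_sets[OF m]) simp
  finally show ?thesis .
qed

lemma measurable_sample_prob: "sample_prob k g \<in> borel_measurable (hausdorff_borel triangle)"
proof -
  have 1: "(\<lambda>K. measure uniform_seq (Pair K -` {z \<in> space (hausdorff_borel triangle \<Otimes>\<^sub>M uniform_seq).
      sampled_hypergraph (fst z) (snd z) k = g})) \<in> borel_measurable (hausdorff_borel triangle)"
    unfolding measure_def
    by (intro borel_measurable_enn2real unif.P.measurable_emeasure_Pair sampled_pair_event)
  have 2: "measure uniform_seq (Pair K -` {z \<in> space (hausdorff_borel triangle \<Otimes>\<^sub>M uniform_seq).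
      sampled_hypergraph (fst z) (snd z) k = g}) = sample_prob k g K"
    if "K \<in> space (hausdorff_borel triangle)" for K
  proof -
    have "Pair K -` {z \<in> space (hausdorff_borel triangle \<Otimes>\<^sub>M uniform_seq). sampled_hypergraph (fst z) (snd z) k = g}
      = {u \<in> space uniform_seq. sampled_hypergraph K u k = g}"
      using that by (auto simp: space_pair_measure)
    then show ?thesis by (simp only: sample_prob_def)
  qed
  show ?thesis by (rule measurable_cong[THEN iffD1, OF _ 1]) (rule 2)
qed

lemma sample_prob_bounds: "0 \<le> sample_prob k g K" "sample_prob k g K \<le> 1"
  unfolding sample_prob_def by (rule measure_nonneg, rule unif.P.prob_le_1)

lemma measurable_sampled_process:
  assumes N: "prob_space N" and K: "random_compact_set N K" and U: "iid_uniform N U"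
  shows "(\<lambda>\<omega>. sampled_hypergraph (K \<omega>) (\<lambda>i. U i \<omega>) n) \<in> N \<rightarrow>\<^sub>M count_space (InHy n)"
proof -
  have Km: "K \<in> N \<rightarrow>\<^sub>M hausdorff_borel triangle" using K by (simp add: random_compact_set_def)
  from measurable_compose[OF measurable_Pair[OF Km iid_uniform_law(1)[OF N U]] measurable_sampled_hypergraph[of n]]
  show ?thesis by (simp only: prod.case sampled_hypergraph_restrict)
qed

lemma prob_sampled_eq:
  assumes N: "prob_space N" and K: "random_compact_set N K" and U: "iid_uniform N U"
    and ind: "indep_of_sequence N K U" and g: "g \<in> InHy n"
  shows "emeasure (distr N (count_space (InHy n)) (\<lambda>\<omega>. sampled_hypergraph (K \<omega>) (\<lambda>i. U i \<omega>) n)) {g} =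
    ennreal (\<integral>\<omega>. sample_prob n g (K \<omega>) \<partial>N)"
proof -
  interpret prob_space N by fact
  let ?HB = "hausdorff_borel triangle :: (real \<times> real) set measure"
  let ?V = "\<Pi>\<^sub>M i\<in>{1::nat..}. (borel :: real measure)"
  let ?p = "\<lambda>\<omega>. (K \<omega>, \<lambda>i\<in>{1..}. U i \<omega>)"
  let ?E = "{z \<in> space (?HB \<Otimes>\<^sub>M uniform_seq). sampled_hypergraph (fst z) (snd z) n = g}"
  have Km: "K \<in> N \<rightarrow>\<^sub>M ?HB" using K by (simp add: random_compact_set_def)
  have pm: "?p \<in> N \<rightarrow>\<^sub>M ?HB \<Otimes>\<^sub>M ?V" by (rule measurable_Pair[OF Km iid_uniform_law(1)[OF N U]])
  have E: "?E \<in> sets (?HB \<Otimes>\<^sub>M ?V)" using sampled_pair_event[of n g] sets_hausdorff_uniform by simp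
  interpret L: prob_space "distr N ?HB K" by (rule prob_space_distr[OF Km])
  have EL: "?E \<in> sets (distr N ?HB K \<Otimes>\<^sub>M uniform_seq)"
    using sampled_pair_event[of n g] sets_pair_measure_cong[OF sets_distr[of N ?HB K] refl] by blast
  have sp: "space (?HB \<Otimes>\<^sub>M uniform_seq) = space (?HB \<Otimes>\<^sub>M ?V)"
    by (rule sets_eq_imp_space_eq[OF sets_hausdorff_uniform])
  have sm: "(\<lambda>\<omega>. sampled_hypergraph (K \<omega>) (\<lambda>i. U i \<omega>) n) \<in> N \<rightarrow>\<^sub>M count_space (InHy n)"
    by (rule measurable_sampled_process[OF N K U])
  have "emeasure (distr N (count_space (InHy n)) (\<lambda>\<omega>. sampled_hypergraph (K \<omega>) (\<lambda>i. U i \<omega>) n)) {g} =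
      emeasure N ((\<lambda>\<omega>. sampled_hypergraph (K \<omega>) (\<lambda>i. U i \<omega>) n) -` {g} \<inter> space N)"
    using g by (intro emeasure_distr[OF sm]) auto
  also have "(\<lambda>\<omega>. sampled_hypergraph (K \<omega>) (\<lambda>i. U i \<omega>) n) -` {g} \<inter> space N = ?p -` ?E \<inter> space N"
  proof -
    have "?p \<omega> \<in> ?E \<longleftrightarrow> sampled_hypergraph (K \<omega>) (\<lambda>i. U i \<omega>) n = g" if "\<omega> \<in> space N" for \<omega>
      using measurable_space[OF pm that]
      by (simp only: sp mem_Collect_eq fst_conv snd_conv sampled_hypergraph_restrict simp_thms)
    then show ?thesis by blast
  qed
  also have "emeasure N (?p -` ?E \<inter> space N) = emeasure (distr N (?HB \<Otimes>\<^sub>M ?V) ?p) ?E"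
    by (rule emeasure_distr[OF pm E, symmetric])
  also have "\<dots> = emeasure (distr N ?HB K \<Otimes>\<^sub>M uniform_seq) ?E"
    by (simp only: joint_law[OF N K U ind])
  also have "\<dots> = (\<integral>\<^sup>+A. emeasure uniform_seq (Pair A -` ?E) \<partial>distr N ?HB K)"
    by (rule unif.P.emeasure_pair_measure_alt[OF EL])
  also have "\<dots> = (\<integral>\<^sup>+A. ennreal (sample_prob n g A) \<partial>distr N ?HB K)"
  proof (rule nn_integral_cong)
    fix A assume "A \<in> space (distr N ?HB K)"
    then have "Pair A -` ?E = {u \<in> space uniform_seq. sampled_hypergraph A u n = g}"
      by (auto simp: space_pair_measure)
    then show "emeasure uniform_seq (Pair A -` ?E) = ennreal (sample_prob n g A)"
      by (simp only: sample_prob_def unif.P.emeasure_eq_measure)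
  qed
  also have "\<dots> = (\<integral>\<^sup>+\<omega>. ennreal (sample_prob n g (K \<omega>)) \<partial>N)"
    by (rule nn_integral_distr[OF Km]) (use measurable_sample_prob in measurable)
  also have "\<dots> = ennreal (\<integral>\<omega>. sample_prob n g (K \<omega>) \<partial>N)"
  proof (rule nn_integral_eq_integral)
    show "integrable N (\<lambda>\<omega>. sample_prob n g (K \<omega>))"
      using measurable_compose[OF Km measurable_sample_prob] sample_prob_bounds
      by (intro integrable_const_bound[of _ 1]) auto
  qed (simp add: sample_prob_bounds)
  finally show ?thesis .
qed

section \<open>Passing to the limit\<close>

text \<open>Extend \<open>\<gamma>\<close> to a permutation \<open>\<pi>\<close> of \<open>{1..n}\<close>; pulling back along \<open>\<gamma>\<close> is to apply the inverse
  of \<open>\<pi>\<close>, which preserves the law of \<open>H n\<close>, and then to restrict to \<open>{1..k}\<close>.\<close>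

lemma prob_pull_back:
  assumes ex: "exchangeable_interval_hypergraph M H" and k: "1 \<le> k" "k \<le> n" and \<gamma>: "\<gamma> \<in> injections k n"
  shows "measure M {\<omega> \<in> space M. pull_back k \<gamma> (H n \<omega>) = g} = measure M {\<omega> \<in> space M. H k \<omega> = g}"
proof -
  have M: "prob_space M" and H: "\<And>n. n \<ge> 1 \<Longrightarrow> H n \<in> M \<rightarrow>\<^sub>M count_space (InHy n)"
    and cons: "\<And>n. n \<ge> 1 \<Longrightarrow> AE \<omega> in M. H n \<omega> = restrict_hypergraph n (H (Suc n) \<omega>)"
    and exch: "\<And>n \<pi>. n \<ge> 1 \<Longrightarrow> \<pi> permutes {1..n} \<Longrightarrow>
        distr M (count_space (InHy n)) (\<lambda>\<omega>. permute_hypergraph \<pi> (H n \<omega>)) = distr M (count_space (InHy n)) (H n)"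
    using ex unfolding exchangeable_interval_hypergraph_def by blast+
  interpret prob_space M by fact
  have n: "1 \<le> n" using k by simp
  obtain \<pi> where \<pi>: "\<pi> permutes {1..n}" "\<And>i. i \<in> {1..k} \<Longrightarrow> \<pi> i = \<gamma> i"
    using injection_extends_to_permutation[OF \<gamma> k(2)] by blast
  have \<rho>: "inv \<pi> permutes {1..n}" by (rule permutes_inv[OF \<pi>(1)])
  let ?T = "{x \<in> InHy n. restrict_hypergraph k x = g}"
  have T: "?T \<in> sets (count_space (InHy n))" by auto
  have pm: "(\<lambda>\<omega>. permute_hypergraph (inv \<pi>) (H n \<omega>)) \<in> M \<rightarrow>\<^sub>M count_space (InHy n)"
    by (rule measurable_compose[OF H[OF n]]) (simp add: permute_hypergraph_InHy[OF _ \<rho>])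
  have in1: "H n \<omega> \<in> InHy n" and in2: "permute_hypergraph (inv \<pi>) (H n \<omega>) \<in> InHy n" if "\<omega> \<in> space M" for \<omega>
    using measurable_space[OF H[OF n] that] measurable_space[OF pm that] by simp_all
  have "{\<omega> \<in> space M. pull_back k \<gamma> (H n \<omega>) = g} = (\<lambda>\<omega>. permute_hypergraph (inv \<pi>) (H n \<omega>)) -` ?T \<inter> space M"
  proof -
    have "pull_back k \<gamma> (H n \<omega>) = g \<longleftrightarrow> permute_hypergraph (inv \<pi>) (H n \<omega>) \<in> ?T" if "\<omega> \<in> space M" for \<omega>
      using in2[OF that] pull_back_eq_restrict_permute[OF \<pi>, where h = "H n \<omega>"] by simp
    then show ?thesis by blast
  qed
  then have "measure M {\<omega> \<in> space M. pull_back k \<gamma> (H n \<omega>) = g} =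
      measure (distr M (count_space (InHy n)) (\<lambda>\<omega>. permute_hypergraph (inv \<pi>) (H n \<omega>))) ?T"
    by (simp only: measure_distr[OF pm T])
  also have "\<dots> = measure M (H n -` ?T \<inter> space M)"
    by (simp only: exch[OF n \<rho>] measure_distr[OF H[OF n] T])
  also have "\<dots> = measure M {\<omega> \<in> space M. H k \<omega> = g}"
  proof (rule finite_measure_eq_AE)
    show "H n -` ?T \<inter> space M \<in> sets M" by (rule measurable_sets[OF H[OF n] T])
    have "{\<omega> \<in> space M. H k \<omega> = g} = H k -` ({g} \<inter> InHy k) \<inter> space M"
      using measurable_space[OF H[OF k(1)]] by auto
    also have "\<dots> \<in> sets M" by (rule measurable_sets[OF H[OF k(1)]]) simp
    finally show "{\<omega> \<in> space M. H k \<omega> = g} \<in> sets M" .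
    have "AE \<omega> in M. H k \<omega> = restrict_hypergraph k (H n \<omega>)"
      by (rule consistent_AE[OF _ _ k]) (erule H cons)+
    then show "AE \<omega> in M. \<omega> \<in> H n -` ?T \<inter> space M \<longleftrightarrow> \<omega> \<in> {\<omega> \<in> space M. H k \<omega> = g}"
      using AE_space
    proof eventually_elim
      case (elim \<omega>)
      then show ?case using in1[OF elim(2)] by simp
    qed
  qed
  finally show ?thesis .
qed

lemma sum_sample_prob:
  assumes "A \<in> nonempty_compacts triangle"
  shows "(\<Sum>g\<in>InHy k. sample_prob k g A) = 1"
proof -
  let ?E = "\<lambda>g. {u \<in> space uniform_seq. sampled_hypergraph A u k = g}"
  have "(\<Sum>g\<in>InHy k. sample_prob k g A) = measure uniform_seq (\<Union>g\<in>InHy k. ?E g)"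
    unfolding sample_prob_def
  proof (rule unif.P.finite_measure_finite_Union[OF finite_InHy, symmetric])
    show "?E ` InHy k \<subseteq> unif.P.events" using sample_event[OF assms] by blast
    show "disjoint_family_on ?E (InHy k)" unfolding disjoint_family_on_def by blast
  qed
  also have "(\<Union>g\<in>InHy k. ?E g) = space uniform_seq" using sampled_hypergraph_InHy by blast
  finally show ?thesis by (simp only: unif.P.prob_space)
qed

text \<open>Integrate the bound for a fixed hypergraph: each injection contributes the same probability by
  exchangeability.\<close>

lemma expected_sample_prob_ge:
  assumes ex: "exchangeable_interval_hypergraph M H" and k: "1 \<le> k" "k \<le> n"
  shows "real (card (injections k n)) * (1 / real n) ^ k * measure M {\<omega> \<in> space M. H k \<omega> = g}
    \<le> (\<integral>\<omega>. sample_prob k g (embedded n (H n \<omega>)) \<partial>M)"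
proof -
  have M: "prob_space M" and H: "H n \<in> M \<rightarrow>\<^sub>M count_space (InHy n)"
    using ex k unfolding exchangeable_interval_hypergraph_def by auto
  interpret prob_space M by fact
  let ?E = "\<lambda>\<gamma>. {\<omega> \<in> space M. pull_back k \<gamma> (H n \<omega>) = g}"
  have ev: "?E \<gamma> \<in> events" for \<gamma>
  proof -
    have "?E \<gamma> = H n -` {h \<in> InHy n. pull_back k \<gamma> h = g} \<inter> space M"
      using measurable_space[OF H] by auto
    also have "\<dots> \<in> events" by (rule measurable_sets[OF H]) auto
    finally show ?thesis .
  qed
  have int: "integrable M (\<lambda>\<omega>. (1 / real n) ^ k * indicator (?E \<gamma>) \<omega> :: real)" for \<gamma>
    using ev by (intro integrable_mult_right integrable_real_indicator) (auto simp: emeasure_eq_measure)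
  have "real (card (injections k n)) * (1 / real n) ^ k * measure M {\<omega> \<in> space M. H k \<omega> = g} =
      (\<Sum>\<gamma>\<in>injections k n. (1 / real n) ^ k * prob (?E \<gamma>))"
    using prob_pull_back[OF ex k] by simp
  also have "\<dots> = (\<Sum>\<gamma>\<in>injections k n. \<integral>\<omega>. (1 / real n) ^ k * indicator (?E \<gamma>) \<omega> \<partial>M)"
    using ev by simp
  also have "\<dots> = (\<integral>\<omega>. (\<Sum>\<gamma>\<in>injections k n. (1 / real n) ^ k * indicator (?E \<gamma>) \<omega>) \<partial>M)"
    by (rule Bochner_Integration.integral_sum[symmetric]) (rule int)
  also have "\<dots> \<le> (\<integral>\<omega>. sample_prob k g (embedded n (H n \<omega>)) \<partial>M)"
  proof (rule integral_mono)
    show "integrable M (\<lambda>\<omega>. \<Sum>\<gamma>\<in>injections k n. (1 / real n) ^ k * indicator (?E \<gamma>) \<omega>)"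
      by (rule Bochner_Integration.integrable_sum) (rule int)
    have "(\<lambda>\<omega>. sample_prob k g (embedded n (H n \<omega>))) \<in> borel_measurable M"
      by (rule measurable_compose[OF H]) simp
    then show "integrable M (\<lambda>\<omega>. sample_prob k g (embedded n (H n \<omega>)))"
      using sample_prob_bounds by (intro integrable_const_bound[of _ 1]) auto
    fix \<omega> assume w: "\<omega> \<in> space M"
    then have h: "H n \<omega> \<in> InHy n" using measurable_space[OF H] by simp
    have "(\<Sum>\<gamma>\<in>injections k n. (1 / real n) ^ k * indicator (?E \<gamma>) \<omega>) =
        (\<Sum>\<gamma>\<in>injections k n. (1 / real n) ^ k * of_bool (pull_back k \<gamma> (H n \<omega>) = g))"
      using w by (intro sum.cong) (auto simp: indicator_def)
    with sample_prob_embedded_ge[OF h, of k g]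
    show "(\<Sum>\<gamma>\<in>injections k n. (1 / real n) ^ k * indicator (?E \<gamma>) \<omega>) \<le> sample_prob k g (embedded n (H n \<omega>))"
      by simp
  qed
  finally show ?thesis .
qed

text \<open>In the limit the lower bounds for the sampling probabilities lose their factor, and lower bounds that already
  sum to \<open>1\<close> are attained.\<close>

lemma limiting_random_compact_set:
  assumes ex: "exchangeable_interval_hypergraph M H"
  obtains \<Omega> :: "real measure" and L where "prob_space \<Omega>" "L \<in> \<Omega> \<rightarrow>\<^sub>M hausdorff_borel triangle"
    "\<And>\<omega>. \<omega> \<in> space \<Omega> \<Longrightarrow> diagonal \<subseteq> L \<omega>"
    "\<And>k g. k \<ge> 1 \<Longrightarrow> g \<in> InHy k \<Longrightarrow>
       (\<integral>\<omega>. sample_prob k g (L \<omega>) \<partial>\<Omega>) = measure M {\<omega> \<in> space M. H k \<omega> = g}"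
proof -
  have M: "prob_space M" and H: "\<And>n. n \<ge> 1 \<Longrightarrow> H n \<in> M \<rightarrow>\<^sub>M count_space (InHy n)"
    using ex unfolding exchangeable_interval_hypergraph_def by blast+
  interpret M: prob_space M by fact
  define X where "X n \<omega> = embedded (Suc n) (H (Suc n) \<omega>)" for n \<omega>
  define \<C> where "\<C> n = embedded (Suc n) ` InHy (Suc n)" for n
  define \<D> where "\<D> = {K \<in> nonempty_compacts triangle. diagonal \<subseteq> K}"
  have fin: "finite (\<C> n)" for n by (simp add: \<C>_def finite_InHy)
  have \<C>: "\<C> n \<subseteq> \<D>" for n
  proof -
    have "diagonal \<subseteq> embedded m h" for m h unfolding embedded_def by (rule Un_upper1)
    then show ?thesis using embedded_nonempty_compact unfolding \<C>_def \<D>_def by blast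
  qed
  have \<D>: "\<D> \<subseteq> nonempty_compacts triangle" by (auto simp: \<D>_def)
  have X: "X n \<in> M \<rightarrow>\<^sub>M count_space (\<C> n)" for n
    unfolding X_def[abs_def] by (rule measurable_compose[OF H]) (auto simp: \<C>_def)
  show ?thesis
  proof (rule compact_set_Skorohod[OF M fin \<C> \<D> X])
    fix r :: "nat \<Rightarrow> nat" and \<Omega> :: "real measure" and Z L
    assume r: "strict_mono r" and \<Omega>: "prob_space \<Omega>"
      and Z: "\<And>n. Z n \<in> \<Omega> \<rightarrow>\<^sub>M count_space \<D>"
      and int: "\<And>n f. (\<integral>\<omega>. f (Z n \<omega>) \<partial>\<Omega>) = (\<integral>\<omega>. f (X (r n) \<omega>) \<partial>M :: real)"
      and L: "\<And>\<omega>. \<omega> \<in> space \<Omega> \<Longrightarrow> L \<omega> \<in> nonempty_compacts triangle"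
      and lim: "\<And>\<omega>. \<omega> \<in> space \<Omega> \<Longrightarrow> (\<lambda>n. hausdorff_dist (Z n \<omega>) (L \<omega>)) \<longlonglongrightarrow> 0"
    interpret \<Omega>: prob_space \<Omega> by fact
    have ZD: "Z n \<omega> \<in> \<D>" if "\<omega> \<in> space \<Omega>" for n \<omega>
      using measurable_space[OF Z that] by simp
    have Z': "Z n \<in> \<Omega> \<rightarrow>\<^sub>M count_space (nonempty_compacts triangle)" for n
    proof (rule measurable_compose[OF Z])
      show "(\<lambda>K. K) \<in> count_space \<D> \<rightarrow>\<^sub>M count_space (nonempty_compacts triangle)"
        using \<D> by (simp add: subset_iff)
    qed
    have Lm: "L \<in> \<Omega> \<rightarrow>\<^sub>M hausdorff_borel triangle"
      by (rule measurable_hausdorff_limit[OF Z' L lim])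
    have diag: "diagonal \<subseteq> L \<omega>" if w: "\<omega> \<in> space \<Omega>" for \<omega>
      by (rule hausdorff_limit_superset[OF _ _ L[OF w] lim[OF w]]) (use ZD[OF w] in \<open>auto simp: \<D>_def\<close>)
    have sm: "(\<lambda>\<omega>. sample_prob k g (L \<omega>)) \<in> borel_measurable \<Omega>" for k g
      by (rule measurable_compose[OF Lm measurable_sample_prob])
    have si: "integrable \<Omega> (\<lambda>\<omega>. sample_prob k g (L \<omega>))" for k g
      using sm sample_prob_bounds by (intro \<Omega>.integrable_const_bound[of _ 1]) auto
    have conv: "(\<lambda>n. \<integral>\<omega>. sample_prob k g (X (r n) \<omega>) \<partial>M) \<longlonglongrightarrow> (\<integral>\<omega>. sample_prob k g (L \<omega>) \<partial>\<Omega>)" for k g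
    proof -
      have "(\<lambda>n. \<integral>\<omega>. sample_prob k g (Z n \<omega>) \<partial>\<Omega>) \<longlonglongrightarrow> (\<integral>\<omega>. sample_prob k g (L \<omega>) \<partial>\<Omega>)"
      proof (rule integral_dominated_convergence[where w = "\<lambda>_. 1"])
        show "(\<lambda>\<omega>. sample_prob k g (Z n \<omega>)) \<in> borel_measurable \<Omega>" for n
          by (rule measurable_compose[OF Z]) simp
        show "integrable \<Omega> (\<lambda>_. 1 :: real)" by (rule \<Omega>.integrable_const)
        show "AE \<omega> in \<Omega>. (\<lambda>n. sample_prob k g (Z n \<omega>)) \<longlonglongrightarrow> sample_prob k g (L \<omega>)"
        proof (rule AE_I2)
          fix \<omega> assume w: "\<omega> \<in> space \<Omega>"
          show "(\<lambda>n. sample_prob k g (Z n \<omega>)) \<longlonglongrightarrow> sample_prob k g (L \<omega>)"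
            by (rule sample_prob_continuous[OF _ L[OF w] lim[OF w]]) (use ZD[OF w] \<D> in blast)
        qed
        show "AE \<omega> in \<Omega>. norm (sample_prob k g (Z n \<omega>)) \<le> 1" for n
          using sample_prob_bounds by simp
      qed (rule sm)
      then show ?thesis by (simp only: int)
    qed
    have ge: "measure M {\<omega> \<in> space M. H k \<omega> = g} \<le> (\<integral>\<omega>. sample_prob k g (L \<omega>) \<partial>\<Omega>)" if k: "k \<ge> 1" for k g
    proof (rule tendsto_le[OF _ conv])
      have "(\<lambda>n. real (card (injections k n)) * (1 / real n) ^ k * measure M {\<omega> \<in> space M. H k \<omega> = g})
          \<longlonglongrightarrow> 1 * measure M {\<omega> \<in> space M. H k \<omega> = g}"
        by (intro tendsto_mult card_injections_ratio tendsto_const)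
      moreover have "filterlim (\<lambda>n. Suc (r n)) sequentially sequentially"
        by (rule filterlim_subseq) (use r in \<open>auto simp: strict_mono_def\<close>)
      ultimately show "(\<lambda>n. real (card (injections k (Suc (r n)))) * (1 / real (Suc (r n))) ^ k * measure M {\<omega> \<in> space M. H k \<omega> = g})
          \<longlonglongrightarrow> measure M {\<omega> \<in> space M. H k \<omega> = g}"
        unfolding mult_1 by (rule filterlim_compose)
      show "\<forall>\<^sub>F n in sequentially. real (card (injections k (Suc (r n)))) * (1 / real (Suc (r n))) ^ k * measure M {\<omega> \<in> space M. H k \<omega> = g}
          \<le> (\<integral>\<omega>. sample_prob k g (X (r n) \<omega>) \<partial>M)"
      proof (rule eventually_sequentiallyI[of k])
        fix n assume "k \<le> n"
        also have "n \<le> r n" by (rule seq_suble[OF r])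
        finally have "k \<le> Suc (r n)" by simp
        from expected_sample_prob_ge[OF ex k this]
        show "real (card (injections k (Suc (r n)))) * (1 / real (Suc (r n))) ^ k * measure M {\<omega> \<in> space M. H k \<omega> = g}
          \<le> (\<integral>\<omega>. sample_prob k g (X (r n) \<omega>) \<partial>M)" unfolding X_def .
      qed
    qed simp
    have eq: "(\<integral>\<omega>. sample_prob k g (L \<omega>) \<partial>\<Omega>) = measure M {\<omega> \<in> space M. H k \<omega> = g}"
      if k: "k \<ge> 1" and g: "g \<in> InHy k" for k g
    proof -
      have "(\<Sum>g\<in>InHy k. measure M {\<omega> \<in> space M. H k \<omega> = g}) = 1"
      proof -
        have "(\<Sum>g\<in>InHy k. measure M {\<omega> \<in> space M. H k \<omega> = g}) = measure M (\<Union>g\<in>InHy k. {\<omega> \<in> space M. H k \<omega> = g})"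
        proof (rule M.finite_measure_finite_Union[OF finite_InHy, symmetric])
          have "{\<omega> \<in> space M. H k \<omega> = g} \<in> sets M" if "g \<in> InHy k" for g
          proof -
            have "{\<omega> \<in> space M. H k \<omega> = g} = H k -` {g} \<inter> space M" by blast
            also have "\<dots> \<in> sets M" by (rule measurable_sets[OF H[OF k]]) (simp add: that)
            finally show ?thesis .
          qed
          then show "(\<lambda>g. {\<omega> \<in> space M. H k \<omega> = g}) ` InHy k \<subseteq> sets M" by blast
          show "disjoint_family_on (\<lambda>g. {\<omega> \<in> space M. H k \<omega> = g}) (InHy k)" unfolding disjoint_family_on_def by blast
        qed
        also have "(\<Union>g\<in>InHy k. {\<omega> \<in> space M. H k \<omega> = g}) = space M"
          using measurable_space[OF H[OF k]] by auto
        finally show ?thesis by (simp only: M.prob_space)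
      qed
      moreover have "(\<Sum>g\<in>InHy k. \<integral>\<omega>. sample_prob k g (L \<omega>) \<partial>\<Omega>) = 1"
      proof -
        have "(\<Sum>g\<in>InHy k. \<integral>\<omega>. sample_prob k g (L \<omega>) \<partial>\<Omega>) = (\<integral>\<omega>. (\<Sum>g\<in>InHy k. sample_prob k g (L \<omega>)) \<partial>\<Omega>)"
          by (rule Bochner_Integration.integral_sum[symmetric]) (rule si)
        also have "\<dots> = (\<integral>\<omega>. 1 \<partial>\<Omega>)"
          by (rule Bochner_Integration.integral_cong[OF refl]) (rule sum_sample_prob[OF L])
        finally show ?thesis by (simp add: \<Omega>.prob_space)
      qed
      ultimately have "(\<Sum>g\<in>InHy k. measure M {\<omega> \<in> space M. H k \<omega> = g}) = (\<Sum>g\<in>InHy k. \<integral>\<omega>. sample_prob k g (L \<omega>) \<partial>\<Omega>)"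
        by simp
      from sum_mono_inv[OF this _ g finite_InHy] ge[OF k] show ?thesis by simp
    qed
    from that[OF \<Omega> Lm diag eq] show ?thesis .
  qed
qed

section \<open>The representation theorem\<close>

theorem theorem1p5:
  fixes M :: "'a measure" and H :: "nat \<Rightarrow> 'a \<Rightarrow> nat set set"
  assumes "exchangeable_interval_hypergraph M H"
  shows "\<exists>(N :: ((real \<times> real) set \<times> (nat \<Rightarrow> real)) measure) K.
           prob_space N \<and>
           random_compact_set N K \<and>
           (\<forall>\<omega>\<in>space N. \<forall>x\<in>{0..1}. (x, x) \<in> K \<omega>) \<and>
           (\<exists>U. iid_uniform N U \<and> indep_of_sequence N K U) \<and>
           (\<forall>U. iid_uniform N U \<and> indep_of_sequence N K U \<longrightarrow>
              (\<forall>n\<ge>1. (\<lambda>\<omega>. sampled_hypergraph (K \<omega>) (\<lambda>i. U i \<omega>) n)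
                        \<in> N \<rightarrow>\<^sub>M count_space (InHy n)) \<and>
              process_law M H =
              process_law N (\<lambda>n \<omega>. sampled_hypergraph (K \<omega>) (\<lambda>i. U i \<omega>) n))"
proof -
  have M: "prob_space M" and H: "\<And>n. n \<ge> 1 \<Longrightarrow> H n \<in> M \<rightarrow>\<^sub>M count_space (InHy n)"
    and cons: "\<And>n. n \<ge> 1 \<Longrightarrow> AE \<omega> in M. H n \<omega> = restrict_hypergraph n (H (Suc n) \<omega>)"
    using assms unfolding exchangeable_interval_hypergraph_def by blast+
  interpret M: prob_space M by fact
  obtain \<Omega> :: "real measure" and L where \<Omega>: "prob_space \<Omega>" and Lm: "L \<in> \<Omega> \<rightarrow>\<^sub>M hausdorff_borel triangle"
    and diag: "\<And>\<omega>. \<omega> \<in> space \<Omega> \<Longrightarrow> diagonal \<subseteq> L \<omega>"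
    and law: "\<And>k g. k \<ge> 1 \<Longrightarrow> g \<in> InHy k \<Longrightarrow>
       (\<integral>\<omega>. sample_prob k g (L \<omega>) \<partial>\<Omega>) = measure M {\<omega> \<in> space M. H k \<omega> = g}"
    using limiting_random_compact_set[OF assms] by blast
  \<comment> \<open>Restricting the space makes the diagonal a subset of the random set at every point, not just almost surely.\<close>
  let ?R = "restrict_space (hausdorff_borel triangle) {K. diagonal \<subseteq> K}"
  have LR: "L \<in> \<Omega> \<rightarrow>\<^sub>M ?R" by (rule measurable_restrict_space2) (use Lm diag in auto)
  define \<Lambda> where "\<Lambda> = distr \<Omega> ?R L"
  interpret \<Lambda>: prob_space \<Lambda> unfolding \<Lambda>_def by (rule prob_space.prob_space_distr[OF \<Omega> LR])
  interpret P: pair_prob_space \<Lambda> uniform_seq ..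
  define N where "N = \<Lambda> \<Otimes>\<^sub>M uniform_seq"
  have N: "prob_space N" unfolding N_def by (rule P.prob_space_axioms)
  interpret N: prob_space N by (rule N)
  have idm: "(\<lambda>K. K) \<in> \<Lambda> \<rightarrow>\<^sub>M hausdorff_borel triangle"
  proof -
    have "(\<lambda>K. K) \<in> ?R \<rightarrow>\<^sub>M hausdorff_borel triangle"
      by (rule measurable_restrict_space1) (rule measurable_ident_sets[OF refl])
    then show ?thesis unfolding \<Lambda>_def by simp
  qed
  have fstm: "fst \<in> N \<rightarrow>\<^sub>M hausdorff_borel triangle"
    using measurable_compose[OF measurable_fst idm] unfolding N_def by simp
  have sndm: "snd \<in> N \<rightarrow>\<^sub>M uniform_seq" unfolding N_def by (rule measurable_snd)
  have rc: "random_compact_set N fst" using fstm by (simp add: random_compact_set_def)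
  have fst_law: "distr N \<Lambda> fst = \<Lambda>"
    unfolding N_def by (rule unif.P.distr_pair_fst)
  have rect: "emeasure N (fst -` A \<inter> snd -` B \<inter> space N) = emeasure \<Lambda> (A \<inter> space \<Lambda>) * emeasure uniform_seq B"
    if "A \<in> sets (hausdorff_borel triangle)" "B \<in> sets uniform_seq" for A B
  proof -
    have "(\<lambda>K. K) -` A \<inter> space \<Lambda> \<in> sets \<Lambda>" by (rule measurable_sets[OF idm that(1)])
    then have "A \<inter> space \<Lambda> \<in> sets \<Lambda>" by simp
    moreover have "fst -` A \<inter> snd -` B \<inter> space N = (A \<inter> space \<Lambda>) \<times> B"
      using sets.sets_into_space[OF that(2)] by (auto simp: N_def space_pair_measure)
    ultimately show ?thesis
      unfolding N_def using that(2) by (simp only: unif.P.emeasure_pair_measure_Times)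
  qed
  show ?thesis
  proof (intro exI[of _ N] exI[of _ fst] conjI)
    show "prob_space N" by (rule N)
    show "random_compact_set N fst" by (rule rc)
    show "\<forall>\<omega>\<in>space N. \<forall>x\<in>{0..1}. (x, x) \<in> fst \<omega>"
      by (auto simp: N_def \<Lambda>_def space_pair_measure space_restrict_space diagonal_def)
    show "\<exists>U. iid_uniform N U \<and> indep_of_sequence N fst U"
    proof (intro exI[of _ "\<lambda>i z. snd z i"] conjI)
      let ?V = "\<Pi>\<^sub>M i\<in>{1::nat..}. (borel :: real measure)"
      have sets_unif01: "sets unif01 = sets borel" by simp
      have rv: "(\<lambda>z. snd z i) \<in> borel_measurable N" if "i \<in> {1..}" for i
        using measurable_compose[OF sndm measurable_component_singleton[OF that]]
        by (simp only: measurable_cong_sets[OF refl sets_unif01])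
      have snd_law: "distr N uniform_seq snd = uniform_seq"
      proof (rule measure_eqI)
        fix B assume "B \<in> sets (distr N uniform_seq snd)"
        then have B: "B \<in> sets uniform_seq" by simp
        have "emeasure (distr N uniform_seq snd) B = emeasure N (snd -` B \<inter> space N)"
          by (rule emeasure_distr[OF sndm B])
        also have "snd -` B \<inter> space N = space \<Lambda> \<times> B"
          using sets.sets_into_space[OF B] by (auto simp: N_def space_pair_measure)
        also have "emeasure N (space \<Lambda> \<times> B) = emeasure uniform_seq B"
          unfolding N_def using B
          by (simp only: unif.P.emeasure_pair_measure_Times[OF sets.top] \<Lambda>.emeasure_space_1 mult_1)
        finally show "emeasure (distr N uniform_seq snd) B = emeasure uniform_seq B" .
      qed simp
      have marg: "distr N borel (\<lambda>z. snd z i) = unif01" if i: "i \<in> {1..}" for i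
      proof -
        have "distr N borel (\<lambda>z. snd z i) = distr N unif01 (\<lambda>z. snd z i)"
          by (rule distr_cong) auto
        also have "\<dots> = distr (distr N uniform_seq snd) unif01 (\<lambda>u. u i)"
          by (subst distr_distr[OF measurable_component_singleton[OF i] sndm]) (simp add: comp_def)
        also have "\<dots> = unif01" unfolding snd_law by (rule unif.PiM_component[OF i])
        finally show ?thesis .
      qed
      have res: "(\<lambda>i\<in>{1..}. snd z i) = snd z" if "z \<in> space N" for z
        using measurable_space[OF sndm that] by (auto simp: space_PiM PiE_restrict)
      have "distr N ?V (\<lambda>z. \<lambda>i\<in>{1..}. snd z i) = distr N uniform_seq snd"
        by (rule distr_cong[OF refl sets_uniform_seq[symmetric] res])
      also have "\<dots> = (\<Pi>\<^sub>M i\<in>{1..}. distr N borel (\<lambda>z. snd z i))"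
        unfolding snd_law by (rule PiM_cong) (auto simp: marg)
      finally have "N.indep_vars (\<lambda>_. borel) (\<lambda>i z. snd z i) {1..}"
        by (subst N.indep_vars_iff_distr_eq_PiM') (use rv in auto)
      then show iid: "iid_uniform N (\<lambda>i z. snd z i)" using marg by (simp add: iid_uniform_def)
      have um: "(\<lambda>z. \<lambda>i\<in>{1..}. snd z i) \<in> N \<rightarrow>\<^sub>M ?V" by (rule iid_uniform_law(1)[OF N iid])
      show "indep_of_sequence N fst (\<lambda>i z. snd z i)"
        unfolding indep_of_sequence_def
      proof (rule N.indep_setI)
        have v1: "sets (vimage_algebra (space N) fst (hausdorff_borel triangle)) =
            {fst -` A \<inter> space N | A. A \<in> sets (hausdorff_borel triangle)}"
          by (rule sets_vimage_algebra2) (use measurable_space[OF fstm] in blast)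
        have v2: "sets (vimage_algebra (space N) (\<lambda>z. \<lambda>i\<in>{1..}. snd z i) ?V) =
            {(\<lambda>z. \<lambda>i\<in>{1..}. snd z i) -` B \<inter> space N | B. B \<in> sets ?V}"
          by (rule sets_vimage_algebra2) (use measurable_space[OF um] in blast)
        show "sets (vimage_algebra (space N) fst (hausdorff_borel triangle)) \<subseteq> N.events"
          unfolding v1 using measurable_sets[OF fstm] by blast
        show "sets (vimage_algebra (space N) (\<lambda>z. \<lambda>i\<in>{1..}. snd z i) ?V) \<subseteq> N.events"
          unfolding v2 using measurable_sets[OF um] by blast
        fix a b assume "a \<in> sets (vimage_algebra (space N) fst (hausdorff_borel triangle))"
          and "b \<in> sets (vimage_algebra (space N) (\<lambda>z. \<lambda>i\<in>{1..}. snd z i) ?V)"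
        then obtain A B where A: "A \<in> sets (hausdorff_borel triangle)" "a = fst -` A \<inter> space N"
          and B: "B \<in> sets ?V" "b = (\<lambda>z. \<lambda>i\<in>{1..}. snd z i) -` B \<inter> space N"
          unfolding v1 v2 by blast
        have B': "B \<in> sets uniform_seq" using B(1) by (simp only: sets_uniform_seq)
        have b: "b = snd -` B \<inter> space N" unfolding B(2) using res by auto
        have top: "space N = fst -` space (hausdorff_borel triangle) \<inter> space N" "space N = snd -` space uniform_seq \<inter> space N"
          using measurable_space[OF fstm] measurable_space[OF sndm] by blast+
        have sp\<Lambda>: "space (hausdorff_borel triangle) \<inter> space \<Lambda> = space \<Lambda>"
          by (auto simp: \<Lambda>_def space_restrict_space)
        have "emeasure N (a \<inter> b) = emeasure \<Lambda> (A \<inter> space \<Lambda>) * emeasure uniform_seq B"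
        proof -
          have "a \<inter> b = fst -` A \<inter> snd -` B \<inter> space N" unfolding A(2) b by blast
          then show ?thesis by (simp only: rect[OF A(1) B'])
        qed
        moreover have "emeasure N a = emeasure \<Lambda> (A \<inter> space \<Lambda>)"
        proof -
          have "a = fst -` A \<inter> snd -` space uniform_seq \<inter> space N" unfolding A(2) using top(2) by blast
          then show ?thesis by (simp only: rect[OF A(1) sets.top] unif.P.emeasure_space_1 mult_1_right)
        qed
        moreover have "emeasure N b = emeasure uniform_seq B"
        proof -
          have "b = fst -` space (hausdorff_borel triangle) \<inter> snd -` B \<inter> space N" unfolding b using top(1) by blast
          then show ?thesis by (simp only: rect[OF sets.top B'] sp\<Lambda> \<Lambda>.emeasure_space_1 mult_1)
        qed
        ultimately have "emeasure N (a \<inter> b) = emeasure N a * emeasure N b" by simp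
        then show "N.prob (a \<inter> b) = N.prob a * N.prob b"
          by (simp add: measure_def enn2real_mult)
      qed
    qed
    show "\<forall>U. iid_uniform N U \<and> indep_of_sequence N fst U \<longrightarrow>
        (\<forall>n\<ge>1. (\<lambda>\<omega>. sampled_hypergraph (fst \<omega>) (\<lambda>i. U i \<omega>) n) \<in> N \<rightarrow>\<^sub>M count_space (InHy n)) \<and>
        process_law M H = process_law N (\<lambda>n \<omega>. sampled_hypergraph (fst \<omega>) (\<lambda>i. U i \<omega>) n)"
    proof (intro allI impI conjI, elim conjE)
      fix U and n :: nat assume "iid_uniform N U"
      then show "(\<lambda>\<omega>. sampled_hypergraph (fst \<omega>) (\<lambda>i. U i \<omega>) n) \<in> N \<rightarrow>\<^sub>M count_space (InHy n)"
        by (rule measurable_sampled_process[OF N rc])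
    next
      fix U assume U: "iid_uniform N U \<and> indep_of_sequence N fst U"
      note sm = measurable_sampled_process[OF N rc conjunct1[OF U]]
      show "process_law M H = process_law N (\<lambda>n \<omega>. sampled_hypergraph (fst \<omega>) (\<lambda>i. U i \<omega>) n)"
      proof (rule process_law_eqI[OF M])
        show "H n \<in> M \<rightarrow>\<^sub>M count_space (InHy n)" "AE \<omega> in M. H n \<omega> = restrict_hypergraph n (H (Suc n) \<omega>)"
          if "n \<ge> 1" for n using H[OF that] cons[OF that] .
        show "(\<lambda>\<omega>. sampled_hypergraph (fst \<omega>) (\<lambda>i. U i \<omega>) n) \<in> N \<rightarrow>\<^sub>M count_space (InHy n)" for n
          by (rule sm)
        show "AE \<omega> in N. sampled_hypergraph (fst \<omega>) (\<lambda>i. U i \<omega>) n =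
            restrict_hypergraph n (sampled_hypergraph (fst \<omega>) (\<lambda>i. U i \<omega>) (Suc n))" for n
          by (simp add: restrict_sampled_hypergraph)
        fix n :: nat assume n: "n \<ge> 1"
        show "distr M (count_space (InHy n)) (H n) =
            distr N (count_space (InHy n)) (\<lambda>\<omega>. sampled_hypergraph (fst \<omega>) (\<lambda>i. U i \<omega>) n)"
        proof (rule measure_eqI_finite[OF _ _ finite_InHy])
          fix g assume g: "g \<in> InHy n"
          have sp: "sample_prob n g \<in> borel_measurable ?R"
            by (rule measurable_restrict_space1[OF measurable_sample_prob])
          have "emeasure (distr M (count_space (InHy n)) (H n)) {g} = emeasure M (H n -` {g} \<inter> space M)"
            using g by (intro emeasure_distr[OF H[OF n]]) auto
          also have "H n -` {g} \<inter> space M = {\<omega> \<in> space M. H n \<omega> = g}" by blast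
          also have "emeasure M \<dots> = ennreal (\<integral>\<omega>. sample_prob n g (L \<omega>) \<partial>\<Omega>)"
            by (simp only: M.emeasure_eq_measure law[OF n g])
          also have "(\<integral>\<omega>. sample_prob n g (L \<omega>) \<partial>\<Omega>) = (\<integral>K. sample_prob n g K \<partial>\<Lambda>)"
            unfolding \<Lambda>_def by (rule integral_distr[OF LR sp, symmetric])
          also have "\<dots> = (\<integral>K. sample_prob n g K \<partial>distr N \<Lambda> fst)" by (simp only: fst_law)
          also have "\<dots> = (\<integral>\<omega>. sample_prob n g (fst \<omega>) \<partial>N)"
            by (rule integral_distr) (use sp in \<open>simp_all add: N_def \<Lambda>_def\<close>)
          also have "ennreal \<dots> = emeasure (distr N (count_space (InHy n)) (\<lambda>\<omega>. sampled_hypergraph (fst \<omega>) (\<lambda>i. U i \<omega>) n)) {g}"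
            by (rule prob_sampled_eq[OF N rc conjunct1[OF U] conjunct2[OF U] g, symmetric])
          finally show "emeasure (distr M (count_space (InHy n)) (H n)) {g} =
              emeasure (distr N (count_space (InHy n)) (\<lambda>\<omega>. sampled_hypergraph (fst \<omega>) (\<lambda>i. U i \<omega>) n)) {g}" .
        qed simp_all
      qed
    qed
  qed
qed

end
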